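(* Let $e:(\mathfrak m,\alpha_{\mathfrak m})\rightarrowtail(\mathfrak k,\alpha_{\mathfrak k})\twoheadrightarrow(\mathfrak g,\alpha_{\mathfrak g})$ be an extension (short exact sequence) of Hom-Leibniz algebras over a field $\mathbb K$. Let $(\mathfrak r,\alpha_{\mathfrak r})\rightarrowtail(\mathfrak f,\alpha_{\mathfrak f})\twoheadrightarrow(\mathfrak k,\alpha_{\mathfrak k})$ be a free presentation of $(\mathfrak k,\alpha_{\mathfrak k})$ and let $(\mathfrak s,\alpha_{\mathfrak s})$ be the ideal of $(\mathfrak f,\alpha_{\mathfrak f})$ containing $\mathfrak r$ such that $(\mathfrak m,\alpha_{\mathfrak m})\cong(\mathfrak s/\mathfrak r,\bar\alpha_{\mathfrak s})$ under the identification $\mathfrak k\cong\mathfrak f/\mathfrak r$. Then there is an exact sequence of Hom-vector spaces $$\ker(\mathfrak r\curlywedge\mathfrak f\to\mathfrak f)\to\ker(\mathfrak s\curlywedge\mathfrak f\to\mathfrak f)\to\ker(\mathfrak m\curlywedge\mathfrak k\to\mathfrak k)\to HL_2^\alpha(\mathfrak k)\to HL_2^\alpha(\mathfrak g)\to\frac{\mathfrak m}{[\mathfrak m,\mathfrak k]}\to HL_1^\alpha(\mathfrak k)\twoheadrightarrow HL_1^\alpha(\mathfrak g),$$ where the kernels carry the restrictions of $\alpha_{\mathfrak r\curlywedge\mathfrak f}$, $\alpha_{\mathfrak s\curlywedge\mathfrak f}$, $\alpha_{\mathfrak m\curlywedge\mathfrak k}$ and $\mathfrak m/[\mathfrak m,\mathfrak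 k]$ carries the map induced by $\alpha_{\mathfrak m}$. Moreover, if the extension $e$ is split, then this sequence induces a short exact sequence $$\ker(\mathfrak m\curlywedge\mathfrak k\to\mathfrak k)\rightarrowtail HL_2^\alpha(\mathfrak k)\twoheadrightarrow HL_2^\alpha(\mathfrak g).$$
   Context: All vector spaces and linear maps are over a fixed field $\mathbb K$. A (multiplicative) Hom-Leibniz algebra $(\mathfrak g,\alpha_{\mathfrak g})$ is a vector space $\mathfrak g$ with a bilinear product $[\,,]$ and a linear map $\alpha_{\mathfrak g}$ such that $[\alpha_{\mathfrak g}(x),[y,z]]=[[x,y],\alpha_{\mathfrak g}(z)]-[[x,z],\alpha_{\mathfrak g}(y)]$ and $\alpha_{\mathfrak g}([x,y])=[\alpha_{\mathfrak g}(x),\alpha_{\mathfrak g}(y)]$. A Hom-vector space is a vector space with a linear self-map; homomorphisms are linear maps (preserving products, in the algebra case) commuting with the self-maps. An ideal is an $\alpha_{\mathfrak g}$-invariant subspace $\mathfrak h$ with $[\mathfrak h,\mathfrak g],[\mathfrak g,\mathfrak h]\subseteq\mathfrak h$. For ideals $\mathfrak h,\mathfrak k$, $[\mathfrak h,\mathfrak k]$ is the subalgebra generated by all $[h,k],[k,h]$. A short exact sequence $\mathfrak m\rightarrowtail\mathfrak k\twoheadrightarrow\mathfrak g$ is split if $\mathfrak k\to\mathfrak g$ has a section that is a homomorphism of Hom-Leibniz algebras; $\mathfrak m$ is identified with an ideal of $\mathfrak k$. Free: $(\mathfrak f,\alpha_{\mathfrak f})$ is free over a Hom-vector space $(\mathfrak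 v,\alpha_{\mathfrak v})$ if it comes with a homomorphism of Hom-vector spaces $\mathfrak v\to\mathfrak f$ through which every homomorphism of Hom-vector spaces from $\mathfrak v$ to a Hom-Leibniz algebra factors by a unique homomorphism of Hom-Leibniz algebras. A free presentation of $\mathfrak k$ is a short exact sequence $\mathfrak r\rightarrowtail\mathfrak f\twoheadrightarrow\mathfrak k$ with $\mathfrak f$ free. Exterior product of two ideals $\mathfrak m,\mathfrak n$ of a Hom-Leibniz algebra (brackets and $\alpha$ taken in the big algebra): the tensor product $\mathfrak m\ast\mathfrak n$ is the Hom-Leibniz algebra generated by two formally distinct families of symbols, $m\ast n$ and $n\ast' m$ ($m\in\mathfrak m,n\in\mathfrak n$), both bilinear, subject to (for all $m,m'\in\mathfrak m$, $n,n'\in\mathfrak n$): $\alpha(m)\ast[m',n]=-\alpha(m)\ast[n,m']$; $\alpha(n)\ast'[n',m]=-\alpha(n)\ast'[m,n']$; $\alpha(m)\ast[n,n']=[m,n]\ast\alpha(n')-[m,n']\ast\alpha(n)$; $\alpha(n)\ast'[m,m']=[n,m]\ast'\alpha(m')-[n,m']\ast'\alpha(m)$; $[m,m']\ast\alpha(n)=[m,n]\ast'\alpha(m')-\alpha(m)\ast[n,m']$; $[n,n']\ast'\alpha(m)=[n,m]\ast\alpha(n')-\alpha(n)\ast'[m,n']$; $[m,n]\ast[m',n']=[m\ast n,m'\ast n']=[m,n]\ast'[m',n']$; $[n,m]\ast[n',m']=[n\ast' m,n'\ast' m']=[n,m]\ast'[n',m']$; $[m,n]\ast[n',m']=[m\ast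 n,n'\ast' m']=[m,n]\ast'[n',m']$; $[n,m]\ast[m',n']=[n\ast' m,m'\ast n']=[n,m]\ast'[m',n']$; with $\alpha(m\ast n)=\alpha(m)\ast\alpha(n)$, $\alpha(n\ast' m)=\alpha(n)\ast'\alpha(m)$. The exterior product $\mathfrak m\curlywedge\mathfrak n$ is the quotient of $\mathfrak m\ast\mathfrak n$ by the span of all $x\ast y-x\ast' y$, $x,y\in\mathfrak m\cap\mathfrak n$; images of $m\ast n$, $n\ast' m$ are written $m\curlywedge n$, $n\curlywedge m$. The maps $\mathfrak r\curlywedge\mathfrak f\to\mathfrak f$, $\mathfrak s\curlywedge\mathfrak f\to\mathfrak f$, $\mathfrak m\curlywedge\mathfrak k\to\mathfrak k$ are $a\curlywedge b\mapsto[a,b]$, $b\curlywedge a\mapsto[b,a]$. Homology: let $CL_n^\alpha(\mathfrak g)=(\mathfrak g^{\otimes n},\alpha_{\mathfrak g}^{\otimes n})$ with $$d_n(x_1\otimes\dots\otimes x_n)=\sum_{1\le i<j\le n}(-1)^{j+1}\alpha_{\mathfrak g}(x_1)\otimes\dots\otimes\alpha_{\mathfrak g}(x_{i-1})\otimes[x_i,x_j]\otimes\alpha_{\mathfrak g}(x_{i+1})\otimes\dots\otimes\widehat{\alpha_{\mathfrak g}(x_j)}\otimes\dots\otimes\alpha_{\mathfrak g}(x_n)$$ (hat means omitted, $d_1=0$). Then $HL_n^\alpha(\mathfrak g)=\ker(d_n)/\mathrm{Im}(d_{n+1})$ with the induced self-map; $HL_1^\alpha(\mathfrak g)\cong\mathfrak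 g/[\mathfrak g,\mathfrak g]$. *)

theory Defs
  imports "HOL-Algebra.Module" "HOL-Algebra.AbelCoset"
begin

section \<open>Hom-vector spaces and Hom-Leibniz algebras\<close>

text \<open>Modules of HOL-Algebra (a carrier inside a type) are extended by the self-map and the product.
  The record fields \<^const>\<open>mult\<close> and \<^const>\<open>one\<close>, which the module record inherits from the ring
  record, play no role; the product is the separate field \<open>bracket\<close>.\<close>

record ('a, 'b) hom_space = "('a, 'b) module" +
  twist :: "'b \<Rightarrow> 'b"

record ('a, 'b) hom_alg = "('a, 'b) hom_space" +
  bracket :: "'b \<Rightarrow> 'b \<Rightarrow> 'b"  (\<open>\<langle>_,/ _\<rangle>\<index>\<close>)

locale hom_vector_space = field K + module K V for K (structure) and V (structure) +
  assumes twist_closed: "x \<in> carrier V \<Longrightarrow> twist V x \<in> carrier V"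
    and twist_add: "\<lbrakk>x \<in> carrier V; y \<in> carrier V\<rbrakk>
      \<Longrightarrow> twist V (x \<oplus>\<^bsub>V\<^esub> y) = twist V x \<oplus>\<^bsub>V\<^esub> twist V y"
    and twist_smult: "\<lbrakk>c \<in> carrier K; x \<in> carrier V\<rbrakk>
      \<Longrightarrow> twist V (c \<odot>\<^bsub>V\<^esub> x) = c \<odot>\<^bsub>V\<^esub> twist V x"

locale hom_leibniz = hom_vector_space K L for K (structure) and L (structure) +
  assumes bracket_closed: "\<lbrakk>x \<in> carrier L; y \<in> carrier L\<rbrakk> \<Longrightarrow> \<langle>x, y\<rangle>\<^bsub>L\<^esub> \<in> carrier L"
    and bracket_add_left: "\<lbrakk>x \<in> carrier L; y \<in> carrier L; z \<in> carrier L\<rbrakk>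
      \<Longrightarrow> \<langle>x \<oplus>\<^bsub>L\<^esub> y, z\<rangle>\<^bsub>L\<^esub> = \<langle>x, z\<rangle>\<^bsub>L\<^esub> \<oplus>\<^bsub>L\<^esub> \<langle>y, z\<rangle>\<^bsub>L\<^esub>"
    and bracket_add_right: "\<lbrakk>x \<in> carrier L; y \<in> carrier L; z \<in> carrier L\<rbrakk>
      \<Longrightarrow> \<langle>x, y \<oplus>\<^bsub>L\<^esub> z\<rangle>\<^bsub>L\<^esub> = \<langle>x, y\<rangle>\<^bsub>L\<^esub> \<oplus>\<^bsub>L\<^esub> \<langle>x, z\<rangle>\<^bsub>L\<^esub>"
    and bracket_smult_left: "\<lbrakk>c \<in> carrier K; x \<in> carrier L; y \<in> carrier L\<rbrakk>
      \<Longrightarrow> \<langle>c \<odot>\<^bsub>L\<^esub> x, y\<rangle>\<^bsub>L\<^esub> = c \<odot>\<^bsub>L\<^esub> \<langle>x, y\<rangle>\<^bsub>L\<^esub>"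
    and bracket_smult_right: "\<lbrakk>c \<in> carrier K; x \<in> carrier L; y \<in> carrier L\<rbrakk>
      \<Longrightarrow> \<langle>x, c \<odot>\<^bsub>L\<^esub> y\<rangle>\<^bsub>L\<^esub> = c \<odot>\<^bsub>L\<^esub> \<langle>x, y\<rangle>\<^bsub>L\<^esub>"
    and hom_leibniz_identity: "\<lbrakk>x \<in> carrier L; y \<in> carrier L; z \<in> carrier L\<rbrakk>
      \<Longrightarrow> \<langle>twist L x, \<langle>y, z\<rangle>\<^bsub>L\<^esub>\<rangle>\<^bsub>L\<^esub>
        = \<langle>\<langle>x, y\<rangle>\<^bsub>L\<^esub>, twist L z\<rangle>\<^bsub>L\<^esub> \<ominus>\<^bsub>L\<^esub> \<langle>\<langle>x, z\<rangle>\<^bsub>L\<^esub>, twist L y\<rangle>\<^bsub>L\<^esub>"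
    and twist_bracket: "\<lbrakk>x \<in> carrier L; y \<in> carrier L\<rbrakk>
      \<Longrightarrow> twist L \<langle>x, y\<rangle>\<^bsub>L\<^esub> = \<langle>twist L x, twist L y\<rangle>\<^bsub>L\<^esub>"

definition hs_hom ::
  "('k, 'z) ring_scheme \<Rightarrow> ('k, 'a, 'm) hom_space_scheme \<Rightarrow> ('k, 'b, 'n) hom_space_scheme \<Rightarrow> ('a \<Rightarrow> 'b) set"
  where "hs_hom K V W = {f. f \<in> carrier V \<rightarrow> carrier W
    \<and> (\<forall>x\<in>carrier V. \<forall>y\<in>carrier V. f (x \<oplus>\<^bsub>V\<^esub> y) = f x \<oplus>\<^bsub>W\<^esub> f y)
    \<and> (\<forall>c\<in>carrier K. \<forall>x\<in>carrier V. f (c \<odot>\<^bsub>V\<^esub> x) = c \<odot>\<^bsub>W\<^esub> f x)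
    \<and> (\<forall>x\<in>carrier V. f (twist V x) = twist W (f x))}"

definition hl_hom ::
  "('k, 'z) ring_scheme \<Rightarrow> ('k, 'a, 'm) hom_alg_scheme \<Rightarrow> ('k, 'b, 'n) hom_alg_scheme \<Rightarrow> ('a \<Rightarrow> 'b) set"
  where "hl_hom K A B = {f \<in> hs_hom K A B.
    \<forall>x\<in>carrier A. \<forall>y\<in>carrier A. f \<langle>x, y\<rangle>\<^bsub>A\<^esub> = \<langle>f x, f y\<rangle>\<^bsub>B\<^esub>}"

definition hl_ideal :: "('k, 'z) ring_scheme \<Rightarrow> ('k, 'a, 'm) hom_alg_scheme \<Rightarrow> 'a set \<Rightarrow> bool"
  where "hl_ideal K L H \<longleftrightarrow> submodule H K L \<and> twist L ` H \<subseteq> H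
    \<and> (\<forall>h\<in>H. \<forall>x\<in>carrier L. \<langle>h, x\<rangle>\<^bsub>L\<^esub> \<in> H \<and> \<langle>x, h\<rangle>\<^bsub>L\<^esub> \<in> H)"

definition hl_subalgebra :: "('k, 'z) ring_scheme \<Rightarrow> ('k, 'a, 'm) hom_alg_scheme \<Rightarrow> 'a set \<Rightarrow> bool"
  where "hl_subalgebra K L S \<longleftrightarrow> submodule S K L \<and> twist L ` S \<subseteq> S
    \<and> (\<forall>x\<in>S. \<forall>y\<in>S. \<langle>x, y\<rangle>\<^bsub>L\<^esub> \<in> S)"

definition ideal_commutator ::
  "('k, 'z) ring_scheme \<Rightarrow> ('k, 'a, 'm) hom_alg_scheme \<Rightarrow> 'a set \<Rightarrow> 'a set \<Rightarrow> 'a set"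
  where "ideal_commutator K L H J = \<Inter>{S. hl_subalgebra K L S
    \<and> (\<forall>h\<in>H. \<forall>j\<in>J. \<langle>h, j\<rangle>\<^bsub>L\<^esub> \<in> S \<and> \<langle>j, h\<rangle>\<^bsub>L\<^esub> \<in> S)}"

definition hs_span :: "('k, 'z) ring_scheme \<Rightarrow> ('k, 'a, 'm) hom_space_scheme \<Rightarrow> 'a set \<Rightarrow> 'a set"
  where "hs_span K V S = \<Inter>{W. submodule W K V \<and> S \<subseteq> W}"

text \<open>A subspace \<open>S\<close> of \<open>V\<close>, with the restricted operations, is \<open>V\<lparr>carrier := S\<rparr>\<close>.
  Elements of a quotient are cosets, with the operations as in \<^const>\<open>A_RCOSETS\<close>,
  \<^const>\<open>set_add\<close>.\<close>

definition hs_quot :: "('k, 'a, 'm) hom_space_scheme \<Rightarrow> 'a set \<Rightarrow> ('k, 'a set) hom_space"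
  where "hs_quot V B = \<lparr>carrier = a_rcosets\<^bsub>V\<^esub> B, mult = undefined, one = undefined,
    zero = B, add = set_add V,
    smult = (\<lambda>c A. \<Union>a\<in>A. B +>\<^bsub>V\<^esub> (c \<odot>\<^bsub>V\<^esub> a)),
    twist = (\<lambda>A. \<Union>a\<in>A. B +>\<^bsub>V\<^esub> twist V a)\<rparr>"

definition hl_quot :: "('k, 'a, 'm) hom_alg_scheme \<Rightarrow> 'a set \<Rightarrow> ('k, 'a set) hom_alg"
  where "hl_quot L B = \<lparr>carrier = a_rcosets\<^bsub>L\<^esub> B, mult = undefined, one = undefined,
    zero = B, add = set_add L,
    smult = (\<lambda>c A. \<Union>a\<in>A. B +>\<^bsub>L\<^esub> (c \<odot>\<^bsub>L\<^esub> a)),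
    twist = (\<lambda>A. \<Union>a\<in>A. B +>\<^bsub>L\<^esub> twist L a),
    bracket = (\<lambda>A A'. \<Union>a\<in>A. \<Union>a'\<in>A'. B +>\<^bsub>L\<^esub> \<langle>a, a'\<rangle>\<^bsub>L\<^esub>)\<rparr>"

definition exact_at ::
  "('k, 'a, 'l) hom_space_scheme \<Rightarrow> ('a \<Rightarrow> 'b) \<Rightarrow> ('k, 'b, 'm) hom_space_scheme
    \<Rightarrow> ('b \<Rightarrow> 'c) \<Rightarrow> ('k, 'c, 'n) hom_space_scheme \<Rightarrow> bool"
  where "exact_at U f V g W \<longleftrightarrow> f ` carrier U = a_kernel V W g"

definition hl_short_exact ::
  "('k, 'z) ring_scheme \<Rightarrow> ('k, 'a) hom_alg \<Rightarrow> ('a \<Rightarrow> 'b) \<Rightarrow> ('k, 'b) hom_alg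
    \<Rightarrow> ('b \<Rightarrow> 'c) \<Rightarrow> ('k, 'c) hom_alg \<Rightarrow> bool"
  where "hl_short_exact K M i L p G \<longleftrightarrow>
    hom_leibniz K M \<and> hom_leibniz K L \<and> hom_leibniz K G
    \<and> i \<in> hl_hom K M L \<and> p \<in> hl_hom K L G
    \<and> inj_on i (carrier M) \<and> exact_at M i L p G \<and> p ` carrier L = carrier G"

definition hl_split ::
  "('k, 'z) ring_scheme \<Rightarrow> ('k, 'b) hom_alg \<Rightarrow> ('b \<Rightarrow> 'c) \<Rightarrow> ('k, 'c) hom_alg \<Rightarrow> bool"
  where "hl_split K L p G \<longleftrightarrow> (\<exists>\<sigma>\<in>hl_hom K G L. \<forall>x\<in>carrier G. p (\<sigma> x) = x)"


section \<open>Hom-Leibniz algebras given by generators and relations\<close>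

datatype ('k, 'x) hl_term =
    HGen 'x
  | HZero
  | HAdd "('k, 'x) hl_term" "('k, 'x) hl_term"
  | HSmult 'k "('k, 'x) hl_term"
  | HBr "('k, 'x) hl_term" "('k, 'x) hl_term"
  | HTw "('k, 'x) hl_term"

inductive_set hl_terms :: "('k, 'z) ring_scheme \<Rightarrow> 'x set \<Rightarrow> ('k, 'x) hl_term set"
  for K (structure) and X where
    "x \<in> X \<Longrightarrow> HGen x \<in> hl_terms K X"
  | "HZero \<in> hl_terms K X"
  | "\<lbrakk>s \<in> hl_terms K X; t \<in> hl_terms K X\<rbrakk> \<Longrightarrow> HAdd s t \<in> hl_terms K X"
  | "\<lbrakk>c \<in> carrier K; t \<in> hl_terms K X\<rbrakk> \<Longrightarrow> HSmult c t \<in> hl_terms K X"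
  | "\<lbrakk>s \<in> hl_terms K X; t \<in> hl_terms K X\<rbrakk> \<Longrightarrow> HBr s t \<in> hl_terms K X"
  | "t \<in> hl_terms K X \<Longrightarrow> HTw t \<in> hl_terms K X"

primrec hl_eval :: "('k, 'b, 'm) hom_alg_scheme \<Rightarrow> ('x \<Rightarrow> 'b) \<Rightarrow> ('k, 'x) hl_term \<Rightarrow> 'b" where
    "hl_eval A \<phi> (HGen x) = \<phi> x"
  | "hl_eval A \<phi> HZero = \<zero>\<^bsub>A\<^esub>"
  | "hl_eval A \<phi> (HAdd s t) = hl_eval A \<phi> s \<oplus>\<^bsub>A\<^esub> hl_eval A \<phi> t"
  | "hl_eval A \<phi> (HSmult c t) = c \<odot>\<^bsub>A\<^esub> hl_eval A \<phi> t"
  | "hl_eval A \<phi> (HBr s t) = \<langle>hl_eval A \<phi> s, hl_eval A \<phi> t\<rangle>\<^bsub>A\<^esub>"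
  | "hl_eval A \<phi> (HTw t) = twist A (hl_eval A \<phi> t)"

abbreviation HMinus :: "('k, 'z) ring_scheme \<Rightarrow> ('k, 'x) hl_term \<Rightarrow> ('k, 'x) hl_term"
  where "HMinus K t \<equiv> HSmult (\<ominus>\<^bsub>K\<^esub> \<one>\<^bsub>K\<^esub>) t"

abbreviation HDiff ::
  "('k, 'z) ring_scheme \<Rightarrow> ('k, 'x) hl_term \<Rightarrow> ('k, 'x) hl_term \<Rightarrow> ('k, 'x) hl_term"
  where "HDiff K s t \<equiv> HAdd s (HMinus K t)"

text \<open>The congruence on terms generated by the relations \<open>R\<close> and the axioms of Hom-Leibniz algebras.\<close>

inductive_set hl_cong ::
  "('k, 'z) ring_scheme \<Rightarrow> 'x set \<Rightarrow> (('k, 'x) hl_term \<times> ('k, 'x) hl_term) set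
    \<Rightarrow> (('k, 'x) hl_term \<times> ('k, 'x) hl_term) set"
  for K (structure) and X and R where
    relation: "\<lbrakk>(s, t) \<in> R; s \<in> hl_terms K X; t \<in> hl_terms K X\<rbrakk> \<Longrightarrow> (s, t) \<in> hl_cong K X R"
  | refl: "t \<in> hl_terms K X \<Longrightarrow> (t, t) \<in> hl_cong K X R"
  | sym: "(s, t) \<in> hl_cong K X R \<Longrightarrow> (t, s) \<in> hl_cong K X R"
  | trans: "\<lbrakk>(s, t) \<in> hl_cong K X R; (t, u) \<in> hl_cong K X R\<rbrakk> \<Longrightarrow> (s, u) \<in> hl_cong K X R"
  | cong_add: "\<lbrakk>(s, s') \<in> hl_cong K X R; (t, t') \<in> hl_cong K X R\<rbrakk>
      \<Longrightarrow> (HAdd s t, HAdd s' t') \<in> hl_cong K X R"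
  | cong_smult: "\<lbrakk>c \<in> carrier K; (t, t') \<in> hl_cong K X R\<rbrakk>
      \<Longrightarrow> (HSmult c t, HSmult c t') \<in> hl_cong K X R"
  | cong_br: "\<lbrakk>(s, s') \<in> hl_cong K X R; (t, t') \<in> hl_cong K X R\<rbrakk>
      \<Longrightarrow> (HBr s t, HBr s' t') \<in> hl_cong K X R"
  | cong_tw: "(t, t') \<in> hl_cong K X R \<Longrightarrow> (HTw t, HTw t') \<in> hl_cong K X R"
  | add_assoc: "\<lbrakk>s \<in> hl_terms K X; t \<in> hl_terms K X; u \<in> hl_terms K X\<rbrakk>
      \<Longrightarrow> (HAdd (HAdd s t) u, HAdd s (HAdd t u)) \<in> hl_cong K X R"
  | add_comm: "\<lbrakk>s \<in> hl_terms K X; t \<in> hl_terms K X\<rbrakk> \<Longrightarrow> (HAdd s t, HAdd t s) \<in> hl_cong K X R"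
  | add_zero: "t \<in> hl_terms K X \<Longrightarrow> (HAdd HZero t, t) \<in> hl_cong K X R"
  | add_inv: "t \<in> hl_terms K X \<Longrightarrow> (HDiff K t t, HZero) \<in> hl_cong K X R"
  | smult_add_left: "\<lbrakk>c \<in> carrier K; d \<in> carrier K; t \<in> hl_terms K X\<rbrakk>
      \<Longrightarrow> (HSmult (c \<oplus> d) t, HAdd (HSmult c t) (HSmult d t)) \<in> hl_cong K X R"
  | smult_add_right: "\<lbrakk>c \<in> carrier K; s \<in> hl_terms K X; t \<in> hl_terms K X\<rbrakk>
      \<Longrightarrow> (HSmult c (HAdd s t), HAdd (HSmult c s) (HSmult c t)) \<in> hl_cong K X R"
  | smult_smult: "\<lbrakk>c \<in> carrier K; d \<in> carrier K; t \<in> hl_terms K X\<rbrakk>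
      \<Longrightarrow> (HSmult (c \<otimes> d) t, HSmult c (HSmult d t)) \<in> hl_cong K X R"
  | smult_one: "t \<in> hl_terms K X \<Longrightarrow> (HSmult \<one> t, t) \<in> hl_cong K X R"
  | tw_add: "\<lbrakk>s \<in> hl_terms K X; t \<in> hl_terms K X\<rbrakk>
      \<Longrightarrow> (HTw (HAdd s t), HAdd (HTw s) (HTw t)) \<in> hl_cong K X R"
  | tw_smult: "\<lbrakk>c \<in> carrier K; t \<in> hl_terms K X\<rbrakk>
      \<Longrightarrow> (HTw (HSmult c t), HSmult c (HTw t)) \<in> hl_cong K X R"
  | br_add_left: "\<lbrakk>s \<in> hl_terms K X; t \<in> hl_terms K X; u \<in> hl_terms K X\<rbrakk>
      \<Longrightarrow> (HBr (HAdd s t) u, HAdd (HBr s u) (HBr t u)) \<in> hl_cong K X R"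
  | br_add_right: "\<lbrakk>s \<in> hl_terms K X; t \<in> hl_terms K X; u \<in> hl_terms K X\<rbrakk>
      \<Longrightarrow> (HBr s (HAdd t u), HAdd (HBr s t) (HBr s u)) \<in> hl_cong K X R"
  | br_smult_left: "\<lbrakk>c \<in> carrier K; s \<in> hl_terms K X; t \<in> hl_terms K X\<rbrakk>
      \<Longrightarrow> (HBr (HSmult c s) t, HSmult c (HBr s t)) \<in> hl_cong K X R"
  | br_smult_right: "\<lbrakk>c \<in> carrier K; s \<in> hl_terms K X; t \<in> hl_terms K X\<rbrakk>
      \<Longrightarrow> (HBr s (HSmult c t), HSmult c (HBr s t)) \<in> hl_cong K X R"
  | leibniz: "\<lbrakk>s \<in> hl_terms K X; t \<in> hl_terms K X; u \<in> hl_terms K X\<rbrakk>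
      \<Longrightarrow> (HBr (HTw s) (HBr t u), HDiff K (HBr (HBr s t) (HTw u)) (HBr (HBr s u) (HTw t)))
        \<in> hl_cong K X R"
  | tw_br: "\<lbrakk>s \<in> hl_terms K X; t \<in> hl_terms K X\<rbrakk>
      \<Longrightarrow> (HTw (HBr s t), HBr (HTw s) (HTw t)) \<in> hl_cong K X R"

definition hl_presented ::
  "('k, 'z) ring_scheme \<Rightarrow> 'x set \<Rightarrow> (('k, 'x) hl_term \<times> ('k, 'x) hl_term) set
    \<Rightarrow> ('k, ('k, 'x) hl_term set) hom_alg"
  where "hl_presented K X R = (let E = hl_cong K X R in
    \<lparr>carrier = hl_terms K X // E, mult = undefined, one = undefined,
     zero = E `` {HZero},
     add = (\<lambda>A B. \<Union>s\<in>A. \<Union>t\<in>B. E `` {HAdd s t}),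
     smult = (\<lambda>c A. \<Union>t\<in>A. E `` {HSmult c t}),
     twist = (\<lambda>A. \<Union>t\<in>A. E `` {HTw t}),
     bracket = (\<lambda>A B. \<Union>s\<in>A. \<Union>t\<in>B. E `` {HBr s t})\<rparr>)"


section \<open>Free Hom-Leibniz algebras\<close>

text \<open>HOL cannot quantify over all types inside a definition, so the targets \<open>A\<close> in the universal
  property range over the Hom-Leibniz algebras carried by subsets of the term type
  \<^typ>\<open>('k, 'v + 'f + 'f) hl_term\<close>. Lemma \<open>free_hom_leibniz_universal\<close> below shows that
  the universal property for targets over an arbitrary type follows, so nothing is lost.
  Uniqueness of a map on a carrier is expressed by \<^const>\<open>extensional\<close>.\<close>

definition free_hom_leibniz ::
  "('k, 'z) ring_scheme \<Rightarrow> ('k, 'v) hom_space \<Rightarrow> ('v \<Rightarrow> 'f) \<Rightarrow> ('k, 'f) hom_alg \<Rightarrow> bool"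
  where "free_hom_leibniz K V \<iota> F \<longleftrightarrow>
    hom_vector_space K V \<and> hom_leibniz K F \<and> \<iota> \<in> hs_hom K V F
    \<and> (\<forall>A :: ('k, ('k, 'v + 'f + 'f) hl_term) hom_alg. hom_leibniz K A \<longrightarrow>
        (\<forall>\<phi>\<in>hs_hom K V A. \<exists>!\<psi>. \<psi> \<in> hl_hom K F A \<and> \<psi> \<in> extensional (carrier F)
          \<and> (\<forall>v\<in>carrier V. \<psi> (\<iota> v) = \<phi> v)))"

lemma hom_leibniz_transfer:
  fixes K (structure) and A :: "('k, 'a) hom_alg" and B :: "('k, 'b) hom_alg"
  assumes A: "hom_leibniz K A"
    and f: "\<And>x. x \<in> carrier B \<Longrightarrow> f x \<in> carrier A" and inj: "inj_on f (carrier B)"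
    and zero: "\<zero>\<^bsub>B\<^esub> \<in> carrier B" "f \<zero>\<^bsub>B\<^esub> = \<zero>\<^bsub>A\<^esub>"
    and add: "\<And>x y. \<lbrakk>x \<in> carrier B; y \<in> carrier B\<rbrakk> \<Longrightarrow> x \<oplus>\<^bsub>B\<^esub> y \<in> carrier B"
      "\<And>x y. \<lbrakk>x \<in> carrier B; y \<in> carrier B\<rbrakk> \<Longrightarrow> f (x \<oplus>\<^bsub>B\<^esub> y) = f x \<oplus>\<^bsub>A\<^esub> f y"
    and smult: "\<And>c x. \<lbrakk>c \<in> carrier K; x \<in> carrier B\<rbrakk> \<Longrightarrow> c \<odot>\<^bsub>B\<^esub> x \<in> carrier B"
      "\<And>c x. \<lbrakk>c \<in> carrier K; x \<in> carrier B\<rbrakk> \<Longrightarrow> f (c \<odot>\<^bsub>B\<^esub> x) = c \<odot>\<^bsub>A\<^esub> f x"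
    and tw: "\<And>x. x \<in> carrier B \<Longrightarrow> twist B x \<in> carrier B"
      "\<And>x. x \<in> carrier B \<Longrightarrow> f (twist B x) = twist A (f x)"
    and br: "\<And>x y. \<lbrakk>x \<in> carrier B; y \<in> carrier B\<rbrakk> \<Longrightarrow> \<langle>x, y\<rangle>\<^bsub>B\<^esub> \<in> carrier B"
      "\<And>x y. \<lbrakk>x \<in> carrier B; y \<in> carrier B\<rbrakk> \<Longrightarrow> f \<langle>x, y\<rangle>\<^bsub>B\<^esub> = \<langle>f x, f y\<rangle>\<^bsub>A\<^esub>"
  shows "hom_leibniz K B"
proof -
  interpret A: hom_leibniz K A by fact
  note cl = zero(1) add(1) smult(1) tw(1) br(1)
  note hom = zero(2) add(2) smult(2) tw(2) br(2)
  have eqI: "x = y" if "x \<in> carrier B" "y \<in> carrier B" "f x = f y" for x y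
    using inj that by (auto dest: inj_onD)
  have neg: "(\<ominus> \<one>) \<odot>\<^bsub>A\<^esub> x = \<ominus>\<^bsub>A\<^esub> x" if "x \<in> carrier A" for x
    using that by (simp add: A.smult_l_minus)
  have B: "abelian_group B"
  proof (rule abelian_groupI)
    fix x assume x: "x \<in> carrier B"
    have "((\<ominus> \<one>) \<odot>\<^bsub>B\<^esub> x) \<oplus>\<^bsub>B\<^esub> x = \<zero>\<^bsub>B\<^esub>"
      by (rule eqI) (use x in \<open>auto simp: cl hom f neg A.M.l_neg\<close>)
    with x show "\<exists>y\<in>carrier B. y \<oplus>\<^bsub>B\<^esub> x = \<zero>\<^bsub>B\<^esub>" 
      by (intro bexI[of _ "(\<ominus> \<one>) \<odot>\<^bsub>B\<^esub> x"]) (simp_all add: smult(1))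
  qed (auto intro!: eqI simp: cl hom f A.M.a_ac)
  then interpret B: abelian_group B .
  interpret B: module K B
    by (intro module.intro module.axioms(1)[OF A.module_axioms] B module_axioms.intro)
      (auto intro!: eqI simp: cl hom f A.smult_l_distr A.smult_r_distr A.smult_assoc1)
  have negB: "f (\<ominus>\<^bsub>B\<^esub> x) = \<ominus>\<^bsub>A\<^esub> f x" if "x \<in> carrier B" for x
  proof -
    have "f (\<ominus>\<^bsub>B\<^esub> x) \<oplus>\<^bsub>A\<^esub> f x = \<zero>\<^bsub>A\<^esub>"
      using that by (metis B.a_inv_closed B.l_neg hom(1,2))
    with that show ?thesis by (simp add: A.M.minus_equality f)
  qed
  show ?thesis
    by unfold_locales
      (auto intro!: eqI simp: cl hom f a_minus_def negB A.twist_add A.twist_smult A.bracket_add_left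
        A.bracket_add_right A.bracket_smult_left A.bracket_smult_right A.twist_bracket
        A.hom_leibniz_identity)
qed

text \<open>The subalgebra of \<open>A\<close> generated by a family \<open>\<gamma>\<close> has a copy carried by a set of terms.\<close>

lemma generated_copy:
  fixes A :: "('k, 'a) hom_alg" and \<gamma> :: "'x \<Rightarrow> 'a"
  assumes A: "hom_leibniz K A" and \<gamma>: "\<And>x. x \<in> X \<Longrightarrow> \<gamma> x \<in> carrier A"
  obtains B :: "('k, ('k, 'x) hl_term) hom_alg" and f where
    "hom_leibniz K B" "f \<in> hl_hom K B A" "inj_on f (carrier B)" "\<gamma> ` X \<subseteq> f ` carrier B"
proof -
  interpret A: hom_leibniz K A by fact
  define f where "f = hl_eval A \<gamma>"
  define e where "e = inv_into (hl_terms K X) f"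
  have f_closed: "f t \<in> carrier A" if "t \<in> hl_terms K X" for t
    using that unfolding f_def
    by induction (auto simp: \<gamma> A.twist_closed A.bracket_closed)
  have fe: "f (e (f t)) = f t" "e (f t) \<in> hl_terms K X" if "t \<in> hl_terms K X" for t
    using that unfolding e_def by (auto simp: f_inv_into_f inv_into_into)
  define B :: "('k, ('k, 'x) hl_term) hom_alg" where
    "B = \<lparr>carrier = (\<lambda>t. e (f t)) ` hl_terms K X, mult = undefined, one = undefined,
      zero = e (f HZero), add = (\<lambda>s t. e (f (HAdd s t))), smult = (\<lambda>c t. e (f (HSmult c t))),
      twist = (\<lambda>t. e (f (HTw t))), bracket = (\<lambda>s t. e (f (HBr s t)))\<rparr>"
  have in_terms: "t \<in> hl_terms K X" "e (f t) = t" if "t \<in> carrier B" for t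
    using that fe by (auto simp: B_def)
  have B_I: "e (f t) \<in> carrier B" if "t \<in> hl_terms K X" for t
    using that by (auto simp: B_def)
  have ops: "\<zero>\<^bsub>B\<^esub> = e (f HZero)" "s \<oplus>\<^bsub>B\<^esub> t = e (f (HAdd s t))"
    "c \<odot>\<^bsub>B\<^esub> t = e (f (HSmult c t))" "twist B t = e (f (HTw t))" "\<langle>s, t\<rangle>\<^bsub>B\<^esub> = e (f (HBr s t))"
    for c s t by (simp_all add: B_def)
  have evs: "f HZero = \<zero>\<^bsub>A\<^esub>" "f (HAdd s t) = f s \<oplus>\<^bsub>A\<^esub> f t" "f (HSmult c t) = c \<odot>\<^bsub>A\<^esub> f t"
    "f (HTw t) = twist A (f t)" "f (HBr s t) = \<langle>f s, f t\<rangle>\<^bsub>A\<^esub>" for c s t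
    by (simp_all add: f_def)
  have inj: "inj_on f (carrier B)"
    by (rule inj_onI) (metis in_terms(2))
  have hom: "f \<zero>\<^bsub>B\<^esub> = \<zero>\<^bsub>A\<^esub>"
    "\<lbrakk>s \<in> carrier B; t \<in> carrier B\<rbrakk> \<Longrightarrow> f (s \<oplus>\<^bsub>B\<^esub> t) = f s \<oplus>\<^bsub>A\<^esub> f t"
    "\<lbrakk>c \<in> carrier K; t \<in> carrier B\<rbrakk> \<Longrightarrow> f (c \<odot>\<^bsub>B\<^esub> t) = c \<odot>\<^bsub>A\<^esub> f t"
    "t \<in> carrier B \<Longrightarrow> f (twist B t) = twist A (f t)"
    "\<lbrakk>s \<in> carrier B; t \<in> carrier B\<rbrakk> \<Longrightarrow> f \<langle>s, t\<rangle>\<^bsub>B\<^esub> = \<langle>f s, f t\<rangle>\<^bsub>A\<^esub>" for c s t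
    unfolding ops by (simp_all add: fe(1) hl_terms.intros in_terms(1) evs[symmetric])
  have cl: "\<zero>\<^bsub>B\<^esub> \<in> carrier B"
    "\<lbrakk>s \<in> carrier B; t \<in> carrier B\<rbrakk> \<Longrightarrow> s \<oplus>\<^bsub>B\<^esub> t \<in> carrier B"
    "\<lbrakk>c \<in> carrier K; t \<in> carrier B\<rbrakk> \<Longrightarrow> c \<odot>\<^bsub>B\<^esub> t \<in> carrier B"
    "t \<in> carrier B \<Longrightarrow> twist B t \<in> carrier B"
    "\<lbrakk>s \<in> carrier B; t \<in> carrier B\<rbrakk> \<Longrightarrow> \<langle>s, t\<rangle>\<^bsub>B\<^esub> \<in> carrier B" for c s t
    unfolding ops by (rule B_I, auto intro: hl_terms.intros in_terms)+
  have fB: "f t \<in> carrier A" if "t \<in> carrier B" for t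
    using that by (simp add: f_closed in_terms)
  show ?thesis
  proof
    show "hom_leibniz K B"
      by (rule hom_leibniz_transfer[OF A fB inj]) (simp_all add: cl hom)
    show "f \<in> hl_hom K B A"
      by (auto simp: hl_hom_def hs_hom_def fB hom)
    show "inj_on f (carrier B)" by (rule inj)
    show "\<gamma> ` X \<subseteq> f ` carrier B"
    proof clarify
      fix x assume "x \<in> X"
      then have "HGen x \<in> hl_terms K X" by (rule hl_terms.intros)
      then have "f (e (f (HGen x))) = \<gamma> x" "e (f (HGen x)) \<in> carrier B"
        using fe(1)[of "HGen x"] B_I[of "HGen x"] by (simp_all add: f_def)
      then show "\<gamma> x \<in> f ` carrier B" by (metis imageI)
    qed
  qed
qed

lemma hs_hom_factor:
  assumes "hom_leibniz K B" "f \<in> hl_hom K B A" "inj_on f (carrier B)"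
    and V: "hom_vector_space K V" and h: "h \<in> hs_hom K V A" "h ` carrier V \<subseteq> f ` carrier B"
  shows "inv_into (carrier B) f \<circ> h \<in> hs_hom K V B"
    and "\<And>x. x \<in> carrier V \<Longrightarrow> f ((inv_into (carrier B) f \<circ> h) x) = h x"
proof -
  interpret B: hom_leibniz K B by fact
  interpret V: hom_vector_space K V by fact
  let ?g = "inv_into (carrier B) f \<circ> h"
  show fg: "f (?g x) = h x" if "x \<in> carrier V" for x
    using that h(2) by (auto simp: f_inv_into_f)
  have cl: "?g x \<in> carrier B" if "x \<in> carrier V" for x
    using that h(2) by (auto simp: inv_into_into)
  have eqI: "x = y" if "f x = f y" "x \<in> carrier B" "y \<in> carrier B" for x y
    using assms(3) that by (auto dest: inj_onD)
  note f = assms(2)[unfolded hl_hom_def hs_hom_def]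
  note h' = h(1)[unfolded hs_hom_def]
  show "?g \<in> hs_hom K V B"
    unfolding hs_hom_def
    by (intro CollectI conjI ballI funcsetI eqI)
      (use f h' cl fg V.twist_closed B.twist_closed in \<open>simp_all del: o_apply\<close>)
qed

lemma hl_hom_factor:
  assumes "hom_leibniz K B" "f \<in> hl_hom K B A" "inj_on f (carrier B)"
    and F: "hom_leibniz K F" and h: "h \<in> hl_hom K F A" "h ` carrier F \<subseteq> f ` carrier B"
  shows "inv_into (carrier B) f \<circ> h \<in> hl_hom K F B"
proof -
  interpret B: hom_leibniz K B by fact
  interpret F: hom_leibniz K F by fact
  let ?g = "inv_into (carrier B) f \<circ> h"
  have hs: "h \<in> hs_hom K F A" using h(1) by (simp add: hl_hom_def)
  note g = hs_hom_factor[OF assms(1-3) F.hom_vector_space_axioms hs h(2)]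
  have cl: "?g x \<in> carrier B" if "x \<in> carrier F" for x
    using g(1) that by (auto simp: hs_hom_def)
  have "?g \<langle>x, y\<rangle>\<^bsub>F\<^esub> = \<langle>?g x, ?g y\<rangle>\<^bsub>B\<^esub>" if xy: "x \<in> carrier F" "y \<in> carrier F" for x y
  proof (rule inj_onD[OF assms(3)])
    have "f (?g \<langle>x, y\<rangle>\<^bsub>F\<^esub>) = \<langle>h x, h y\<rangle>\<^bsub>A\<^esub>"
      using xy h(1) by (simp only: g(2) F.bracket_closed) (simp add: hl_hom_def)
    also have "\<dots> = \<langle>f (?g x), f (?g y)\<rangle>\<^bsub>A\<^esub>"
      using xy by (simp only: g(2))
    also have "\<dots> = f \<langle>?g x, ?g y\<rangle>\<^bsub>B\<^esub>"
      using assms(2) cl[OF xy(1)] cl[OF xy(2)] by (simp add: hl_hom_def del: o_apply)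
    finally show "f (?g \<langle>x, y\<rangle>\<^bsub>F\<^esub>) = f \<langle>?g x, ?g y\<rangle>\<^bsub>B\<^esub>" .
  qed (use xy cl F.bracket_closed B.bracket_closed in blast)+
  with g(1) show ?thesis by (simp add: hl_hom_def del: o_apply)
qed

lemma hl_hom_compose:
  assumes "hom_leibniz K F" "g \<in> hl_hom K F B" "f \<in> hl_hom K B A"
  shows "restrict (f \<circ> g) (carrier F) \<in> hl_hom K F A"
proof -
  interpret F: hom_leibniz K F by fact
  have "g x \<in> carrier B" if "x \<in> carrier F" for x
    using that assms(2) by (auto simp: hl_hom_def hs_hom_def)
  then show ?thesis
    using assms(2,3) by (auto simp: hl_hom_def hs_hom_def F.twist_closed F.bracket_closed)
qed

lemma free_hom_leibniz_universal:
  fixes V :: "('k, 'v) hom_space" and F :: "('k, 'f) hom_alg" and A :: "('k, 'a) hom_alg"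
  assumes free: "free_hom_leibniz K V \<iota> F" and A: "hom_leibniz K A"
    and \<phi>: "\<phi> \<in> hs_hom K V A"
  shows "\<exists>!\<psi>. \<psi> \<in> hl_hom K F A \<and> \<psi> \<in> extensional (carrier F)
    \<and> (\<forall>v\<in>carrier V. \<psi> (\<iota> v) = \<phi> v)"
proof -
  have V: "hom_vector_space K V" and F: "hom_leibniz K F" and \<iota>: "\<iota> \<in> hs_hom K V F"
    using free by (auto simp: free_hom_leibniz_def)
  have \<iota>_in: "\<iota> v \<in> carrier F" if "v \<in> carrier V" for v
    using \<iota> that by (auto simp: hs_hom_def)
  have \<phi>_in: "\<phi> v \<in> carrier A" if "v \<in> carrier V" for v
    using \<phi> that by (auto simp: hs_hom_def)
  have univ: "\<exists>!\<psi>. \<psi> \<in> hl_hom K F B \<and> \<psi> \<in> extensional (carrier F)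
      \<and> (\<forall>v\<in>carrier V. \<psi> (\<iota> v) = \<phi>' v)"
    if "hom_leibniz K B" "\<phi>' \<in> hs_hom K V B"
    for B :: "('k, ('k, 'v + 'f + 'f) hl_term) hom_alg" and \<phi>'
    using free that unfolding free_hom_leibniz_def by blast
  show ?thesis
  proof (rule ex_ex1I)
    let ?X = "Inl ` carrier V :: ('v + 'f + 'f) set"
    let ?\<gamma> = "case_sum \<phi> undefined :: 'v + 'f + 'f \<Rightarrow> 'a"
    obtain B :: "('k, ('k, 'v + 'f + 'f) hl_term) hom_alg" and f where B:
      "hom_leibniz K B" "f \<in> hl_hom K B A" "inj_on f (carrier B)" "?\<gamma> ` ?X \<subseteq> f ` carrier B"
      by (rule generated_copy[OF A, of ?X ?\<gamma>]) (use \<phi>_in in auto)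
    have sub: "\<phi> ` carrier V \<subseteq> f ` carrier B" using B(4) by (simp add: image_image)
    note fac = hs_hom_factor[OF B(1-3) V \<phi> sub]
    obtain \<psi> where \<psi>: "\<psi> \<in> hl_hom K F B"
      "\<forall>v\<in>carrier V. \<psi> (\<iota> v) = (inv_into (carrier B) f \<circ> \<phi>) v"
      using univ[OF B(1) fac(1)] by blast
    have "\<forall>v\<in>carrier V. restrict (f \<circ> \<psi>) (carrier F) (\<iota> v) = \<phi> v"
      using \<psi>(2) fac(2) \<iota>_in by simp
    then show "\<exists>\<psi>. \<psi> \<in> hl_hom K F A \<and> \<psi> \<in> extensional (carrier F)
        \<and> (\<forall>v\<in>carrier V. \<psi> (\<iota> v) = \<phi> v)"
      using hl_hom_compose[OF F \<psi>(1) B(2)] by (metis restrict_extensional)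
  next
    fix \<psi>1 \<psi>2
    assume 1: "\<psi>1 \<in> hl_hom K F A \<and> \<psi>1 \<in> extensional (carrier F)
        \<and> (\<forall>v\<in>carrier V. \<psi>1 (\<iota> v) = \<phi> v)"
      and 2: "\<psi>2 \<in> hl_hom K F A \<and> \<psi>2 \<in> extensional (carrier F)
        \<and> (\<forall>v\<in>carrier V. \<psi>2 (\<iota> v) = \<phi> v)"
    have in_A: "\<psi>1 x \<in> carrier A" "\<psi>2 x \<in> carrier A" if "x \<in> carrier F" for x
      using 1 2 that by (auto simp: hl_hom_def hs_hom_def)
    let ?X = "Inr ` (Inl ` carrier F \<union> Inr ` carrier F) :: ('v + 'f + 'f) set"
    let ?\<gamma> = "case_sum undefined (case_sum \<psi>1 \<psi>2) :: 'v + 'f + 'f \<Rightarrow> 'a"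
    obtain B :: "('k, ('k, 'v + 'f + 'f) hl_term) hom_alg" and f where B:
      "hom_leibniz K B" "f \<in> hl_hom K B A" "inj_on f (carrier B)" "?\<gamma> ` ?X \<subseteq> f ` carrier B"
      by (rule generated_copy[OF A, of ?X ?\<gamma>]) (use in_A in auto)
    have sub: "\<psi>1 ` carrier F \<subseteq> f ` carrier B" "\<psi>2 ` carrier F \<subseteq> f ` carrier B"
      using B(4) by (auto simp: image_Un image_image)
    let ?e = "inv_into (carrier B) f"
    have subV: "\<phi> ` carrier V \<subseteq> f ` carrier B"
    proof clarify
      fix v assume v: "v \<in> carrier V"
      then have "\<phi> v = \<psi>1 (\<iota> v)" using 1 by simp
      then show "\<phi> v \<in> f ` carrier B" using sub(1) \<iota>_in[OF v] by auto
    qed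
    define P where "P \<psi> \<longleftrightarrow> \<psi> \<in> hl_hom K F B \<and> \<psi> \<in> extensional (carrier F)
      \<and> (\<forall>v\<in>carrier V. \<psi> (\<iota> v) = (?e \<circ> \<phi>) v)" for \<psi>
    have ex1: "\<exists>!\<psi>. P \<psi>"
      unfolding P_def by (rule univ[OF B(1) hs_hom_factor(1)[OF B(1-3) V \<phi> subV]])
    have P: "P (restrict (?e \<circ> \<psi>) (carrier F))"
      if "\<psi> \<in> hl_hom K F A" "\<psi> ` carrier F \<subseteq> f ` carrier B" "\<forall>v\<in>carrier V. \<psi> (\<iota> v) = \<phi> v" for \<psi>
    proof -
      have id: "id \<in> hl_hom K B B" by (simp add: hl_hom_def hs_hom_def)
      have "restrict (?e \<circ> \<psi>) (carrier F) \<in> hl_hom K F B"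
        using hl_hom_compose[OF F hl_hom_factor[OF B(1-3) F that(1,2)] id] by simp
      then show ?thesis using that(3) \<iota>_in by (simp add: P_def)
    qed
    have P1: "P (restrict (?e \<circ> \<psi>1) (carrier F))"
      by (rule P[OF conjunct1[OF 1] sub(1) conjunct2[OF conjunct2[OF 1]]])
    have P2: "P (restrict (?e \<circ> \<psi>2) (carrier F))"
      by (rule P[OF conjunct1[OF 2] sub(2) conjunct2[OF conjunct2[OF 2]]])
    have "restrict (?e \<circ> \<psi>1) (carrier F) = restrict (?e \<circ> \<psi>2) (carrier F)"
      using ex1 P1 P2 by blast
    note same = fun_cong[OF this]
    have e: "?e (\<psi>1 x) = ?e (\<psi>2 x)" if "x \<in> carrier F" for x
      using same[of x] that by simp
    have eq: "\<psi>1 x = \<psi>2 x" if "x \<in> carrier F" for x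
    proof -
      have "f (?e (\<psi>1 x)) = \<psi>1 x"
        by (rule f_inv_into_f[OF subsetD[OF sub(1) imageI[OF that]]])
      moreover have "f (?e (\<psi>2 x)) = \<psi>2 x"
        by (rule f_inv_into_f[OF subsetD[OF sub(2) imageI[OF that]]])
      ultimately show ?thesis using e[OF that] by metis
    qed
    show "\<psi>1 = \<psi>2"
      by (rule extensionalityI[OF conjunct1[OF conjunct2[OF 1]] conjunct1[OF conjunct2[OF 2]] eq])
  qed
qed

section \<open>Tensor and exterior product of two ideals\<close>

text \<open>\<open>Star m n\<close> stands for \<open>m * n\<close> and \<open>Star' n m\<close> for \<open>n *' m\<close>.\<close>

datatype 'a star_symbol = Star 'a 'a | Star' 'a 'a

definition star_symbols :: "'a set \<Rightarrow> 'a set \<Rightarrow> 'a star_symbol set"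
  where "star_symbols M N = {Star m n | m n. m \<in> M \<and> n \<in> N} \<union> {Star' n m | m n. m \<in> M \<and> n \<in> N}"

abbreviation HStar :: "'a \<Rightarrow> 'a \<Rightarrow> ('k, 'a star_symbol) hl_term"  (infix \<open>\<star>\<close> 75)
  where "m \<star> n \<equiv> HGen (Star m n)"

abbreviation HStar' :: "'a \<Rightarrow> 'a \<Rightarrow> ('k, 'a star_symbol) hl_term"  (infix \<open>\<star>''\<close> 75)
  where "n \<star>' m \<equiv> HGen (Star' n m)"

inductive_set star_rels ::
  "('k, 'z) ring_scheme \<Rightarrow> ('k, 'a, 'm) hom_alg_scheme \<Rightarrow> 'a set \<Rightarrow> 'a set
    \<Rightarrow> (('k, 'a star_symbol) hl_term \<times> ('k, 'a star_symbol) hl_term) set"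
  for K and L (structure) and M N where
    \<comment> \<open>bilinearity\<close>
    "\<lbrakk>m \<in> M; m' \<in> M; n \<in> N\<rbrakk> \<Longrightarrow> ((m \<oplus> m') \<star> n, HAdd (m \<star> n) (m' \<star> n)) \<in> star_rels K L M N"
  | "\<lbrakk>m \<in> M; n \<in> N; n' \<in> N\<rbrakk> \<Longrightarrow> (m \<star> (n \<oplus> n'), HAdd (m \<star> n) (m \<star> n')) \<in> star_rels K L M N"
  | "\<lbrakk>c \<in> carrier K; m \<in> M; n \<in> N\<rbrakk> \<Longrightarrow> ((c \<odot> m) \<star> n, HSmult c (m \<star> n)) \<in> star_rels K L M N"
  | "\<lbrakk>c \<in> carrier K; m \<in> M; n \<in> N\<rbrakk> \<Longrightarrow> (m \<star> (c \<odot> n), HSmult c (m \<star> n)) \<in> star_rels K L M N"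
  | "\<lbrakk>m \<in> M; n \<in> N; n' \<in> N\<rbrakk> \<Longrightarrow> ((n \<oplus> n') \<star>' m, HAdd (n \<star>' m) (n' \<star>' m)) \<in> star_rels K L M N"
  | "\<lbrakk>m \<in> M; m' \<in> M; n \<in> N\<rbrakk> \<Longrightarrow> (n \<star>' (m \<oplus> m'), HAdd (n \<star>' m) (n \<star>' m')) \<in> star_rels K L M N"
  | "\<lbrakk>c \<in> carrier K; m \<in> M; n \<in> N\<rbrakk> \<Longrightarrow> ((c \<odot> n) \<star>' m, HSmult c (n \<star>' m)) \<in> star_rels K L M N"
  | "\<lbrakk>c \<in> carrier K; m \<in> M; n \<in> N\<rbrakk> \<Longrightarrow> (n \<star>' (c \<odot> m), HSmult c (n \<star>' m)) \<in> star_rels K L M N"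
    \<comment> \<open>compatibility with the self-map\<close>
  | "\<lbrakk>m \<in> M; n \<in> N\<rbrakk> \<Longrightarrow> (HTw (m \<star> n), twist L m \<star> twist L n) \<in> star_rels K L M N"
  | "\<lbrakk>m \<in> M; n \<in> N\<rbrakk> \<Longrightarrow> (HTw (n \<star>' m), twist L n \<star>' twist L m) \<in> star_rels K L M N"
    \<comment> \<open>the defining relations\<close>
  | "\<lbrakk>m \<in> M; m' \<in> M; n \<in> N\<rbrakk>
      \<Longrightarrow> (twist L m \<star> \<langle>m', n\<rangle>, HMinus K (twist L m \<star> \<langle>n, m'\<rangle>)) \<in> star_rels K L M N"
  | "\<lbrakk>m \<in> M; n \<in> N; n' \<in> N\<rbrakk>
      \<Longrightarrow> (twist L n \<star>' \<langle>n', m\<rangle>, HMinus K (twist L n \<star>' \<langle>m, n'\<rangle>)) \<in> star_rels K L M N"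
  | "\<lbrakk>m \<in> M; n \<in> N; n' \<in> N\<rbrakk>
      \<Longrightarrow> (twist L m \<star> \<langle>n, n'\<rangle>, HDiff K (\<langle>m, n\<rangle> \<star> twist L n') (\<langle>m, n'\<rangle> \<star> twist L n))
        \<in> star_rels K L M N"
  | "\<lbrakk>m \<in> M; m' \<in> M; n \<in> N\<rbrakk>
      \<Longrightarrow> (twist L n \<star>' \<langle>m, m'\<rangle>, HDiff K (\<langle>n, m\<rangle> \<star>' twist L m') (\<langle>n, m'\<rangle> \<star>' twist L m))
        \<in> star_rels K L M N"
  | "\<lbrakk>m \<in> M; m' \<in> M; n \<in> N\<rbrakk>
      \<Longrightarrow> (\<langle>m, m'\<rangle> \<star> twist L n, HDiff K (\<langle>m, n\<rangle> \<star>' twist L m') (twist L m \<star> \<langle>n, m'\<rangle>))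
        \<in> star_rels K L M N"
  | "\<lbrakk>m \<in> M; n \<in> N; n' \<in> N\<rbrakk>
      \<Longrightarrow> (\<langle>n, n'\<rangle> \<star>' twist L m, HDiff K (\<langle>n, m\<rangle> \<star> twist L n') (twist L n \<star>' \<langle>m, n'\<rangle>))
        \<in> star_rels K L M N"
  | "\<lbrakk>m \<in> M; m' \<in> M; n \<in> N; n' \<in> N\<rbrakk>
      \<Longrightarrow> (\<langle>m, n\<rangle> \<star> \<langle>m', n'\<rangle>, HBr (m \<star> n) (m' \<star> n')) \<in> star_rels K L M N"
  | "\<lbrakk>m \<in> M; m' \<in> M; n \<in> N; n' \<in> N\<rbrakk>
      \<Longrightarrow> (HBr (m \<star> n) (m' \<star> n'), \<langle>m, n\<rangle> \<star>' \<langle>m', n'\<rangle>) \<in> star_rels K L M N"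
  | "\<lbrakk>m \<in> M; m' \<in> M; n \<in> N; n' \<in> N\<rbrakk>
      \<Longrightarrow> (\<langle>n, m\<rangle> \<star> \<langle>n', m'\<rangle>, HBr (n \<star>' m) (n' \<star>' m')) \<in> star_rels K L M N"
  | "\<lbrakk>m \<in> M; m' \<in> M; n \<in> N; n' \<in> N\<rbrakk>
      \<Longrightarrow> (HBr (n \<star>' m) (n' \<star>' m'), \<langle>n, m\<rangle> \<star>' \<langle>n', m'\<rangle>) \<in> star_rels K L M N"
  | "\<lbrakk>m \<in> M; m' \<in> M; n \<in> N; n' \<in> N\<rbrakk>
      \<Longrightarrow> (\<langle>m, n\<rangle> \<star> \<langle>n', m'\<rangle>, HBr (m \<star> n) (n' \<star>' m')) \<in> star_rels K L M N"
  | "\<lbrakk>m \<in> M; m' \<in> M; n \<in> N; n' \<in> N\<rbrakk>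
      \<Longrightarrow> (HBr (m \<star> n) (n' \<star>' m'), \<langle>m, n\<rangle> \<star>' \<langle>n', m'\<rangle>) \<in> star_rels K L M N"
  | "\<lbrakk>m \<in> M; m' \<in> M; n \<in> N; n' \<in> N\<rbrakk>
      \<Longrightarrow> (\<langle>n, m\<rangle> \<star> \<langle>m', n'\<rangle>, HBr (n \<star>' m) (m' \<star> n')) \<in> star_rels K L M N"
  | "\<lbrakk>m \<in> M; m' \<in> M; n \<in> N; n' \<in> N\<rbrakk>
      \<Longrightarrow> (HBr (n \<star>' m) (m' \<star> n'), \<langle>n, m\<rangle> \<star>' \<langle>m', n'\<rangle>) \<in> star_rels K L M N"

definition star_product ::
  "('k, 'z) ring_scheme \<Rightarrow> ('k, 'a, 'm) hom_alg_scheme \<Rightarrow> 'a set \<Rightarrow> 'a set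
    \<Rightarrow> ('k, ('k, 'a star_symbol) hl_term set) hom_alg"
  where "star_product K L M N = hl_presented K (star_symbols M N) (star_rels K L M N)"

definition star_class ::
  "('k, 'z) ring_scheme \<Rightarrow> ('k, 'a, 'm) hom_alg_scheme \<Rightarrow> 'a set \<Rightarrow> 'a set
    \<Rightarrow> 'a star_symbol \<Rightarrow> ('k, 'a star_symbol) hl_term set"
  where "star_class K L M N x = hl_cong K (star_symbols M N) (star_rels K L M N) `` {HGen x}"

definition exterior_product ::
  "('k, 'z) ring_scheme \<Rightarrow> ('k, 'a, 'm) hom_alg_scheme \<Rightarrow> 'a set \<Rightarrow> 'a set
    \<Rightarrow> ('k, ('k, 'a star_symbol) hl_term set set) hom_alg"
  where "exterior_product K L M N = hl_quot (star_product K L M N)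
    (hs_span K (star_product K L M N)
      {star_class K L M N (Star x y) \<ominus>\<^bsub>star_product K L M N\<^esub> star_class K L M N (Star' x y)
        | x y. x \<in> M \<inter> N \<and> y \<in> M \<inter> N})"

primrec symbol_bracket :: "('k, 'a, 'm) hom_alg_scheme \<Rightarrow> 'a star_symbol \<Rightarrow> 'a" where
    "symbol_bracket L (Star m n) = \<langle>m, n\<rangle>\<^bsub>L\<^esub>"
  | "symbol_bracket L (Star' n m) = \<langle>n, m\<rangle>\<^bsub>L\<^esub>"

text \<open>The homomorphism induced on the exterior product: the value is computed on a representing
  term \<open>t\<close> of a class \<open>C\<close> of the tensor product that belongs to the coset \<open>A\<close>.\<close>

definition exterior_map :: "('k, 'a, 'm) hom_alg_scheme \<Rightarrow> ('k, 'a star_symbol) hl_term set set \<Rightarrow> 'a"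
  where "exterior_map L A = the_elem ((\<lambda>C. the_elem (hl_eval L (symbol_bracket L) ` C)) ` A)"

definition exterior_kernel ::
  "('k, 'z) ring_scheme \<Rightarrow> ('k, 'a, 'm) hom_alg_scheme \<Rightarrow> 'a set \<Rightarrow> 'a set
    \<Rightarrow> ('k, ('k, 'a star_symbol) hl_term set set) hom_alg"
  where "exterior_kernel K L M N = (exterior_product K L M N)
    \<lparr>carrier := a_kernel (exterior_product K L M N) L (exterior_map L)\<rparr>"


section \<open>Tensor powers and homology\<close>

datatype ('k, 'x) lin_term =
    LGen 'x
  | LZero
  | LAdd "('k, 'x) lin_term" "('k, 'x) lin_term"
  | LSmult 'k "('k, 'x) lin_term"

inductive_set lin_terms :: "('k, 'z) ring_scheme \<Rightarrow> 'x set \<Rightarrow> ('k, 'x) lin_term set"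
  for K (structure) and X where
    "x \<in> X \<Longrightarrow> LGen x \<in> lin_terms K X"
  | "LZero \<in> lin_terms K X"
  | "\<lbrakk>s \<in> lin_terms K X; t \<in> lin_terms K X\<rbrakk> \<Longrightarrow> LAdd s t \<in> lin_terms K X"
  | "\<lbrakk>c \<in> carrier K; t \<in> lin_terms K X\<rbrakk> \<Longrightarrow> LSmult c t \<in> lin_terms K X"

primrec lin_eval :: "('k, 'b, 'm) module_scheme \<Rightarrow> ('x \<Rightarrow> 'b) \<Rightarrow> ('k, 'x) lin_term \<Rightarrow> 'b" where
    "lin_eval V \<phi> (LGen x) = \<phi> x"
  | "lin_eval V \<phi> LZero = \<zero>\<^bsub>V\<^esub>"
  | "lin_eval V \<phi> (LAdd s t) = lin_eval V \<phi> s \<oplus>\<^bsub>V\<^esub> lin_eval V \<phi> t"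
  | "lin_eval V \<phi> (LSmult c t) = c \<odot>\<^bsub>V\<^esub> lin_eval V \<phi> t"

text \<open>The congruence on linear terms generated by the relations \<open>R\<close> and the vector space axioms.\<close>

inductive_set lin_cong ::
  "('k, 'z) ring_scheme \<Rightarrow> 'x set \<Rightarrow> (('k, 'x) lin_term \<times> ('k, 'x) lin_term) set
    \<Rightarrow> (('k, 'x) lin_term \<times> ('k, 'x) lin_term) set"
  for K (structure) and X and R where
    relation: "\<lbrakk>(s, t) \<in> R; s \<in> lin_terms K X; t \<in> lin_terms K X\<rbrakk> \<Longrightarrow> (s, t) \<in> lin_cong K X R"
  | refl: "t \<in> lin_terms K X \<Longrightarrow> (t, t) \<in> lin_cong K X R"
  | sym: "(s, t) \<in> lin_cong K X R \<Longrightarrow> (t, s) \<in> lin_cong K X R"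
  | trans: "\<lbrakk>(s, t) \<in> lin_cong K X R; (t, u) \<in> lin_cong K X R\<rbrakk> \<Longrightarrow> (s, u) \<in> lin_cong K X R"
  | cong_add: "\<lbrakk>(s, s') \<in> lin_cong K X R; (t, t') \<in> lin_cong K X R\<rbrakk>
      \<Longrightarrow> (LAdd s t, LAdd s' t') \<in> lin_cong K X R"
  | cong_smult: "\<lbrakk>c \<in> carrier K; (t, t') \<in> lin_cong K X R\<rbrakk>
      \<Longrightarrow> (LSmult c t, LSmult c t') \<in> lin_cong K X R"
  | add_assoc: "\<lbrakk>s \<in> lin_terms K X; t \<in> lin_terms K X; u \<in> lin_terms K X\<rbrakk>
      \<Longrightarrow> (LAdd (LAdd s t) u, LAdd s (LAdd t u)) \<in> lin_cong K X R"
  | add_comm: "\<lbrakk>s \<in> lin_terms K X; t \<in> lin_terms K X\<rbrakk> \<Longrightarrow> (LAdd s t, LAdd t s) \<in> lin_cong K X R"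
  | add_zero: "t \<in> lin_terms K X \<Longrightarrow> (LAdd LZero t, t) \<in> lin_cong K X R"
  | add_inv: "t \<in> lin_terms K X \<Longrightarrow> (LAdd t (LSmult (\<ominus> \<one>) t), LZero) \<in> lin_cong K X R"
  | smult_add_left: "\<lbrakk>c \<in> carrier K; d \<in> carrier K; t \<in> lin_terms K X\<rbrakk>
      \<Longrightarrow> (LSmult (c \<oplus> d) t, LAdd (LSmult c t) (LSmult d t)) \<in> lin_cong K X R"
  | smult_add_right: "\<lbrakk>c \<in> carrier K; s \<in> lin_terms K X; t \<in> lin_terms K X\<rbrakk>
      \<Longrightarrow> (LSmult c (LAdd s t), LAdd (LSmult c s) (LSmult c t)) \<in> lin_cong K X R"
  | smult_smult: "\<lbrakk>c \<in> carrier K; d \<in> carrier K; t \<in> lin_terms K X\<rbrakk>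
      \<Longrightarrow> (LSmult (c \<otimes> d) t, LSmult c (LSmult d t)) \<in> lin_cong K X R"
  | smult_one: "t \<in> lin_terms K X \<Longrightarrow> (LSmult \<one> t, t) \<in> lin_cong K X R"

text \<open>The list \<open>[x\<^sub>1, \<dots>, x\<^sub>n]\<close> stands for \<open>x\<^sub>1 \<otimes> \<dots> \<otimes> x\<^sub>n\<close>; the tensor power is the vector
  space generated by these symbols subject to multilinearity.\<close>

definition tensor_symbols :: "('k, 'a, 'm) hom_space_scheme \<Rightarrow> nat \<Rightarrow> 'a list set"
  where "tensor_symbols V n = {xs. length xs = n \<and> set xs \<subseteq> carrier V}"

definition multilinear_rels ::
  "('k, 'z) ring_scheme \<Rightarrow> ('k, 'a, 'm) hom_space_scheme \<Rightarrow> nat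
    \<Rightarrow> (('k, 'a list) lin_term \<times> ('k, 'a list) lin_term) set"
  where "multilinear_rels K V n =
    {(LGen (xs @ (x \<oplus>\<^bsub>V\<^esub> y) # ys), LAdd (LGen (xs @ x # ys)) (LGen (xs @ y # ys))) | xs ys x y.
       xs @ x # ys \<in> tensor_symbols V n \<and> y \<in> carrier V}
    \<union> {(LGen (xs @ (c \<odot>\<^bsub>V\<^esub> x) # ys), LSmult c (LGen (xs @ x # ys))) | xs ys x c.
       xs @ x # ys \<in> tensor_symbols V n \<and> c \<in> carrier K}"

definition tensor_cong ::
  "('k, 'z) ring_scheme \<Rightarrow> ('k, 'a, 'm) hom_space_scheme \<Rightarrow> nat
    \<Rightarrow> (('k, 'a list) lin_term \<times> ('k, 'a list) lin_term) set"
  where "tensor_cong K V n = lin_cong K (tensor_symbols V n) (multilinear_rels K V n)"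

definition tensor_power ::
  "('k, 'z) ring_scheme \<Rightarrow> ('k, 'a, 'm) hom_space_scheme \<Rightarrow> nat
    \<Rightarrow> ('k, ('k, 'a list) lin_term set) hom_space"
  where "tensor_power K V n = (let E = tensor_cong K V n in
    \<lparr>carrier = lin_terms K (tensor_symbols V n) // E, mult = undefined, one = undefined,
     zero = E `` {LZero},
     add = (\<lambda>A B. \<Union>s\<in>A. \<Union>t\<in>B. E `` {LAdd s t}),
     smult = (\<lambda>c A. \<Union>t\<in>A. E `` {LSmult c t}),
     twist = (\<lambda>A. \<Union>t\<in>A. E `` {map_lin_term id (map (twist V)) t})\<rparr>)"

definition pure_tensor ::
  "('k, 'z) ring_scheme \<Rightarrow> ('k, 'a, 'm) hom_space_scheme \<Rightarrow> 'a list \<Rightarrow> ('k, 'a list) lin_term set"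
  where "pure_tensor K V xs = tensor_cong K V (length xs) `` {LGen xs}"

text \<open>Positions are counted from 0 here, so the sign \<open>(- 1) ^ (j + 1)\<close> of the 1-based formula
  becomes \<open>(- 1) ^ j\<close>. For \<open>n \<le> 1\<close> the sum is empty and the map is zero.\<close>

definition leibniz_d_pure ::
  "('k, 'z) ring_scheme \<Rightarrow> ('k, 'a, 'm) hom_alg_scheme \<Rightarrow> nat \<Rightarrow> 'a list \<Rightarrow> ('k, 'a list) lin_term set"
  where "leibniz_d_pure K L n xs =
    finsum (tensor_power K L (n - 1))
      (\<lambda>(i, j). ((\<ominus>\<^bsub>K\<^esub> \<one>\<^bsub>K\<^esub>) [^]\<^bsub>K\<^esub> j) \<odot>\<^bsub>tensor_power K L (n - 1)\<^esub>
        pure_tensor K L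
          (map (\<lambda>l. if l = i then \<langle>xs ! i, xs ! j\<rangle>\<^bsub>L\<^esub> else twist L (xs ! l))
            (filter (\<lambda>l. l \<noteq> j) [0..<n])))
      {(i, j). i < j \<and> j < n}"

definition leibniz_d ::
  "('k, 'z) ring_scheme \<Rightarrow> ('k, 'a, 'm) hom_alg_scheme \<Rightarrow> nat
    \<Rightarrow> ('k, 'a list) lin_term set \<Rightarrow> ('k, 'a list) lin_term set"
  where "leibniz_d K L n A =
    the_elem (lin_eval (tensor_power K L (n - 1)) (leibniz_d_pure K L n) ` A)"

definition HL ::
  "('k, 'z) ring_scheme \<Rightarrow> ('k, 'a, 'm) hom_alg_scheme \<Rightarrow> nat
    \<Rightarrow> ('k, ('k, 'a list) lin_term set set) hom_space"
  where "HL K L n = hs_quot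
    ((tensor_power K L n)\<lparr>carrier :=
      a_kernel (tensor_power K L n) (tensor_power K L (n - 1)) (leibniz_d K L n)\<rparr>)
    (leibniz_d K L (Suc n) ` carrier (tensor_power K L (Suc n)))"

end

theory Submission
  imports Defs
begin

text \<open>
  Write \<open>E(L,M)\<close> for the exterior product of an ideal \<open>M\<close> of \<open>L\<close> with \<open>L\<close> itself, and \<open>\<lambda>\<close> for its map
  to \<open>L\<close>. The relations let a product of two symbols be rewritten as a symbol, so \<open>E(L,M)\<close> is spanned,
  as a vector space, by the elements \<open>x \<and> y\<close> with \<open>x\<close> or \<open>y\<close> in \<open>M\<close>; and the relations that remain say
  exactly that \<open>x \<and> y\<close> is bilinear, commutes with the self-maps and satisfies the Leibniz rule
  \<open>\<alpha>x \<and> [y,z] + [x,z] \<and> \<alpha>y = [x,y] \<and> \<alpha>z\<close> as soon as one of \<open>x, y, z\<close> lies in \<open>M\<close>. Thus \<open>E(L,M)\<close>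
  is the universal target of such Hom-Leibniz pairings (\<open>wedge_pairing\<close>, \<open>wedge_span\<close>,
  \<open>wedge_universal\<close>), and only this is used of it afterwards.

  For \<open>M = L\<close> the Leibniz rule is the vanishing of the boundary \<open>d\<^sub>3\<close>. Hence \<open>E(L,L)\<close> is the
  cokernel of \<open>d\<^sub>3\<close>, the map \<open>\<lambda>\<close> is \<open>d\<^sub>2\<close> up to sign, and
  \<open>HL\<^sub>2(L)\<close> is the kernel of \<open>\<lambda>\<close> on \<open>E(L,L)\<close> while \<open>HL\<^sub>1(L)\<close> is its cokernel
  (\<open>HL_2_iso\<close>, \<open>HL_1_iso\<close>).

  A surjection \<open>p : L \<rightarrow> L'\<close> with kernel \<open>R\<close> inside an ideal \<open>S\<close> gives an exact sequence
  \<open>E(L,R) \<rightarrow> E(L,S) \<rightarrow> E(L',p(S)) \<rightarrow> 0\<close> (\<open>exterior_right_exact\<close>), because modulo the image of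
  \<open>E(L,R)\<close> the element \<open>x \<and> y\<close> depends on \<open>p(x)\<close> and \<open>p(y)\<close> only. Applied to the extension, this is
  the upper row of a diagram whose lower row is \<open>M \<rightarrow> k \<rightarrow> g\<close> and whose vertical maps are the \<open>\<lambda>\<close>. The snake
  lemma yields the six terms on the right. Applied to the free presentation, and
  restricted to the kernels of \<open>\<lambda>\<close>, the sequence yields exactness at the kernel for \<open>S\<close>.

  Exactness at the kernel for \<open>M\<close> follows by comparing \<open>E(f,R) \<rightarrow> E(f,S) \<rightarrow> E(k,M)\<close> with
  \<open>E(f,R) \<rightarrow> E(f,f) \<rightarrow> E(k,k)\<close>. The input is that \<open>\<lambda>\<close> is injective on \<open>E(f,f)\<close> for \<open>f\<close> free (\<open>exterior_map_free_injective\<close>): the bracket \<open>([x,y], x \<and> y)\<close> makes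
  \<open>f \<times> E(f,f)\<close> a Hom-Leibniz algebra over \<open>f\<close>, and a homomorphic section of its projection to \<open>f\<close> has a second
  component that takes \<open>[x,y]\<close> back to \<open>x \<and> y\<close>.

  If the extension splits by \<open>\<sigma>\<close>, put \<open>e = \<sigma>\<pi>\<close>. The pairing \<open>(x - ex) \<and> y + ex \<and> (y - ey)\<close> removes from
  \<open>x \<and> y\<close> its part \<open>ex \<and> ey\<close> and retracts \<open>E(k,k)\<close> onto \<open>E(k,M)\<close>, so that
  \<open>E(k,M) \<rightarrow> E(k,k)\<close> is injective (\<open>exterior_split_injective\<close>); and \<open>\<sigma>\<close> induces a section of
  \<open>HL\<^sub>2(k) \<rightarrow> HL\<^sub>2(g)\<close>.
\<close>

section \<open>Hom-vector spaces, subspaces and quotients\<close>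

context hom_vector_space
begin

lemmas vs = hom_vector_space_axioms

declare twist_closed [simp]

lemma twist_zero [simp]: "twist V \<zero>\<^bsub>V\<^esub> = \<zero>\<^bsub>V\<^esub>"
  using twist_smult[of "\<zero>" "\<zero>\<^bsub>V\<^esub>"] by (simp add: twist_closed)

lemma minus_one_smult: "x \<in> carrier V \<Longrightarrow> (\<ominus> \<one>) \<odot>\<^bsub>V\<^esub> x = \<ominus>\<^bsub>V\<^esub> x"
  by (simp add: smult_l_minus)

lemma neg_zero [simp]: "\<ominus>\<^bsub>V\<^esub> \<zero>\<^bsub>V\<^esub> = \<zero>\<^bsub>V\<^esub>"
  using M.l_neg[of "\<zero>\<^bsub>V\<^esub>"] by simp

lemma diff_zero [simp]: "x \<in> carrier V \<Longrightarrow> x \<ominus>\<^bsub>V\<^esub> \<zero>\<^bsub>V\<^esub> = x"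
  by (simp add: a_minus_def)

lemma diff_self [simp]: "x \<in> carrier V \<Longrightarrow> x \<ominus>\<^bsub>V\<^esub> x = \<zero>\<^bsub>V\<^esub>"
  by (simp add: a_minus_def M.r_neg)

lemma diff_eq_zero_iff:
  "\<lbrakk>x \<in> carrier V; y \<in> carrier V\<rbrakk> \<Longrightarrow> x \<ominus>\<^bsub>V\<^esub> y = \<zero>\<^bsub>V\<^esub> \<longleftrightarrow> x = y"
  by (metis M.minus_equality M.minus_minus M.a_inv_closed a_minus_def diff_self)

lemma twist_neg: "x \<in> carrier V \<Longrightarrow> twist V (\<ominus>\<^bsub>V\<^esub> x) = \<ominus>\<^bsub>V\<^esub> twist V x"
  using twist_smult[of "\<ominus> \<one>" x] by (simp add: minus_one_smult)

lemma twist_diff: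
  "\<lbrakk>x \<in> carrier V; y \<in> carrier V\<rbrakk> \<Longrightarrow> twist V (x \<ominus>\<^bsub>V\<^esub> y) = twist V x \<ominus>\<^bsub>V\<^esub> twist V y"
  by (simp add: a_minus_def twist_add twist_neg)

end

text \<open>Every structure built below, from classes of terms, from cosets or from pairs, is the
  image \<open>cl ` T\<close> of a set of representatives on which the operations are explicit, so the axioms
  have to be checked on representatives only.\<close>

lemma hom_vector_space_image:
  fixes K (structure) and Q :: "('k, 'b, 'm) hom_space_scheme"
  assumes K: "field K" and carr: "carrier Q = cl ` T"
    and z: "z \<in> T" "\<zero>\<^bsub>Q\<^esub> = cl z"
    and ad: "\<And>s t. \<lbrakk>s \<in> T; t \<in> T\<rbrakk> \<Longrightarrow> ad s t \<in> T"
      "\<And>s t. \<lbrakk>s \<in> T; t \<in> T\<rbrakk> \<Longrightarrow> cl s \<oplus>\<^bsub>Q\<^esub> cl t = cl (ad s t)"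
    and sm: "\<And>c t. \<lbrakk>c \<in> carrier K; t \<in> T\<rbrakk> \<Longrightarrow> sm c t \<in> T"
      "\<And>c t. \<lbrakk>c \<in> carrier K; t \<in> T\<rbrakk> \<Longrightarrow> c \<odot>\<^bsub>Q\<^esub> cl t = cl (sm c t)"
    and tw: "\<And>t. t \<in> T \<Longrightarrow> tw t \<in> T" "\<And>t. t \<in> T \<Longrightarrow> twist Q (cl t) = cl (tw t)"
    and axs: "\<And>s t u. \<lbrakk>s \<in> T; t \<in> T; u \<in> T\<rbrakk> \<Longrightarrow> cl (ad (ad s t) u) = cl (ad s (ad t u))"
      "\<And>s t. \<lbrakk>s \<in> T; t \<in> T\<rbrakk> \<Longrightarrow> cl (ad s t) = cl (ad t s)"
      "\<And>t. t \<in> T \<Longrightarrow> cl (ad z t) = cl t"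
      "\<And>t. t \<in> T \<Longrightarrow> cl (ad t (sm (\<ominus> \<one>) t)) = cl z"
      "\<And>c d t. \<lbrakk>c \<in> carrier K; d \<in> carrier K; t \<in> T\<rbrakk> \<Longrightarrow> cl (sm (c \<oplus> d) t) = cl (ad (sm c t) (sm d t))"
      "\<And>c s t. \<lbrakk>c \<in> carrier K; s \<in> T; t \<in> T\<rbrakk> \<Longrightarrow> cl (sm c (ad s t)) = cl (ad (sm c s) (sm c t))"
      "\<And>c d t. \<lbrakk>c \<in> carrier K; d \<in> carrier K; t \<in> T\<rbrakk> \<Longrightarrow> cl (sm (c \<otimes> d) t) = cl (sm c (sm d t))"
      "\<And>t. t \<in> T \<Longrightarrow> cl (sm \<one> t) = cl t"
      "\<And>s t. \<lbrakk>s \<in> T; t \<in> T\<rbrakk> \<Longrightarrow> cl (tw (ad s t)) = cl (ad (tw s) (tw t))"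
      "\<And>c t. \<lbrakk>c \<in> carrier K; t \<in> T\<rbrakk> \<Longrightarrow> cl (tw (sm c t)) = cl (sm c (tw t))"
  shows "hom_vector_space K Q"
proof -
  interpret K: field K by fact
  note ops = z(2) ad(2) sm(2) tw(2)
  note cl = z(1) ad(1) sm(1) tw(1)
  have inv: "cl (sm (\<ominus> \<one>) t) \<oplus>\<^bsub>Q\<^esub> cl t = \<zero>\<^bsub>Q\<^esub>" if "t \<in> T" for t
    using that axs(2)[of "sm (\<ominus> \<one>) t" t] axs(4)[of t] by (simp add: ops cl)
  have "abelian_group Q"
  proof (rule abelian_groupI)
    fix x assume "x \<in> carrier Q"
    then obtain t where t: "t \<in> T" "x = cl t" by (auto simp: carr)
    then show "\<exists>y\<in>carrier Q. y \<oplus>\<^bsub>Q\<^esub> x = \<zero>\<^bsub>Q\<^esub>"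
      using inv[OF t(1)] by (auto simp: carr cl intro!: bexI[of _ "sm (\<ominus> \<one>) t"])
  qed (auto simp: carr ops cl axs(1,3) intro: axs(2))
  then have "module K Q"
    by (intro moduleI K.is_cring) (auto simp: carr ops cl axs(5-))
  then show ?thesis
    by (intro hom_vector_space.intro hom_vector_space_axioms.intro K)
      (auto simp: carr ops cl axs(9-))
qed

definition hs_subspace ::
  "('k, 'z) ring_scheme \<Rightarrow> ('k, 'a, 'm) hom_space_scheme \<Rightarrow> 'a set \<Rightarrow> bool"
  where "hs_subspace K V B \<longleftrightarrow> submodule B K V \<and> twist V ` B \<subseteq> B"

context hom_vector_space
begin

lemma submoduleI_closed:
  assumes "B \<subseteq> carrier V" "\<zero>\<^bsub>V\<^esub> \<in> B"
    and "\<And>x y. \<lbrakk>x \<in> B; y \<in> B\<rbrakk> \<Longrightarrow> x \<oplus>\<^bsub>V\<^esub> y \<in> B"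
    and "\<And>c x. \<lbrakk>c \<in> carrier K; x \<in> B\<rbrakk> \<Longrightarrow> c \<odot>\<^bsub>V\<^esub> x \<in> B"
  shows "submodule B K V"
proof (rule submoduleI)
  fix a assume a: "a \<in> B"
  then have "(\<ominus> \<one>) \<odot>\<^bsub>V\<^esub> a \<in> B" by (intro assms) simp
  with a assms(1) show "\<ominus>\<^bsub>V\<^esub> a \<in> B" by (simp add: minus_one_smult subset_iff)
qed (use assms in auto)

lemma subspaceI:
  assumes "B \<subseteq> carrier V" "\<zero>\<^bsub>V\<^esub> \<in> B"
    and "\<And>x y. \<lbrakk>x \<in> B; y \<in> B\<rbrakk> \<Longrightarrow> x \<oplus>\<^bsub>V\<^esub> y \<in> B"
    and "\<And>c x. \<lbrakk>c \<in> carrier K; x \<in> B\<rbrakk> \<Longrightarrow> c \<odot>\<^bsub>V\<^esub> x \<in> B"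
    and "\<And>x. x \<in> B \<Longrightarrow> twist V x \<in> B"
  shows "hs_subspace K V B"
  using submoduleI_closed[OF assms(1-4)] assms(5) by (auto simp: hs_subspace_def)

lemma submodule_zero: "submodule B K V \<Longrightarrow> \<zero>\<^bsub>V\<^esub> \<in> B"
  by (metis submoduleE(1,2,3,5) M.r_neg ex_in_conv subsetD)

lemma subspaceD:
  assumes "hs_subspace K V B"
  shows "B \<subseteq> carrier V" "x \<in> B \<Longrightarrow> x \<in> carrier V" "\<zero>\<^bsub>V\<^esub> \<in> B"
    "\<lbrakk>x \<in> B; y \<in> B\<rbrakk> \<Longrightarrow> x \<oplus>\<^bsub>V\<^esub> y \<in> B"
    "\<lbrakk>c \<in> carrier K; x \<in> B\<rbrakk> \<Longrightarrow> c \<odot>\<^bsub>V\<^esub> x \<in> B" "x \<in> B \<Longrightarrow> \<ominus>\<^bsub>V\<^esub> x \<in> B"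
    "x \<in> B \<Longrightarrow> twist V x \<in> B"
  using assms submoduleE submodule_zero by (auto simp: hs_subspace_def)

lemma subspace_restrict:
  assumes "hs_subspace K V B"
  shows "hom_vector_space K (V\<lparr>carrier := B\<rparr>)"
  by (rule hom_vector_space_image[where cl = id and T = B and z = "\<zero>\<^bsub>V\<^esub>" and ad = "(\<oplus>\<^bsub>V\<^esub>)"
        and sm = "(\<odot>\<^bsub>V\<^esub>)" and tw = "twist V"])
    (use subspaceD[OF assms] in \<open>auto simp: field_axioms M.a_ac smult_l_distr smult_r_distr
      smult_assoc1 twist_add twist_smult minus_one_smult M.r_neg\<close>)

text \<open>The span is closed under the self-map because the elements that the self-map sends into
  the span form a submodule containing \<open>S\<close>.\<close>

lemma subspace_span:
  assumes "S \<subseteq> carrier V" "\<And>x. x \<in> S \<Longrightarrow> twist V x \<in> S"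
  shows "hs_subspace K V (hs_span K V S)" "S \<subseteq> hs_span K V S"
    "\<And>D. \<lbrakk>submodule D K V; S \<subseteq> D\<rbrakk> \<Longrightarrow> hs_span K V S \<subseteq> D"
proof -
  let ?B = "hs_span K V S"
  show S: "S \<subseteq> ?B" and least: "\<And>D. \<lbrakk>submodule D K V; S \<subseteq> D\<rbrakk> \<Longrightarrow> hs_span K V S \<subseteq> D"
    by (auto simp: hs_span_def)
  have inB: "x \<in> ?B" if "\<And>W. \<lbrakk>submodule W K V; S \<subseteq> W\<rbrakk> \<Longrightarrow> x \<in> W" for x
    using that by (auto simp: hs_span_def)
  have Bin: "x \<in> W" if "x \<in> ?B" "submodule W K V" "S \<subseteq> W" for x W
    using that by (auto simp: hs_span_def)
  have carr: "?B \<subseteq> carrier V"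
    using least[OF carrier_is_submodule assms(1)] .
  have sub: "submodule ?B K V"
  proof (rule submoduleI_closed[OF carr])
    show "\<zero>\<^bsub>V\<^esub> \<in> ?B" by (rule inB) (rule submodule_zero)
    fix x y assume "x \<in> ?B" "y \<in> ?B"
    then show "x \<oplus>\<^bsub>V\<^esub> y \<in> ?B" by (intro inB) (meson Bin submoduleE(5))
  next
    fix c x assume "c \<in> carrier K" "x \<in> ?B"
    then show "c \<odot>\<^bsub>V\<^esub> x \<in> ?B" by (intro inB) (meson Bin submoduleE(4))
  qed
  let ?D = "{x \<in> carrier V. twist V x \<in> ?B}"
  have "submodule ?D K V"
    by (rule submoduleI_closed) (use sub submoduleE[OF sub] submodule_zero[OF sub] twist_closed in
        \<open>auto simp: twist_add twist_smult\<close>)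
  then have "?B \<subseteq> ?D"
    by (rule least) (use S assms in auto)
  with sub show "hs_subspace K V ?B" by (auto simp: hs_subspace_def)
qed

end

lemma hs_homI:
  assumes "\<And>x. x \<in> carrier V \<Longrightarrow> f x \<in> carrier W"
    and "\<And>x y. \<lbrakk>x \<in> carrier V; y \<in> carrier V\<rbrakk> \<Longrightarrow> f (x \<oplus>\<^bsub>V\<^esub> y) = f x \<oplus>\<^bsub>W\<^esub> f y"
    and "\<And>c x. \<lbrakk>c \<in> carrier K; x \<in> carrier V\<rbrakk> \<Longrightarrow> f (c \<odot>\<^bsub>V\<^esub> x) = c \<odot>\<^bsub>W\<^esub> f x"
    and "\<And>x. x \<in> carrier V \<Longrightarrow> f (twist V x) = twist W (f x)"
  shows "f \<in> hs_hom K V W"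
  using assms by (auto simp: hs_hom_def)

lemma hs_homD:
  assumes "f \<in> hs_hom K V W"
  shows "x \<in> carrier V \<Longrightarrow> f x \<in> carrier W"
    and "\<lbrakk>x \<in> carrier V; y \<in> carrier V\<rbrakk> \<Longrightarrow> f (x \<oplus>\<^bsub>V\<^esub> y) = f x \<oplus>\<^bsub>W\<^esub> f y"
    and "\<lbrakk>c \<in> carrier K; x \<in> carrier V\<rbrakk> \<Longrightarrow> f (c \<odot>\<^bsub>V\<^esub> x) = c \<odot>\<^bsub>W\<^esub> f x"
    and "x \<in> carrier V \<Longrightarrow> f (twist V x) = twist W (f x)"
  using assms by (auto simp: hs_hom_def)

lemma hs_hom_id: "(\<lambda>x. x) \<in> hs_hom K V V"
  by (simp add: hs_hom_def)

lemma (in hom_vector_space) hs_hom_zero: "(\<lambda>_. \<zero>\<^bsub>V\<^esub>) \<in> hs_hom K U V"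
  by (rule hs_homI) auto

lemma hs_hom_comp:
  assumes "f \<in> hs_hom K U V" "g \<in> hs_hom K V W"
  shows "(\<lambda>x. g (f x)) \<in> hs_hom K U W"
  by (rule hs_homI) (simp_all add: hs_homD[OF assms(1)] hs_homD[OF assms(2)])

locale hs_map = V: hom_vector_space K V + W: hom_vector_space K W
  for K and V :: "('k, 'a, 'm) hom_space_scheme" and W :: "('k, 'b, 'n) hom_space_scheme" +
  fixes f
  assumes hs: "f \<in> hs_hom K V W"
begin

lemmas closed [simp] = hs_homD(1)[OF hs]
  and add = hs_homD(2)[OF hs]
  and smult = hs_homD(3)[OF hs]
  and tw = hs_homD(4)[OF hs]

lemma zero [simp]: "f \<zero>\<^bsub>V\<^esub> = \<zero>\<^bsub>W\<^esub>"
  using smult[of "\<zero>\<^bsub>K\<^esub>" "\<zero>\<^bsub>V\<^esub>"] by simp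

lemma neg: "x \<in> carrier V \<Longrightarrow> f (\<ominus>\<^bsub>V\<^esub> x) = \<ominus>\<^bsub>W\<^esub> f x"
  using smult[of "\<ominus>\<^bsub>K\<^esub> \<one>\<^bsub>K\<^esub>" x] by (simp add: V.minus_one_smult W.minus_one_smult)

lemma diff: "\<lbrakk>x \<in> carrier V; y \<in> carrier V\<rbrakk> \<Longrightarrow> f (x \<ominus>\<^bsub>V\<^esub> y) = f x \<ominus>\<^bsub>W\<^esub> f y"
  by (simp add: a_minus_def add neg)

lemma kernel_subspace: "hs_subspace K V (a_kernel V W f)"
  by (rule V.subspaceI) (auto simp: a_kernel_def' add smult tw)

lemma image_subspace:
  assumes "hs_subspace K V B"
  shows "hs_subspace K W (f ` B)"
proof (rule W.subspaceI)
  note B = V.subspaceD[OF assms]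
  show "f ` B \<subseteq> carrier W" using B by auto
  show "\<zero>\<^bsub>W\<^esub> \<in> f ` B" using B(3) zero by (metis imageI)
  fix x assume "x \<in> f ` B"
  then obtain u where u: "u \<in> B" "x = f u" by auto
  show "twist W x \<in> f ` B" using u B by (auto simp: tw[symmetric])
  show "c \<odot>\<^bsub>W\<^esub> x \<in> f ` B" if "c \<in> carrier K" for c
    using u B that by (auto simp: smult[symmetric])
  fix y assume "y \<in> f ` B"
  then obtain v where "v \<in> B" "y = f v" by auto
  then show "x \<oplus>\<^bsub>W\<^esub> y \<in> f ` B" using u B by (auto simp: add[symmetric])
qed

lemma preimage_submodule:
  assumes "submodule D K W"
  shows "submodule {x \<in> carrier V. f x \<in> D} K V"
  by (rule V.submoduleI_closed) (use W.submoduleE[OF assms] W.submodule_zero[OF assms] in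
      \<open>auto simp: add smult\<close>)

end

lemma (in hom_vector_space) whole_subspace: "hs_subspace K V (carrier V)"
  by (rule subspaceI) auto

lemma hs_mapI:
  "\<lbrakk>hom_vector_space K V; hom_vector_space K W; f \<in> hs_hom K V W\<rbrakk> \<Longrightarrow> hs_map K V W f"
  by (simp add: hs_map_def hs_map_axioms_def)

lemma (in hom_vector_space) equalizer_submodule:
  assumes W: "hom_vector_space K W" and "f \<in> hs_hom K V W" "g \<in> hs_hom K V W"
  shows "submodule {x \<in> carrier V. f x = g x} K V"
proof -
  interpret f: hs_map K V W f by (rule hs_mapI[OF vs W assms(2)])
  interpret g: hs_map K V W g by (rule hs_mapI[OF vs W assms(3)])
  show ?thesis
    by (rule submoduleI_closed) (auto simp: f.add f.smult g.add g.smult)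
qed

lemma the_elem_image: "\<lbrakk>A \<noteq> {}; \<And>x. x \<in> A \<Longrightarrow> f x = c\<rbrakk> \<Longrightarrow> the_elem (f ` A) = c"
  by (metis image_cong image_constant_conv the_elem_eq)

text \<open>The cosets of \<open>B\<close> carry two records, \<^const>\<open>hs_quot\<close> and \<^const>\<open>hl_quot\<close>; leaving the
  record \<open>Q\<close> open covers both.\<close>

locale subspace_quotient = hom_vector_space K V
  for K (structure) and V :: "('k, 'a, 'm) hom_space_scheme" (structure) +
  fixes B :: "'a set" and Q :: "('k, 'a set, 'n) hom_space_scheme"
  assumes subspace: "hs_subspace K V B"
    and quotient: "carrier Q = a_rcosets\<^bsub>V\<^esub> B" "\<zero>\<^bsub>Q\<^esub> = B" "add Q = set_add V"
      "smult Q = (\<lambda>c A. \<Union>a\<in>A. B +>\<^bsub>V\<^esub> (c \<odot>\<^bsub>V\<^esub> a))"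
      "twist Q = (\<lambda>A. \<Union>a\<in>A. B +>\<^bsub>V\<^esub> twist V a)"
begin

lemmas B = subspaceD[OF subspace]

lemma submod: "submodule B K V" using subspace by (simp add: hs_subspace_def)

lemma abelian_subgroup: "abelian_subgroup B V"
  using submod M.abelian_group_axioms
  by (intro abelian_subgroupI3) (auto simp: submodule_def additive_subgroup_def)

lemma coset_eq_iff:
  assumes "x \<in> carrier V" "y \<in> carrier V"
  shows "B +>\<^bsub>V\<^esub> x = B +>\<^bsub>V\<^esub> y \<longleftrightarrow> x \<ominus>\<^bsub>V\<^esub> y \<in> B"
proof
  assume "B +>\<^bsub>V\<^esub> x = B +>\<^bsub>V\<^esub> y"
  then have "x \<in> B +>\<^bsub>V\<^esub> y"
    using abelian_subgroup.a_rcos_self[OF abelian_subgroup assms(1)] by simp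
  then show "x \<ominus>\<^bsub>V\<^esub> y \<in> B"
    using abelian_subgroup.a_rcos_module[OF abelian_subgroup assms(2,1)] by (simp add: a_minus_def)
next
  assume "x \<ominus>\<^bsub>V\<^esub> y \<in> B"
  then have "x \<in> B +>\<^bsub>V\<^esub> y"
    using abelian_subgroup.a_rcos_module[OF abelian_subgroup assms(2,1)] by (simp add: a_minus_def)
  then show "B +>\<^bsub>V\<^esub> x = B +>\<^bsub>V\<^esub> y"
    by (rule abelian_subgroup.a_repr_independence'[OF abelian_subgroup _ assms(2), symmetric])
qed

lemma coset_zero_iff: "x \<in> carrier V \<Longrightarrow> B +>\<^bsub>V\<^esub> x = B \<longleftrightarrow> x \<in> B"
  using coset_eq_iff[of x "\<zero>\<^bsub>V\<^esub>"] M.a_coset_add_zero[OF B(1)] by simp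

lemma coset_self: "x \<in> carrier V \<Longrightarrow> x \<in> B +>\<^bsub>V\<^esub> x"
  by (rule abelian_subgroup.a_rcos_self[OF abelian_subgroup])

lemma in_coset_iff:
  "x \<in> carrier V \<Longrightarrow> y \<in> B +>\<^bsub>V\<^esub> x \<longleftrightarrow> y \<in> carrier V \<and> y \<ominus>\<^bsub>V\<^esub> x \<in> B"
  unfolding a_minus_def
  by (metis abelian_subgroup.a_rcos_module[OF abelian_subgroup]
      abelian_subgroup.a_elemrcos_carrier[OF abelian_subgroup])

lemma carrier_Q: "carrier Q = (\<lambda>x. B +>\<^bsub>V\<^esub> x) ` carrier V"
  by (auto simp: quotient A_RCOSETS_def')

lemma zero_Q: "\<zero>\<^bsub>Q\<^esub> = B +>\<^bsub>V\<^esub> \<zero>\<^bsub>V\<^esub>"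
  using coset_zero_iff[of "\<zero>\<^bsub>V\<^esub>"] B by (simp add: quotient)

lemma add_Q:
  "\<lbrakk>x \<in> carrier V; y \<in> carrier V\<rbrakk>
    \<Longrightarrow> (B +>\<^bsub>V\<^esub> x) \<oplus>\<^bsub>Q\<^esub> (B +>\<^bsub>V\<^esub> y) = B +>\<^bsub>V\<^esub> (x \<oplus>\<^bsub>V\<^esub> y)"
  by (simp add: quotient abelian_subgroup.a_rcos_sum[OF abelian_subgroup])

lemma union_coset:
  assumes x: "x \<in> carrier V" and g: "\<And>y. y \<in> carrier V \<Longrightarrow> g y \<in> carrier V"
    and "\<And>y. \<lbrakk>y \<in> carrier V; y \<ominus>\<^bsub>V\<^esub> x \<in> B\<rbrakk> \<Longrightarrow> g y \<ominus>\<^bsub>V\<^esub> g x \<in> B"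
  shows "(\<Union>a\<in>B +>\<^bsub>V\<^esub> x. B +>\<^bsub>V\<^esub> g a) = B +>\<^bsub>V\<^esub> g x"
proof -
  have "B +>\<^bsub>V\<^esub> g a = B +>\<^bsub>V\<^esub> g x" if "a \<in> B +>\<^bsub>V\<^esub> x" for a
    using that assms by (simp add: in_coset_iff coset_eq_iff)
  with coset_self[OF x] show ?thesis by (intro SUP_eq_const) blast+
qed

lemma smult_Q:
  assumes "c \<in> carrier K" "x \<in> carrier V"
  shows "c \<odot>\<^bsub>Q\<^esub> (B +>\<^bsub>V\<^esub> x) = B +>\<^bsub>V\<^esub> (c \<odot>\<^bsub>V\<^esub> x)"
proof -
  have "c \<odot>\<^bsub>V\<^esub> y \<ominus>\<^bsub>V\<^esub> c \<odot>\<^bsub>V\<^esub> x = c \<odot>\<^bsub>V\<^esub> (y \<ominus>\<^bsub>V\<^esub> x)" if "y \<in> carrier V" for y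
    using assms that by (simp add: a_minus_def smult_r_distr smult_r_minus)
  then show ?thesis
    using union_coset[of x "\<lambda>y. c \<odot>\<^bsub>V\<^esub> y"] assms B(5) by (simp add: quotient)
qed

lemma twist_Q: "x \<in> carrier V \<Longrightarrow> twist Q (B +>\<^bsub>V\<^esub> x) = B +>\<^bsub>V\<^esub> twist V x"
  unfolding quotient by (rule union_coset) (simp_all add: B(7) flip: twist_diff)

lemma quotient_hom_vector_space: "hom_vector_space K Q"
proof (rule hom_vector_space_image[where cl = "\<lambda>x. B +>\<^bsub>V\<^esub> x" and T = "carrier V"
        and z = "\<zero>\<^bsub>V\<^esub>" and ad = "(\<oplus>\<^bsub>V\<^esub>)" and sm = "(\<odot>\<^bsub>V\<^esub>)" and tw = "twist V"])
  show "field K" by (rule field_axioms)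
  show "\<zero>\<^bsub>Q\<^esub> = B +>\<^bsub>V\<^esub> \<zero>\<^bsub>V\<^esub>" by (rule zero_Q)
  show "B +>\<^bsub>V\<^esub> (s \<oplus>\<^bsub>V\<^esub> t) = B +>\<^bsub>V\<^esub> (t \<oplus>\<^bsub>V\<^esub> s)" if "s \<in> carrier V" "t \<in> carrier V" for s t
    using that by (simp only: M.a_comm)
qed (simp_all add: carrier_Q add_Q smult_Q twist_Q M.a_assoc smult_l_distr smult_r_distr
      smult_assoc1 twist_add twist_smult minus_one_smult M.r_neg)

lemma projection: "(\<lambda>x. B +>\<^bsub>V\<^esub> x) \<in> hs_hom K V Q"
  by (rule hs_homI) (auto simp: carrier_Q add_Q smult_Q twist_Q)

lemma coset_in_Q [simp]: "x \<in> carrier V \<Longrightarrow> B +>\<^bsub>V\<^esub> x \<in> carrier Q"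
  by (simp add: carrier_Q)

text \<open>The value \<open>the_elem (f ` A)\<close> is kept explicit because \<^const>\<open>exterior_map\<close> is defined in this
  form.\<close>

lemma descend:
  assumes W: "hom_vector_space K W" and f: "f \<in> hs_hom K V W" and ker: "\<And>b. b \<in> B \<Longrightarrow> f b = \<zero>\<^bsub>W\<^esub>"
  shows "(\<lambda>A. the_elem (f ` A)) \<in> hs_hom K Q W"
    and "x \<in> carrier V \<Longrightarrow> the_elem (f ` (B +>\<^bsub>V\<^esub> x)) = f x"
proof -
  interpret f: hs_map K V W f
    by (rule hs_mapI[OF vs W f])
  show val: "the_elem (f ` (B +>\<^bsub>V\<^esub> x)) = f x" if x: "x \<in> carrier V" for x
  proof (rule the_elem_image)
    show "B +>\<^bsub>V\<^esub> x \<noteq> {}" using coset_self[OF x] by auto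
    fix y assume "y \<in> B +>\<^bsub>V\<^esub> x"
    then have y: "y \<in> carrier V" "f (y \<ominus>\<^bsub>V\<^esub> x) = \<zero>\<^bsub>W\<^esub>" using x ker by (auto simp: in_coset_iff)
    then show "f y = f x" using x by (simp add: f.diff f.W.diff_eq_zero_iff)
  qed
  show "(\<lambda>A. the_elem (f ` A)) \<in> hs_hom K Q W"
    by (rule hs_homI)
      (auto simp: carrier_Q add_Q smult_Q twist_Q val f.add f.smult f.tw twist_closed)
qed

end

lemma subspace_quotient_hs_quot:
  assumes "hom_vector_space K V" "hs_subspace K V B"
  shows "subspace_quotient K V B (hs_quot V B)"
  using assms by (auto simp: subspace_quotient_def subspace_quotient_axioms_def hs_quot_def)

section \<open>Hom-Leibniz pairings\<close>

context hom_vector_space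
begin

lemma eq_diff_iff:
  assumes "a \<in> carrier V" "b \<in> carrier V" "c \<in> carrier V"
  shows "a = b \<ominus>\<^bsub>V\<^esub> c \<longleftrightarrow> a \<oplus>\<^bsub>V\<^esub> c = b"
  using assms by (auto simp: a_minus_def M.a_assoc M.l_neg M.r_neg)

lemma diff_smult:
  "\<lbrakk>a \<in> carrier V; b \<in> carrier V\<rbrakk> \<Longrightarrow> a \<ominus>\<^bsub>V\<^esub> b = a \<oplus>\<^bsub>V\<^esub> (\<ominus> \<one>) \<odot>\<^bsub>V\<^esub> b"
  by (simp add: minus_one_smult a_minus_def)

lemma add_eq_zero_iff:
  "\<lbrakk>a \<in> carrier V; b \<in> carrier V\<rbrakk> \<Longrightarrow> a \<oplus>\<^bsub>V\<^esub> b = \<zero>\<^bsub>V\<^esub> \<longleftrightarrow> a = \<ominus>\<^bsub>V\<^esub> b"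
  using eq_diff_iff[of a "\<zero>\<^bsub>V\<^esub>" b] by (simp add: a_minus_def)

end

context hom_leibniz
begin

declare bracket_closed [simp]

lemma bracket_zero_left [simp]: "x \<in> carrier L \<Longrightarrow> \<langle>\<zero>\<^bsub>L\<^esub>, x\<rangle>\<^bsub>L\<^esub> = \<zero>\<^bsub>L\<^esub>"
  using bracket_smult_left[of "\<zero>" "\<zero>\<^bsub>L\<^esub>" x] by simp

lemma bracket_zero_right [simp]: "x \<in> carrier L \<Longrightarrow> \<langle>x, \<zero>\<^bsub>L\<^esub>\<rangle>\<^bsub>L\<^esub> = \<zero>\<^bsub>L\<^esub>"
  using bracket_smult_right[of "\<zero>" x "\<zero>\<^bsub>L\<^esub>"] by simp

lemma leibniz_add:
  "\<lbrakk>x \<in> carrier L; y \<in> carrier L; z \<in> carrier L\<rbrakk>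
    \<Longrightarrow> \<langle>twist L x, \<langle>y, z\<rangle>\<^bsub>L\<^esub>\<rangle>\<^bsub>L\<^esub> \<oplus>\<^bsub>L\<^esub> \<langle>\<langle>x, z\<rangle>\<^bsub>L\<^esub>, twist L y\<rangle>\<^bsub>L\<^esub> = \<langle>\<langle>x, y\<rangle>\<^bsub>L\<^esub>, twist L z\<rangle>\<^bsub>L\<^esub>"
  by (simp add: eq_diff_iff[symmetric] hom_leibniz_identity)

lemma whole_ideal: "hl_ideal K L (carrier L)"
  using carrier_is_submodule by (auto simp: hl_ideal_def)

end

locale leibniz_ideal = hom_leibniz K L
  for K (structure) and L :: "('k, 'a, 'm) hom_alg_scheme" (structure) +
  fixes M
  assumes ideal: "hl_ideal K L M"
begin

lemma ideal_subspace: "hs_subspace K L M"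
  using ideal by (simp add: hl_ideal_def hs_subspace_def)

lemmas M_subset = subspaceD(1)[OF ideal_subspace]
  and M_carrier [simp] = subspaceD(2)[OF ideal_subspace]
  and M_zero [simp] = subspaceD(3)[OF ideal_subspace]
  and M_add [simp] = subspaceD(4)[OF ideal_subspace]
  and M_smult [simp] = subspaceD(5)[OF ideal_subspace]
  and M_neg [simp] = subspaceD(6)[OF ideal_subspace]
  and M_twist [simp] = subspaceD(7)[OF ideal_subspace]

lemma M_bracket [simp]:
  "\<lbrakk>x \<in> M; y \<in> carrier L\<rbrakk> \<Longrightarrow> \<langle>x, y\<rangle>\<^bsub>L\<^esub> \<in> M"
  "\<lbrakk>y \<in> M; x \<in> carrier L\<rbrakk> \<Longrightarrow> \<langle>x, y\<rangle>\<^bsub>L\<^esub> \<in> M"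
  using ideal by (auto simp: hl_ideal_def)

lemma M_diff [simp]: "\<lbrakk>x \<in> M; y \<in> M\<rbrakk> \<Longrightarrow> x \<ominus>\<^bsub>L\<^esub> y \<in> M"
  by (simp add: a_minus_def)

end

text \<open>The data of a linear map on the exterior product of \<open>M\<close> with \<open>L\<close>, where \<open>\<beta> x y\<close> is the value
  at \<open>x \<and> y\<close>. Both families of symbols agree on \<open>M \<times> M\<close> in the exterior product, so one function
  describes them, defined on the pairs with an entry in \<open>M\<close>. The single Leibniz rule, stated without
  subtraction, accounts for all six mixed relations.\<close>

locale leibniz_pairing = leibniz_ideal K L M + W: hom_vector_space K W
  for K (structure) and L :: "('k, 'a, 'm) hom_alg_scheme" (structure) and M
    and W :: "('k, 'w, 'n) hom_space_scheme" +
  fixes \<beta> :: "'a \<Rightarrow> 'a \<Rightarrow> 'w"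
  assumes pair_closed: "\<lbrakk>x \<in> carrier L; y \<in> carrier L; x \<in> M \<or> y \<in> M\<rbrakk> \<Longrightarrow> \<beta> x y \<in> carrier W"
    and pair_add_left: "\<lbrakk>x \<in> carrier L; x' \<in> carrier L; y \<in> carrier L; x \<in> M \<and> x' \<in> M \<or> y \<in> M\<rbrakk>
      \<Longrightarrow> \<beta> (x \<oplus>\<^bsub>L\<^esub> x') y = \<beta> x y \<oplus>\<^bsub>W\<^esub> \<beta> x' y"
    and pair_add_right: "\<lbrakk>x \<in> carrier L; y \<in> carrier L; y' \<in> carrier L; x \<in> M \<or> y \<in> M \<and> y' \<in> M\<rbrakk>
      \<Longrightarrow> \<beta> x (y \<oplus>\<^bsub>L\<^esub> y') = \<beta> x y \<oplus>\<^bsub>W\<^esub> \<beta> x y'"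
    and pair_smult_left: "\<lbrakk>c \<in> carrier K; x \<in> carrier L; y \<in> carrier L; x \<in> M \<or> y \<in> M\<rbrakk>
      \<Longrightarrow> \<beta> (c \<odot>\<^bsub>L\<^esub> x) y = c \<odot>\<^bsub>W\<^esub> \<beta> x y"
    and pair_smult_right: "\<lbrakk>c \<in> carrier K; x \<in> carrier L; y \<in> carrier L; x \<in> M \<or> y \<in> M\<rbrakk>
      \<Longrightarrow> \<beta> x (c \<odot>\<^bsub>L\<^esub> y) = c \<odot>\<^bsub>W\<^esub> \<beta> x y"
    and pair_twist: "\<lbrakk>x \<in> carrier L; y \<in> carrier L; x \<in> M \<or> y \<in> M\<rbrakk>
      \<Longrightarrow> \<beta> (twist L x) (twist L y) = twist W (\<beta> x y)"
    and pair_leibniz: "\<lbrakk>x \<in> carrier L; y \<in> carrier L; z \<in> carrier L; x \<in> M \<or> y \<in> M \<or> z \<in> M\<rbrakk>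
      \<Longrightarrow> \<beta> (twist L x) \<langle>y, z\<rangle>\<^bsub>L\<^esub> \<oplus>\<^bsub>W\<^esub> \<beta> \<langle>x, z\<rangle>\<^bsub>L\<^esub> (twist L y) = \<beta> \<langle>x, y\<rangle>\<^bsub>L\<^esub> (twist L z)"
begin

lemma pair_zero_left [simp]: "y \<in> carrier L \<Longrightarrow> \<beta> \<zero>\<^bsub>L\<^esub> y = \<zero>\<^bsub>W\<^esub>"
  using pair_smult_left[of "\<zero>" "\<zero>\<^bsub>L\<^esub>" y] pair_closed[of "\<zero>\<^bsub>L\<^esub>" y] by simp

lemma pair_zero_right [simp]: "x \<in> carrier L \<Longrightarrow> \<beta> x \<zero>\<^bsub>L\<^esub> = \<zero>\<^bsub>W\<^esub>"
  using pair_smult_right[of "\<zero>" x "\<zero>\<^bsub>L\<^esub>"] pair_closed[of x "\<zero>\<^bsub>L\<^esub>"] by simp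

lemma pair_neg:
  assumes "x \<in> carrier L" "y \<in> carrier L" "x \<in> M \<or> y \<in> M"
  shows "\<beta> (\<ominus>\<^bsub>L\<^esub> x) y = \<ominus>\<^bsub>W\<^esub> \<beta> x y" "\<beta> x (\<ominus>\<^bsub>L\<^esub> y) = \<ominus>\<^bsub>W\<^esub> \<beta> x y"
  using pair_smult_left[of "\<ominus> \<one>" x y] pair_smult_right[of "\<ominus> \<one>" x y] pair_closed[of x y] assms
  by (auto simp: minus_one_smult W.minus_one_smult)

lemma pair_diff_left:
  assumes "x \<in> carrier L" "x' \<in> carrier L" "y \<in> carrier L" "x \<in> M \<and> x' \<in> M \<or> y \<in> M"
  shows "\<beta> (x \<ominus>\<^bsub>L\<^esub> x') y = \<beta> x y \<ominus>\<^bsub>W\<^esub> \<beta> x' y"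
proof -
  have "\<ominus>\<^bsub>L\<^esub> x' \<in> M \<or> y \<in> M" using assms(4) M_neg by blast
  with assms show ?thesis
    by (auto simp: a_minus_def pair_add_left pair_neg)
qed

lemma pair_diff_right:
  assumes "x \<in> carrier L" "y \<in> carrier L" "y' \<in> carrier L" "x \<in> M \<or> y \<in> M \<and> y' \<in> M"
  shows "\<beta> x (y \<ominus>\<^bsub>L\<^esub> y') = \<beta> x y \<ominus>\<^bsub>W\<^esub> \<beta> x y'"
proof -
  have "x \<in> M \<or> \<ominus>\<^bsub>L\<^esub> y' \<in> M" using assms(4) M_neg by blast
  with assms show ?thesis
    by (auto simp: a_minus_def pair_add_right pair_neg)
qed

lemma pair_leibniz_closed:
  assumes "x \<in> carrier L" "y \<in> carrier L" "z \<in> carrier L" "x \<in> M \<or> y \<in> M \<or> z \<in> M"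
  shows "\<beta> (twist L x) \<langle>y, z\<rangle>\<^bsub>L\<^esub> \<in> carrier W" "\<beta> \<langle>x, y\<rangle>\<^bsub>L\<^esub> (twist L z) \<in> carrier W"
  using assms by (auto intro!: pair_closed)

lemma pair_leibniz1:
  assumes "x \<in> carrier L" "y \<in> carrier L" "z \<in> carrier L" "x \<in> M \<or> y \<in> M \<or> z \<in> M"
  shows "\<beta> (twist L x) \<langle>y, z\<rangle>\<^bsub>L\<^esub>
    = \<beta> \<langle>x, y\<rangle>\<^bsub>L\<^esub> (twist L z) \<oplus>\<^bsub>W\<^esub> (\<ominus> \<one>) \<odot>\<^bsub>W\<^esub> \<beta> \<langle>x, z\<rangle>\<^bsub>L\<^esub> (twist L y)"
  using pair_leibniz[OF assms] pair_leibniz_closed[of x y z] pair_leibniz_closed[of x z y] assms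
  by (simp add: W.diff_smult[symmetric] W.eq_diff_iff disj_commute)

lemma pair_leibniz2:
  assumes "x \<in> carrier L" "y \<in> carrier L" "z \<in> carrier L" "x \<in> M \<or> y \<in> M \<or> z \<in> M"
  shows "\<beta> \<langle>x, z\<rangle>\<^bsub>L\<^esub> (twist L y)
    = \<beta> \<langle>x, y\<rangle>\<^bsub>L\<^esub> (twist L z) \<oplus>\<^bsub>W\<^esub> (\<ominus> \<one>) \<odot>\<^bsub>W\<^esub> \<beta> (twist L x) \<langle>y, z\<rangle>\<^bsub>L\<^esub>"
  using pair_leibniz[OF assms] pair_leibniz_closed[of x y z] pair_leibniz_closed[of x z y] assms
  by (simp add: W.diff_smult[symmetric] W.eq_diff_iff disj_commute W.M.a_comm)

text \<open>The Leibniz rules for \<open>(x, y, z)\<close> and \<open>(x, z, y)\<close> have the same terms on exchanged sides;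
  adding them leaves the antisymmetry.\<close>

lemma pair_antisym:
  assumes "x \<in> carrier L" "y \<in> carrier L" "z \<in> carrier L" "x \<in> M \<or> y \<in> M \<or> z \<in> M"
  shows "\<beta> (twist L x) \<langle>y, z\<rangle>\<^bsub>L\<^esub> = (\<ominus> \<one>) \<odot>\<^bsub>W\<^esub> \<beta> (twist L x) \<langle>z, y\<rangle>\<^bsub>L\<^esub>"
proof -
  have c: "\<beta> (twist L x) \<langle>y, z\<rangle>\<^bsub>L\<^esub> \<in> carrier W" "\<beta> (twist L x) \<langle>z, y\<rangle>\<^bsub>L\<^esub> \<in> carrier W"
    "\<beta> \<langle>x, y\<rangle>\<^bsub>L\<^esub> (twist L z) \<in> carrier W" "\<beta> \<langle>x, z\<rangle>\<^bsub>L\<^esub> (twist L y) \<in> carrier W"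
    using assms pair_leibniz_closed[of x y z] pair_leibniz_closed[of x z y] by auto
  have 1: "\<beta> (twist L x) \<langle>y, z\<rangle>\<^bsub>L\<^esub> \<oplus>\<^bsub>W\<^esub> \<beta> \<langle>x, z\<rangle>\<^bsub>L\<^esub> (twist L y) = \<beta> \<langle>x, y\<rangle>\<^bsub>L\<^esub> (twist L z)"
    by (rule pair_leibniz[OF assms])
  have 2: "\<beta> (twist L x) \<langle>z, y\<rangle>\<^bsub>L\<^esub> \<oplus>\<^bsub>W\<^esub> \<beta> \<langle>x, y\<rangle>\<^bsub>L\<^esub> (twist L z) = \<beta> \<langle>x, z\<rangle>\<^bsub>L\<^esub> (twist L y)"
    by (rule pair_leibniz) (use assms in auto)
  have "(\<beta> (twist L x) \<langle>y, z\<rangle>\<^bsub>L\<^esub> \<oplus>\<^bsub>W\<^esub> \<beta> (twist L x) \<langle>z, y\<rangle>\<^bsub>L\<^esub>) \<oplus>\<^bsub>W\<^esub> \<beta> \<langle>x, y\<rangle>\<^bsub>L\<^esub> (twist L z)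
      = \<beta> \<langle>x, y\<rangle>\<^bsub>L\<^esub> (twist L z)"
    using c 1 2 by (simp add: W.M.a_assoc)
  then have "\<beta> (twist L x) \<langle>y, z\<rangle>\<^bsub>L\<^esub> \<oplus>\<^bsub>W\<^esub> \<beta> (twist L x) \<langle>z, y\<rangle>\<^bsub>L\<^esub> = \<zero>\<^bsub>W\<^esub>"
    using c W.eq_diff_iff[of "\<beta> (twist L x) \<langle>y, z\<rangle>\<^bsub>L\<^esub> \<oplus>\<^bsub>W\<^esub> \<beta> (twist L x) \<langle>z, y\<rangle>\<^bsub>L\<^esub>"] by simp
  then show ?thesis using c by (simp add: W.add_eq_zero_iff W.minus_one_smult)
qed

end

lemma (in leibniz_ideal) bracket_pairing: "leibniz_pairing K L M L (bracket L)"
  by unfold_locales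
    (auto simp: bracket_add_left bracket_add_right bracket_smult_left bracket_smult_right
      twist_bracket leibniz_add)

text \<open>A pairing turns \<open>M \<times> W\<close> into a Hom-Leibniz algebra over \<open>M\<close>. Through it, universal
  properties that speak about algebras (of presented and of free algebras) produce linear maps to \<open>W\<close>.\<close>

definition pairing_algebra ::
  "('k, 'a, 'm) hom_alg_scheme \<Rightarrow> 'a set \<Rightarrow> ('k, 'w, 'n) hom_space_scheme \<Rightarrow> ('a \<Rightarrow> 'a \<Rightarrow> 'w)
    \<Rightarrow> ('k, 'a \<times> 'w) hom_alg"
  where "pairing_algebra L M W \<beta> = \<lparr>carrier = M \<times> carrier W, mult = undefined, one = undefined,
    zero = (\<zero>\<^bsub>L\<^esub>, \<zero>\<^bsub>W\<^esub>), add = (\<lambda>p q. (fst p \<oplus>\<^bsub>L\<^esub> fst q, snd p \<oplus>\<^bsub>W\<^esub> snd q)),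
    smult = (\<lambda>c p. (c \<odot>\<^bsub>L\<^esub> fst p, c \<odot>\<^bsub>W\<^esub> snd p)), twist = (\<lambda>p. (twist L (fst p), twist W (snd p))),
    bracket = (\<lambda>p q. (\<langle>fst p, fst q\<rangle>\<^bsub>L\<^esub>, \<beta> (fst p) (fst q)))\<rparr>"

lemma pairing_algebra_simps [simp]:
  "carrier (pairing_algebra L M W \<beta>) = M \<times> carrier W"
  "\<zero>\<^bsub>pairing_algebra L M W \<beta>\<^esub> = (\<zero>\<^bsub>L\<^esub>, \<zero>\<^bsub>W\<^esub>)"
  "p \<oplus>\<^bsub>pairing_algebra L M W \<beta>\<^esub> q = (fst p \<oplus>\<^bsub>L\<^esub> fst q, snd p \<oplus>\<^bsub>W\<^esub> snd q)"
  "c \<odot>\<^bsub>pairing_algebra L M W \<beta>\<^esub> p = (c \<odot>\<^bsub>L\<^esub> fst p, c \<odot>\<^bsub>W\<^esub> snd p)"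
  "twist (pairing_algebra L M W \<beta>) p = (twist L (fst p), twist W (snd p))"
  "\<langle>p, q\<rangle>\<^bsub>pairing_algebra L M W \<beta>\<^esub> = (\<langle>fst p, fst q\<rangle>\<^bsub>L\<^esub>, \<beta> (fst p) (fst q))"
  by (simp_all add: pairing_algebra_def)

context leibniz_pairing
begin

lemma pairing_algebra_hom_leibniz: "hom_leibniz K (pairing_algebra L M W \<beta>)"
proof -
  let ?A = "pairing_algebra L M W \<beta>"
  interpret A: hom_vector_space K ?A
    by (rule hom_vector_space_image[where cl = id and T = "M \<times> carrier W" and z = "(\<zero>\<^bsub>L\<^esub>, \<zero>\<^bsub>W\<^esub>)"
          and ad = "\<lambda>p q. (fst p \<oplus>\<^bsub>L\<^esub> fst q, snd p \<oplus>\<^bsub>W\<^esub> snd q)"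
          and sm = "\<lambda>c p. (c \<odot>\<^bsub>L\<^esub> fst p, c \<odot>\<^bsub>W\<^esub> snd p)"
          and tw = "\<lambda>p. (twist L (fst p), twist W (snd p))"])
      (auto simp: field_axioms a_ac W.M.a_ac smult_l_distr W.smult_l_distr smult_r_distr
        W.smult_r_distr smult_assoc1 W.smult_assoc1 minus_one_smult W.minus_one_smult
        r_neg W.M.r_neg twist_add W.twist_add twist_smult W.twist_smult)
  have closed: "\<langle>p, q\<rangle>\<^bsub>?A\<^esub> \<in> carrier ?A" if "p \<in> carrier ?A" "q \<in> carrier ?A" for p q
    using that by (auto intro!: pair_closed)
  show ?thesis
  proof (intro hom_leibniz.intro A.vs hom_leibniz_axioms.intro closed)
    fix x y z assume xyz: "x \<in> carrier ?A" "y \<in> carrier ?A" "z \<in> carrier ?A"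
    then have "\<langle>twist ?A x, \<langle>y, z\<rangle>\<^bsub>?A\<^esub>\<rangle>\<^bsub>?A\<^esub> \<oplus>\<^bsub>?A\<^esub> \<langle>\<langle>x, z\<rangle>\<^bsub>?A\<^esub>, twist ?A y\<rangle>\<^bsub>?A\<^esub>
        = \<langle>\<langle>x, y\<rangle>\<^bsub>?A\<^esub>, twist ?A z\<rangle>\<^bsub>?A\<^esub>"
      by (auto simp: leibniz_add pair_leibniz)
    then show "\<langle>twist ?A x, \<langle>y, z\<rangle>\<^bsub>?A\<^esub>\<rangle>\<^bsub>?A\<^esub>
        = \<langle>\<langle>x, y\<rangle>\<^bsub>?A\<^esub>, twist ?A z\<rangle>\<^bsub>?A\<^esub> \<ominus>\<^bsub>?A\<^esub> \<langle>\<langle>x, z\<rangle>\<^bsub>?A\<^esub>, twist ?A y\<rangle>\<^bsub>?A\<^esub>"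
      using xyz by (subst A.eq_diff_iff) (auto intro!: closed A.twist_closed simp del: pairing_algebra_simps)
  qed (auto simp: bracket_add_left bracket_add_right bracket_smult_left bracket_smult_right
      twist_bracket pair_add_left pair_add_right pair_smult_left pair_smult_right pair_twist)
qed

lemma snd_hom: "snd \<in> hs_hom K (pairing_algebra L M W \<beta>) W"
  by (rule hs_homI) auto

lemma fst_hom: "fst \<in> hl_hom K (pairing_algebra L M W \<beta>) L"
  unfolding hl_hom_def by (auto intro: hs_homI)

end

section \<open>Hom-Leibniz algebras presented by generators and relations\<close>

lemma UN_class:
  assumes "equiv A r" "a \<in> A" "\<And>s t. (s, t) \<in> r \<Longrightarrow> (g s, g t) \<in> r"
  shows "(\<Union>s\<in>r `` {a}. r `` {g s}) = r `` {g a}"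
  by (rule UN_equiv_class[OF assms(1) _ assms(2)])
    (auto simp: congruent_def intro!: equiv_class_eq[OF assms(1)] assms(3))

lemma UN_class2:
  assumes "equiv A r" "a \<in> A" "b \<in> A"
    and "\<And>s s' t t'. \<lbrakk>(s, s') \<in> r; (t, t') \<in> r\<rbrakk> \<Longrightarrow> (g s t, g s' t') \<in> r"
  shows "(\<Union>s\<in>r `` {a}. \<Union>t\<in>r `` {b}. r `` {g s t}) = r `` {g a b}"
  by (rule UN_equiv_class2[OF assms(1,1) _ assms(2,3)])
    (auto simp: congruent2_def intro!: equiv_class_eq[OF assms(1)] assms(4))

lemma hl_cong_terms:
  fixes K (structure)
  assumes K: "field K" and "(s, t) \<in> hl_cong K X R"
  shows "s \<in> hl_terms K X" "t \<in> hl_terms K X"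
proof -
  interpret K: field K by fact
  have "s \<in> hl_terms K X \<and> t \<in> hl_terms K X"
    using assms(2) by induction (auto intro!: hl_terms.intros)
  then show "s \<in> hl_terms K X" "t \<in> hl_terms K X" by auto
qed

lemma hl_cong_equiv:
  assumes "field K"
  shows "equiv (hl_terms K X) (hl_cong K X R)"
proof (rule equivI)
  show "hl_cong K X R \<subseteq> hl_terms K X \<times> hl_terms K X"
    by (auto dest: hl_cong_terms[OF assms])
  show "refl_on (hl_terms K X) (hl_cong K X R)" by (auto intro: refl_onI hl_cong.refl)
  show "sym (hl_cong K X R)" by (rule symI) (rule hl_cong.sym)
  show "trans (hl_cong K X R)" by (rule transI) (rule hl_cong.trans)
qed

context
  fixes K :: "('k, 'z) ring_scheme" (structure) and X :: "'x set"
    and R :: "(('k, 'x) hl_term \<times> ('k, 'x) hl_term) set"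
  assumes K: "field K"
begin

interpretation K: field K by fact

lemma hl_class_eq_iff:
  assumes "s \<in> hl_terms K X" "t \<in> hl_terms K X"
  shows "hl_cong K X R `` {s} = hl_cong K X R `` {t} \<longleftrightarrow> (s, t) \<in> hl_cong K X R"
  using hl_cong_equiv[OF K] assms by (rule eq_equiv_class_iff)

lemma hl_class_self: "t \<in> hl_terms K X \<Longrightarrow> t \<in> hl_cong K X R `` {t}"
  by (auto intro: hl_cong.refl)

lemma hl_presented_ops:
  shows "carrier (hl_presented K X R) = (\<lambda>t. hl_cong K X R `` {t}) ` hl_terms K X"
    and "\<zero>\<^bsub>hl_presented K X R\<^esub> = hl_cong K X R `` {HZero}"
    and "\<lbrakk>s \<in> hl_terms K X; t \<in> hl_terms K X\<rbrakk>
      \<Longrightarrow> hl_cong K X R `` {s} \<oplus>\<^bsub>hl_presented K X R\<^esub> hl_cong K X R `` {t} = hl_cong K X R `` {HAdd s t}"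
    and "\<lbrakk>c \<in> carrier K; t \<in> hl_terms K X\<rbrakk>
      \<Longrightarrow> c \<odot>\<^bsub>hl_presented K X R\<^esub> hl_cong K X R `` {t} = hl_cong K X R `` {HSmult c t}"
    and "t \<in> hl_terms K X
      \<Longrightarrow> twist (hl_presented K X R) (hl_cong K X R `` {t}) = hl_cong K X R `` {HTw t}"
  by (simp_all add: hl_presented_def Let_def quotient_def UNION_singleton_eq_range
      UN_class[OF hl_cong_equiv[OF K]] UN_class2[OF hl_cong_equiv[OF K], where g = HAdd] hl_cong.cong_add hl_cong.cong_smult hl_cong.cong_tw)

lemma hl_presented_hom_vector_space: "hom_vector_space K (hl_presented K X R)"
  by (rule hom_vector_space_image[where cl = "\<lambda>t. hl_cong K X R `` {t}" and T = "hl_terms K X"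
        and z = HZero and ad = HAdd and sm = HSmult and tw = HTw])
    (simp_all add: K hl_presented_ops hl_terms.intros hl_class_eq_iff hl_cong.add_assoc hl_cong.add_comm
      hl_cong.add_zero hl_cong.add_inv hl_cong.smult_add_left hl_cong.smult_add_right
      hl_cong.smult_smult hl_cong.smult_one hl_cong.tw_add hl_cong.tw_smult)

lemma hl_eval_closed:
  assumes A: "hom_leibniz K A" and \<phi>: "\<And>x. x \<in> X \<Longrightarrow> \<phi> x \<in> carrier A" and t: "t \<in> hl_terms K X"
  shows "hl_eval A \<phi> t \<in> carrier A"
proof -
  interpret A: hom_leibniz K A by fact
  show ?thesis using t by induction (auto simp: \<phi>)
qed

lemma hl_eval_cong:
  assumes A: "hom_leibniz K A" and \<phi>: "\<And>x. x \<in> X \<Longrightarrow> \<phi> x \<in> carrier A"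
    and R: "\<And>s t. \<lbrakk>(s, t) \<in> R; s \<in> hl_terms K X; t \<in> hl_terms K X\<rbrakk> \<Longrightarrow> hl_eval A \<phi> s = hl_eval A \<phi> t"
    and st: "(s, t) \<in> hl_cong K X R"
  shows "hl_eval A \<phi> s = hl_eval A \<phi> t"
proof -
  interpret A: hom_leibniz K A by fact
  have cl: "hl_eval A \<phi> t \<in> carrier A" if "t \<in> hl_terms K X" for t
    using hl_eval_closed[OF A \<phi> that] .
  have neg: "(\<ominus> \<one>) \<odot>\<^bsub>A\<^esub> a = \<ominus>\<^bsub>A\<^esub> a" if "a \<in> carrier A" for a
    using that by (rule A.minus_one_smult)
  show ?thesis
    using st
  proof induction
    case (add_comm s t)
    then show ?case by (simp add: cl A.M.a_comm)
  qed (auto simp: cl R A.M.a_assoc neg A.M.r_neg A.smult_l_distr A.smult_r_distr A.smult_assoc1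
      A.twist_add A.twist_smult A.bracket_add_left A.bracket_add_right A.bracket_smult_left
      A.bracket_smult_right A.twist_bracket A.hom_leibniz_identity A.diff_smult)
qed

lemma hl_presented_map:
  assumes A: "hom_leibniz K A" and \<phi>: "\<And>x. x \<in> X \<Longrightarrow> \<phi> x \<in> carrier A"
    and R: "\<And>s t. \<lbrakk>(s, t) \<in> R; s \<in> hl_terms K X; t \<in> hl_terms K X\<rbrakk> \<Longrightarrow> hl_eval A \<phi> s = hl_eval A \<phi> t"
  shows "(\<lambda>C. the_elem (hl_eval A \<phi> ` C)) \<in> hs_hom K (hl_presented K X R) A"
    and "t \<in> hl_terms K X \<Longrightarrow> the_elem (hl_eval A \<phi> ` (hl_cong K X R `` {t})) = hl_eval A \<phi> t"
proof -
  have ev: "hl_eval A \<phi> s = hl_eval A \<phi> t" if "(t, s) \<in> hl_cong K X R" for s t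
    using hl_eval_cong[OF A \<phi> R that] by simp
  show val: "the_elem (hl_eval A \<phi> ` (hl_cong K X R `` {t})) = hl_eval A \<phi> t"
    if "t \<in> hl_terms K X" for t
    by (rule the_elem_image, use hl_class_self[OF that] in blast) (rule ev, simp)
  show "(\<lambda>C. the_elem (hl_eval A \<phi> ` C)) \<in> hs_hom K (hl_presented K X R) A"
    by (rule hs_homI)
      (auto simp: hl_presented_ops val hl_terms.intros intro!: hl_eval_closed[OF A \<phi>])
qed

end

section \<open>The exterior product as a universal pairing\<close>

inductive_set hl_linear :: "('k, 'z) ring_scheme \<Rightarrow> 'x set \<Rightarrow> ('k, 'x) hl_term set"
  for K (structure) and X where
    "x \<in> X \<Longrightarrow> HGen x \<in> hl_linear K X"
  | "HZero \<in> hl_linear K X"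
  | "\<lbrakk>s \<in> hl_linear K X; t \<in> hl_linear K X\<rbrakk> \<Longrightarrow> HAdd s t \<in> hl_linear K X"
  | "\<lbrakk>c \<in> carrier K; t \<in> hl_linear K X\<rbrakk> \<Longrightarrow> HSmult c t \<in> hl_linear K X"

lemma hl_linear_terms: "t \<in> hl_linear K X \<Longrightarrow> t \<in> hl_terms K X"
  by (induction rule: hl_linear.induct) (auto intro: hl_terms.intros)

primrec symbol_value :: "('a \<Rightarrow> 'a \<Rightarrow> 'b) \<Rightarrow> 'a star_symbol \<Rightarrow> 'b" where
    "symbol_value \<beta> (Star m n) = \<beta> m n"
  | "symbol_value \<beta> (Star' n m) = \<beta> n m"

lemma symbol_bracket_value: "symbol_bracket L = symbol_value (bracket L)"
proof
  show "symbol_bracket L x = symbol_value (bracket L) x" for x by (cases x) auto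
qed

definition exterior_relators ::
  "('k, 'z) ring_scheme \<Rightarrow> ('k, 'a, 'm) hom_alg_scheme \<Rightarrow> 'a set \<Rightarrow> ('k, 'a star_symbol) hl_term set set"
  where "exterior_relators K L M = {star_class K L M (carrier L) (Star x y)
      \<ominus>\<^bsub>star_product K L M (carrier L)\<^esub> star_class K L M (carrier L) (Star' x y)
    | x y. x \<in> M \<inter> carrier L \<and> y \<in> M \<inter> carrier L}"

text \<open>The image of a term in the exterior product: its class in the tensor product, then the coset
  of that class.\<close>

definition exterior_class ::
  "('k, 'z) ring_scheme \<Rightarrow> ('k, 'a, 'm) hom_alg_scheme \<Rightarrow> 'a set \<Rightarrow> ('k, 'a star_symbol) hl_term
    \<Rightarrow> ('k, 'a star_symbol) hl_term set set"
  where "exterior_class K L M t =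
    hs_span K (star_product K L M (carrier L)) (exterior_relators K L M)
      +>\<^bsub>star_product K L M (carrier L)\<^esub>
    (hl_cong K (star_symbols M (carrier L)) (star_rels K L M (carrier L)) `` {t})"

text \<open>For \<open>x\<close> and \<open>y\<close> both in \<open>M\<close> the two symbols have the same image, and the choice of \<^const>\<open>Star\<close>
  is arbitrary; otherwise only one of them exists.\<close>

definition wedge ::
  "('k, 'z) ring_scheme \<Rightarrow> ('k, 'a, 'm) hom_alg_scheme \<Rightarrow> 'a set \<Rightarrow> 'a \<Rightarrow> 'a
    \<Rightarrow> ('k, 'a star_symbol) hl_term set set"
  where "wedge K L M x y = exterior_class K L M (HGen (if x \<in> M then Star x y else Star' x y))"

context leibniz_ideal
begin

abbreviation "symbols \<equiv> star_symbols M (carrier L)"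
abbreviation "rels \<equiv> star_rels K L M (carrier L)"
abbreviation "terms \<equiv> hl_terms K symbols"
abbreviation "tensor \<equiv> star_product K L M (carrier L)"
abbreviation "cls t \<equiv> hl_cong K symbols rels `` {t}"
abbreviation "ext \<equiv> exterior_product K L M (carrier L)"
abbreviation "diffs \<equiv> exterior_relators K L M"
abbreviation "ecls \<equiv> exterior_class K L M"

lemma symbols_mem [simp]:
  "\<lbrakk>m \<in> M; n \<in> carrier L\<rbrakk> \<Longrightarrow> Star m n \<in> symbols"
  "\<lbrakk>m \<in> M; n \<in> carrier L\<rbrakk> \<Longrightarrow> Star' n m \<in> symbols"
  by (auto simp: star_symbols_def)

lemma symbols_cases:
  assumes "x \<in> symbols"
  obtains m n where "x = Star m n" "m \<in> M" "n \<in> carrier L"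
    | m n where "x = Star' n m" "m \<in> M" "n \<in> carrier L"
  using assms by (auto simp: star_symbols_def)

lemma symbols_terms [simp]:
  "\<lbrakk>m \<in> M; n \<in> carrier L\<rbrakk> \<Longrightarrow> m \<star> n \<in> terms"
  "\<lbrakk>m \<in> M; n \<in> carrier L\<rbrakk> \<Longrightarrow> n \<star>' m \<in> terms"
  by (auto intro!: hl_terms.intros simp: star_symbols_def)

lemmas tensor_ops = hl_presented_ops[OF field_axioms, where X = symbols and R = rels, folded star_product_def]

sublocale T: hom_vector_space K tensor
  unfolding star_product_def by (rule hl_presented_hom_vector_space[OF field_axioms])

lemma cls_eqI: "(s, t) \<in> hl_cong K symbols rels \<Longrightarrow> cls s = cls t"
  by (rule equiv_class_eq[OF hl_cong_equiv[OF field_axioms]])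

lemma cls_rel: "\<lbrakk>(s, t) \<in> rels; s \<in> terms; t \<in> terms\<rbrakk> \<Longrightarrow> cls s = cls t"
  by (rule cls_eqI) (rule hl_cong.relation)

lemma cls_closed [simp]: "t \<in> terms \<Longrightarrow> cls t \<in> carrier tensor"
  by (simp add: tensor_ops)

lemma diffs_twist: "u \<in> diffs \<Longrightarrow> twist tensor u \<in> diffs"
proof -
  assume "u \<in> diffs"
  then obtain x y where xy: "x \<in> M" "y \<in> M" "u = cls (x \<star> y) \<ominus>\<^bsub>tensor\<^esub> cls (x \<star>' y)"
    by (auto simp: star_class_def exterior_relators_def)
  have tw: "cls (HTw (x \<star> y)) = cls (twist L x \<star> twist L y)"
    "cls (HTw (x \<star>' y)) = cls (twist L x \<star>' twist L y)"
    by (rule cls_rel; use xy in \<open>auto intro: star_rels.intros hl_terms.intros\<close>)+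
  have "twist tensor u = cls (twist L x \<star> twist L y) \<ominus>\<^bsub>tensor\<^esub> cls (twist L x \<star>' twist L y)"
    using xy by (simp add: T.twist_diff tensor_ops tw)
  then show ?thesis using xy M_twist M_carrier unfolding star_class_def exterior_relators_def by blast
qed

lemma diffs_subset: "diffs \<subseteq> carrier tensor"
  by (auto simp: star_class_def exterior_relators_def)

sublocale E: subspace_quotient K tensor "hs_span K tensor diffs" ext
  using T.subspace_span(1)[OF diffs_subset diffs_twist] T.vs
  by (auto simp: subspace_quotient_def subspace_quotient_axioms_def hl_quot_def exterior_product_def
      exterior_relators_def)

sublocale EV: hom_vector_space K ext
  by (rule E.quotient_hom_vector_space)

lemma ecls_ops:
  "carrier ext = (\<lambda>t. ecls t) ` terms"
  "\<zero>\<^bsub>ext\<^esub> = ecls HZero"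
  "\<lbrakk>s \<in> terms; t \<in> terms\<rbrakk> \<Longrightarrow> ecls (HAdd s t) = ecls s \<oplus>\<^bsub>ext\<^esub> ecls t"
  "\<lbrakk>c \<in> carrier K; t \<in> terms\<rbrakk> \<Longrightarrow> ecls (HSmult c t) = c \<odot>\<^bsub>ext\<^esub> ecls t"
  "t \<in> terms \<Longrightarrow> ecls (HTw t) = twist ext (ecls t)"
  by (simp_all add: exterior_class_def E.carrier_Q E.zero_Q E.add_Q E.smult_Q E.twist_Q tensor_ops
      image_image)

lemma ecls_closed [simp]: "t \<in> terms \<Longrightarrow> ecls t \<in> carrier ext"
  by (simp add: ecls_ops)

lemma ecls_rel: "\<lbrakk>(s, t) \<in> rels; s \<in> terms; t \<in> terms\<rbrakk> \<Longrightarrow> ecls s = ecls t"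
  by (simp add: exterior_class_def cls_rel)

lemma ecls_Star_eq:
  assumes "x \<in> M" "y \<in> M"
  shows "ecls (x \<star> y) = ecls (x \<star>' y)"
proof -
  have "cls (x \<star> y) \<ominus>\<^bsub>tensor\<^esub> cls (x \<star>' y) \<in> diffs"
    using assms M_carrier unfolding exterior_relators_def star_class_def by blast
  then have "cls (x \<star> y) \<ominus>\<^bsub>tensor\<^esub> cls (x \<star>' y) \<in> hs_span K tensor diffs"
    using T.subspace_span(2)[OF diffs_subset diffs_twist] by blast
  then show ?thesis
    using assms unfolding exterior_class_def by (subst E.coset_eq_iff) auto
qed

lemma wedge_Star: "\<lbrakk>x \<in> M; y \<in> carrier L\<rbrakk> \<Longrightarrow> wedge K L M x y = ecls (x \<star> y)"
  by (simp add: wedge_def)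

lemma wedge_Star': "\<lbrakk>y \<in> M; x \<in> carrier L\<rbrakk> \<Longrightarrow> wedge K L M x y = ecls (x \<star>' y)"
  using ecls_Star_eq[of x y] by (simp add: wedge_def)

text \<open>The last eight relations express a product of two symbols as a symbol, and the self-map sends
  symbols to symbols. With bilinearity this removes all brackets and self-maps from a term.\<close>

lemma linear_combination:
  assumes "t \<in> terms"
  shows "\<exists>l\<in>hl_linear K symbols. (t, l) \<in> hl_cong K symbols rels"
proof -
  let ?C = "hl_cong K symbols rels" and ?L = "hl_linear K symbols"
  have reduce: "\<exists>l\<in>?L. (s, l) \<in> ?C" if "(s, t) \<in> ?C" "\<exists>l\<in>?L. (t, l) \<in> ?C" for s t
    using that by (meson hl_cong.trans)
  have add: "\<exists>l\<in>?L. (HAdd s t, l) \<in> ?C" if "\<exists>l\<in>?L. (s, l) \<in> ?C" "\<exists>l\<in>?L. (t, l) \<in> ?C" for s t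
    using that by (meson hl_cong.cong_add hl_linear.intros(3))
  have smult: "\<exists>l\<in>?L. (HSmult c t, l) \<in> ?C" if "c \<in> carrier K" "\<exists>l\<in>?L. (t, l) \<in> ?C" for c t
    using that by (meson hl_cong.cong_smult hl_linear.intros(4))
  have gen: "\<exists>l\<in>?L. (HGen x, l) \<in> ?C" if "x \<in> symbols" for x
    using that by (meson hl_cong.refl hl_linear.intros(1) hl_terms.intros(1))
  have zero: "\<exists>l\<in>?L. (t, l) \<in> ?C" if "(t, HZero) \<in> ?C" for t
    using that by (meson hl_linear.intros(2))
  have eq: "(s, t) \<in> ?C" if "s \<in> terms" "t \<in> terms" "cls s = cls t" for s t
    using that hl_class_eq_iff[OF field_axioms] by blast
  have Z: "HZero \<in> terms" by (rule hl_terms.intros)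
  have null: "(HSmult \<zero> t, HZero) \<in> ?C" if "t \<in> terms" for t
    by (rule eq) (use that Z in \<open>simp_all add: hl_terms.intros tensor_ops(2,4)[symmetric]\<close>)
  have tw: "\<exists>l\<in>?L. (HTw t, l) \<in> ?C" if "t \<in> ?L" for t
    using that
  proof induction
    case (1 x)
    then show ?case
    proof (cases rule: symbols_cases)
      case (1 m n)
      have "(HTw (m \<star> n), twist L m \<star> twist L n) \<in> ?C"
        using 1 by (intro hl_cong.relation star_rels.intros hl_terms.intros) (auto simp: star_symbols_def)
      from reduce[OF this gen] 1 show ?thesis by simp
    next
      case (2 m n)
      have "(HTw (n \<star>' m), twist L n \<star>' twist L m) \<in> ?C"
        using 2 by (intro hl_cong.relation star_rels.intros hl_terms.intros) (auto simp: star_symbols_def)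
      from reduce[OF this gen] 2 show ?thesis by simp
    qed
  next
    case 2
    have "twist tensor (cls HZero) = cls HZero" using T.twist_zero by (simp add: tensor_ops)
    then have "(HTw HZero, HZero) \<in> ?C" using Z by (intro eq) (auto simp: tensor_ops hl_terms.intros)
    then show ?case by (rule zero)
  next
    case (3 s t)
    show ?case
      by (rule reduce[OF hl_cong.tw_add add]) (use 3 in \<open>auto intro: hl_linear_terms\<close>)
  next
    case (4 c t)
    show ?case
      by (rule reduce[OF hl_cong.tw_smult smult]) (use 4 in \<open>auto intro: hl_linear_terms\<close>)
  qed
  have br_gen: "\<exists>l\<in>?L. (HBr (HGen x) (HGen y), l) \<in> ?C" if xy: "x \<in> symbols" "y \<in> symbols" for x y
  proof -
    have "(HBr (HGen x) (HGen y), symbol_bracket L x \<star> symbol_bracket L y) \<in> ?C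
      \<and> Star (symbol_bracket L x) (symbol_bracket L y) \<in> symbols"
      using xy(1)
    proof (cases rule: symbols_cases)
      case 1
      from xy(2) show ?thesis
        by (cases rule: symbols_cases)
          (use 1 in \<open>auto intro!: hl_cong.sym[OF hl_cong.relation] star_rels.intros hl_terms.intros(5)\<close>)
    next
      case 2
      from xy(2) show ?thesis
        by (cases rule: symbols_cases)
          (use 2 in \<open>auto intro!: hl_cong.sym[OF hl_cong.relation] star_rels.intros hl_terms.intros(5)\<close>)
    qed
    then show ?thesis by (blast intro: reduce gen)
  qed
  have br_gen_left: "\<exists>l\<in>?L. (HBr (HGen x) t, l) \<in> ?C" if x: "x \<in> symbols" and "t \<in> ?L" for x t
    using that(2)
  proof induction
    case (1 y)
    with x show ?case by (rule br_gen)
  next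
    case 2
    have g: "HGen x \<in> terms" using x by (rule hl_terms.intros)
    have "(HBr (HGen x) HZero, HBr (HGen x) (HSmult \<zero> HZero)) \<in> ?C"
      by (intro hl_cong.cong_br hl_cong.refl g hl_cong.sym[OF null] Z)
    moreover have "(HBr (HGen x) (HSmult \<zero> HZero), HSmult \<zero> (HBr (HGen x) HZero)) \<in> ?C"
      using g Z by (intro hl_cong.br_smult_right) auto
    ultimately show ?case
      using null[of "HBr (HGen x) HZero"] g Z by (intro zero) (meson hl_cong.trans hl_terms.intros(5))
  next
    case (3 s t)
    show ?case
      by (rule reduce[OF hl_cong.br_add_right add])
        (use 3 x in \<open>auto intro: hl_linear_terms hl_terms.intros\<close>)
  next
    case (4 c t)
    show ?case
      by (rule reduce[OF hl_cong.br_smult_right smult])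
        (use 4 x in \<open>auto intro: hl_linear_terms hl_terms.intros\<close>)
  qed
  have br: "\<exists>l\<in>?L. (HBr s t, l) \<in> ?C" if "s \<in> ?L" "t \<in> ?L" for s t
    using that(1)
  proof induction
    case (1 x)
    then show ?case using that(2) by (rule br_gen_left)
  next
    case 2
    have g: "t \<in> terms" using that(2) by (rule hl_linear_terms)
    have "(HBr HZero t, HBr (HSmult \<zero> HZero) t) \<in> ?C"
      by (intro hl_cong.cong_br hl_cong.refl g hl_cong.sym[OF null] Z)
    moreover have "(HBr (HSmult \<zero> HZero) t, HSmult \<zero> (HBr HZero t)) \<in> ?C"
      using g Z by (intro hl_cong.br_smult_left) auto
    ultimately show ?case
      using null[of "HBr HZero t"] g Z by (intro zero) (meson hl_cong.trans hl_terms.intros(5))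
  next
    case (3 u v)
    show ?case
      by (rule reduce[OF hl_cong.br_add_left add])
        (use 3 that(2) in \<open>auto intro: hl_linear_terms\<close>)
  next
    case (4 c u)
    show ?case
      by (rule reduce[OF hl_cong.br_smult_left smult])
        (use 4 that(2) in \<open>auto intro: hl_linear_terms\<close>)
  qed
  show ?thesis
    using assms
  proof induction
    case (5 s t)
    then obtain s' t' where "s' \<in> ?L" "(s, s') \<in> ?C" "t' \<in> ?L" "(t, t') \<in> ?C" by blast
    then show ?case by (meson reduce br hl_cong.cong_br)
  next
    case (6 t)
    then show ?case by (meson reduce tw hl_cong.cong_tw)
  next
    case 2
    show ?case using Z by (intro zero hl_cong.refl)
  qed (auto intro: gen add smult)
qed

lemma wedge_span:
  assumes D: "submodule D K ext"
    and gen: "\<And>x y. \<lbrakk>x \<in> carrier L; y \<in> carrier L; x \<in> M \<or> y \<in> M\<rbrakk> \<Longrightarrow> wedge K L M x y \<in> D"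
  shows "carrier ext \<subseteq> D"
proof
  fix u assume "u \<in> carrier ext"
  then obtain t where t: "t \<in> terms" "u = ecls t" by (auto simp: ecls_ops)
  obtain l where l: "l \<in> hl_linear K symbols" "(t, l) \<in> hl_cong K symbols rels"
    using linear_combination[OF t(1)] by blast
  have "ecls l \<in> D" using l(1)
  proof induction
    case (1 x)
    then show ?case
      unfolding star_symbols_def using gen wedge_Star wedge_Star' M_carrier by force
  next
    case 2
    show ?case using EV.submodule_zero[OF D] by (simp add: ecls_ops)
  next
    case (3 s t)
    then show ?case using EV.submoduleE(5)[OF D] by (simp add: ecls_ops hl_linear_terms)
  next
    case (4 c t)
    then show ?case using EV.submoduleE(4)[OF D] by (simp add: ecls_ops hl_linear_terms)
  qed
  with t cls_eqI[OF l(2)] show "u \<in> D" by (simp add: exterior_class_def)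
qed

end

text \<open>The Leibniz rule is the relation for \<open>\<alpha>(m) * [n,n']\<close> if \<open>x\<close> is in \<open>M\<close>, and the relation
  for \<open>[n,n'] *' \<alpha>(m)\<close> if \<open>y\<close> is in \<open>M\<close>. If \<open>z\<close> is in \<open>M\<close> it follows from the latter, with \<open>y\<close> and \<open>z\<close>
  exchanged, and from \<open>\<alpha>(n) *' [n',m] = -\<alpha>(n) *' [m,n']\<close>.\<close>

lemma (in leibniz_ideal) wedge_pairing: "leibniz_pairing K L M ext (wedge K L M)"
proof (intro leibniz_pairing.intro leibniz_ideal_axioms EV.vs
    leibniz_pairing_axioms.intro)
  note wedge = wedge_Star wedge_Star'
  note intros = hl_terms.intros star_rels.intros
  note [simp] = hl_terms.intros(3,4,6)
  fix x y assume xy: "x \<in> carrier L" "y \<in> carrier L"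
  show closed: "wedge K L M x y \<in> carrier ext" if "x \<in> M \<or> y \<in> M"
    using that xy by (auto simp: wedge)
  { fix z assume z: "z \<in> carrier L"
    show "wedge K L M (x \<oplus>\<^bsub>L\<^esub> y) z = wedge K L M x z \<oplus>\<^bsub>ext\<^esub> wedge K L M y z"
      if "x \<in> M \<and> y \<in> M \<or> z \<in> M"
      using that
    proof
      assume m: "x \<in> M \<and> y \<in> M"
      have "ecls ((x \<oplus>\<^bsub>L\<^esub> y) \<star> z) = ecls (HAdd (x \<star> z) (y \<star> z))"
        by (rule ecls_rel) (use m z in \<open>auto intro: intros\<close>)
      with m z show ?thesis by (simp add: wedge ecls_ops)
    next
      assume m: "z \<in> M"
      have "ecls ((x \<oplus>\<^bsub>L\<^esub> y) \<star>' z) = ecls (HAdd (x \<star>' z) (y \<star>' z))"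
        by (rule ecls_rel) (use m xy in \<open>auto intro: intros\<close>)
      with m xy show ?thesis by (simp add: wedge ecls_ops)
    qed
    show "wedge K L M x (y \<oplus>\<^bsub>L\<^esub> z) = wedge K L M x y \<oplus>\<^bsub>ext\<^esub> wedge K L M x z"
      if "x \<in> M \<or> y \<in> M \<and> z \<in> M"
      using that
    proof
      assume m: "x \<in> M"
      have "ecls (x \<star> (y \<oplus>\<^bsub>L\<^esub> z)) = ecls (HAdd (x \<star> y) (x \<star> z))"
        by (rule ecls_rel) (use m xy z in \<open>auto intro: intros\<close>)
      with m xy z show ?thesis by (simp add: wedge ecls_ops)
    next
      assume m: "y \<in> M \<and> z \<in> M"
      have "ecls (x \<star>' (y \<oplus>\<^bsub>L\<^esub> z)) = ecls (HAdd (x \<star>' y) (x \<star>' z))"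
        by (rule ecls_rel) (use m xy in \<open>auto intro: intros\<close>)
      with m xy show ?thesis by (simp add: wedge ecls_ops)
    qed
    let ?w = "wedge K L M"
    have right: "?w (twist L x) \<langle>y, z\<rangle>\<^bsub>L\<^esub> = ?w \<langle>x, y\<rangle>\<^bsub>L\<^esub> (twist L z) \<ominus>\<^bsub>ext\<^esub> ?w \<langle>x, z\<rangle>\<^bsub>L\<^esub> (twist L y)"
      if m: "x \<in> M"
    proof -
      have "ecls (twist L x \<star> \<langle>y, z\<rangle>\<^bsub>L\<^esub>) = ecls (HDiff K (\<langle>x, y\<rangle>\<^bsub>L\<^esub> \<star> twist L z) (\<langle>x, z\<rangle>\<^bsub>L\<^esub> \<star> twist L y))"
        by (rule ecls_rel) (use m xy z in \<open>auto intro: intros\<close>)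
      with m xy z show ?thesis by (simp add: wedge ecls_ops EV.diff_smult)
    qed
    have middle: "?w \<langle>x, z\<rangle>\<^bsub>L\<^esub> (twist L y) = ?w \<langle>x, y\<rangle>\<^bsub>L\<^esub> (twist L z) \<ominus>\<^bsub>ext\<^esub> ?w (twist L x) \<langle>y, z\<rangle>\<^bsub>L\<^esub>"
      if m: "y \<in> M" and xz: "x \<in> carrier L" "z \<in> carrier L" for x y z
    proof -
      have "ecls (\<langle>x, z\<rangle>\<^bsub>L\<^esub> \<star>' twist L y) = ecls (HDiff K (\<langle>x, y\<rangle>\<^bsub>L\<^esub> \<star> twist L z) (twist L x \<star>' \<langle>y, z\<rangle>\<^bsub>L\<^esub>))"
        by (rule ecls_rel) (use m xz in \<open>auto intro: intros\<close>)
      with m xz show ?thesis by (simp add: wedge ecls_ops EV.diff_smult)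
    qed
    have anti: "?w (twist L x) \<langle>y, z\<rangle>\<^bsub>L\<^esub> = \<ominus>\<^bsub>ext\<^esub> ?w (twist L x) \<langle>z, y\<rangle>\<^bsub>L\<^esub>" if m: "z \<in> M"
    proof -
      have "ecls (twist L x \<star>' \<langle>y, z\<rangle>\<^bsub>L\<^esub>) = ecls (HMinus K (twist L x \<star>' \<langle>z, y\<rangle>\<^bsub>L\<^esub>))"
        by (rule ecls_rel) (use m xy in \<open>auto intro: intros\<close>)
      with m xy show ?thesis by (simp add: wedge ecls_ops EV.minus_one_smult)
    qed
    have closed2: "?w a b \<in> carrier ext" if "a \<in> carrier L" "b \<in> carrier L" "a \<in> M \<or> b \<in> M" for a b
      using that by (auto simp: wedge)
    show "?w (twist L x) \<langle>y, z\<rangle>\<^bsub>L\<^esub> \<oplus>\<^bsub>ext\<^esub> ?w \<langle>x, z\<rangle>\<^bsub>L\<^esub> (twist L y) = ?w \<langle>x, y\<rangle>\<^bsub>L\<^esub> (twist L z)"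
      if xyz: "x \<in> M \<or> y \<in> M \<or> z \<in> M"
    proof -
      have cl: "?w (twist L x) \<langle>y, z\<rangle>\<^bsub>L\<^esub> \<in> carrier ext" "?w \<langle>x, z\<rangle>\<^bsub>L\<^esub> (twist L y) \<in> carrier ext"
        "?w \<langle>x, y\<rangle>\<^bsub>L\<^esub> (twist L z) \<in> carrier ext" "?w (twist L x) \<langle>z, y\<rangle>\<^bsub>L\<^esub> \<in> carrier ext"
        using xyz xy z by (auto intro!: closed2)
      from xyz consider "x \<in> M" | "y \<in> M" | "z \<in> M" by blast
      then show ?thesis
      proof cases
        case 1
        then show ?thesis using right[OF 1] cl by (simp add: EV.eq_diff_iff)
      next
        case 2
        then show ?thesis using middle[OF 2 xy(1) z] cl by (simp add: EV.eq_diff_iff EV.M.a_comm)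
      next
        case 3
        have "?w \<langle>x, y\<rangle>\<^bsub>L\<^esub> (twist L z) \<oplus>\<^bsub>ext\<^esub> ?w (twist L x) \<langle>z, y\<rangle>\<^bsub>L\<^esub> = ?w \<langle>x, z\<rangle>\<^bsub>L\<^esub> (twist L y)"
          using middle[OF 3 xy] cl by (simp add: EV.eq_diff_iff)
        then show ?thesis
          using anti[OF 3] cl
          by (metis EV.M.a_assoc EV.M.a_comm EV.M.l_neg EV.M.r_zero EV.M.a_inv_closed)
      qed
    qed
  }
  show "wedge K L M (twist L x) (twist L y) = twist ext (wedge K L M x y)" if "x \<in> M \<or> y \<in> M"
    using that
  proof
    assume m: "x \<in> M"
    have "ecls (HTw (x \<star> y)) = ecls (twist L x \<star> twist L y)"
      by (rule ecls_rel) (use m xy in \<open>auto intro: intros\<close>)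
    with m xy show ?thesis by (simp add: wedge ecls_ops)
  next
    assume m: "y \<in> M"
    have "ecls (HTw (x \<star>' y)) = ecls (twist L x \<star>' twist L y)"
      by (rule ecls_rel) (use m xy in \<open>auto intro: intros\<close>)
    with m xy show ?thesis by (simp add: wedge ecls_ops)
  qed
next
  note wedge = wedge_Star wedge_Star'
  note intros = hl_terms.intros star_rels.intros
  note [simp] = hl_terms.intros(3,4,6)
  fix c x y assume c: "c \<in> carrier K" and xy: "x \<in> carrier L" "y \<in> carrier L" and "x \<in> M \<or> y \<in> M"
  then consider "x \<in> M" | "y \<in> M" by blast
  then have "wedge K L M (c \<odot>\<^bsub>L\<^esub> x) y = c \<odot>\<^bsub>ext\<^esub> wedge K L M x y
    \<and> wedge K L M x (c \<odot>\<^bsub>L\<^esub> y) = c \<odot>\<^bsub>ext\<^esub> wedge K L M x y"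
  proof cases
    case 1
    have "ecls ((c \<odot>\<^bsub>L\<^esub> x) \<star> y) = ecls (HSmult c (x \<star> y))"
      by (rule ecls_rel) (use 1 c xy in \<open>auto intro: intros\<close>)
    moreover have "ecls (x \<star> (c \<odot>\<^bsub>L\<^esub> y)) = ecls (HSmult c (x \<star> y))"
      by (rule ecls_rel) (use 1 c xy in \<open>auto intro: intros\<close>)
    ultimately show ?thesis using 1 c xy by (simp add: wedge ecls_ops)
  next
    case 2
    have "ecls ((c \<odot>\<^bsub>L\<^esub> x) \<star>' y) = ecls (HSmult c (x \<star>' y))"
      by (rule ecls_rel) (use 2 c xy in \<open>auto intro: intros\<close>)
    moreover have "ecls (x \<star>' (c \<odot>\<^bsub>L\<^esub> y)) = ecls (HSmult c (x \<star>' y))"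
      by (rule ecls_rel) (use 2 c xy in \<open>auto intro: intros\<close>)
    ultimately show ?thesis using 2 c xy by (simp add: wedge ecls_ops)
  qed
  then show "wedge K L M (c \<odot>\<^bsub>L\<^esub> x) y = c \<odot>\<^bsub>ext\<^esub> wedge K L M x y"
    "wedge K L M x (c \<odot>\<^bsub>L\<^esub> y) = c \<odot>\<^bsub>ext\<^esub> wedge K L M x y" by blast+
qed

sublocale leibniz_ideal \<subseteq> wedge: leibniz_pairing K L M "exterior_product K L M (carrier L)" "wedge K L M"
  by (rule wedge_pairing)

context leibniz_ideal
begin

text \<open>The hypothesis \<open>mult\<close> takes care of the relations between brackets of symbols; the other
  relations are identities of pairings.\<close>

lemma symbol_value_rels:
  assumes A: "hom_leibniz K A" and b: "leibniz_pairing K L M A b"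
    and mult: "\<And>x y x' y'. \<lbrakk>x \<in> carrier L; y \<in> carrier L; x \<in> M \<or> y \<in> M;
        x' \<in> carrier L; y' \<in> carrier L; x' \<in> M \<or> y' \<in> M\<rbrakk>
      \<Longrightarrow> \<langle>b x y, b x' y'\<rangle>\<^bsub>A\<^esub> = b \<langle>x, y\<rangle>\<^bsub>L\<^esub> \<langle>x', y'\<rangle>\<^bsub>L\<^esub>"
    and st: "(s, t) \<in> rels"
  shows "hl_eval A (symbol_value b) s = hl_eval A (symbol_value b) t"
proof -
  interpret b: leibniz_pairing K L M A b by fact
  show ?thesis
    using st
    by (cases rule: star_rels.cases)
      (auto simp: mult b.pair_add_left b.pair_add_right b.pair_smult_left b.pair_smult_right b.pair_twist
        intro: b.pair_leibniz1 b.pair_leibniz2 b.pair_antisym)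
qed

text \<open>The common source of \<^const>\<open>exterior_map\<close>, where \<open>A = L\<close> and \<open>b\<close> is the bracket, and of the maps
  to pairing algebras.\<close>

lemma exterior_eval_map:
  assumes A: "hom_leibniz K A" and b: "leibniz_pairing K L M A b"
    and mult: "\<And>x y x' y'. \<lbrakk>x \<in> carrier L; y \<in> carrier L; x \<in> M \<or> y \<in> M;
        x' \<in> carrier L; y' \<in> carrier L; x' \<in> M \<or> y' \<in> M\<rbrakk>
      \<Longrightarrow> \<langle>b x y, b x' y'\<rangle>\<^bsub>A\<^esub> = b \<langle>x, y\<rangle>\<^bsub>L\<^esub> \<langle>x', y'\<rangle>\<^bsub>L\<^esub>"
  defines "h \<equiv> \<lambda>U. the_elem ((\<lambda>C. the_elem (hl_eval A (symbol_value b) ` C)) ` U)"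
  shows "h \<in> hs_hom K ext A"
    and "\<lbrakk>x \<in> carrier L; y \<in> carrier L; x \<in> M \<or> y \<in> M\<rbrakk> \<Longrightarrow> h (wedge K L M x y) = b x y"
proof -
  interpret b: leibniz_pairing K L M A b by fact
  let ?g = "\<lambda>C. the_elem (hl_eval A (symbol_value b) ` C)"
  have closed: "symbol_value b x \<in> carrier A" if "x \<in> symbols" for x
    using that by (cases rule: symbols_cases) (auto intro: b.pair_closed)
  note sound = symbol_value_rels[OF A b mult]
  have g: "?g \<in> hs_hom K tensor A"
    unfolding star_product_def by (rule hl_presented_map(1)[OF field_axioms A closed sound])
  have g_cls: "?g (cls t) = hl_eval A (symbol_value b) t" if "t \<in> terms" for t
    by (rule hl_presented_map(2)[OF field_axioms A closed sound that])
  interpret g: hs_map K tensor A ?g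
    by (rule hs_mapI[OF T.vs b.W.vs g])
  have "hs_span K tensor diffs \<subseteq> a_kernel tensor A ?g"
  proof (rule T.subspace_span(3)[OF diffs_subset diffs_twist])
    show "submodule (a_kernel tensor A ?g) K tensor"
      using g.kernel_subspace by (simp add: hs_subspace_def)
    have "?g u = \<zero>\<^bsub>A\<^esub>" if u: "u \<in> diffs" for u
    proof -
      from u obtain x y where "x \<in> M" "y \<in> M" "u = cls (x \<star> y) \<ominus>\<^bsub>tensor\<^esub> cls (x \<star>' y)"
        by (auto simp: star_class_def exterior_relators_def)
      then show ?thesis by (simp add: g.diff g_cls b.pair_closed)
    qed
    then show "diffs \<subseteq> a_kernel tensor A ?g" using diffs_subset by (auto simp: a_kernel_def')
  qed
  then have ker: "?g u = \<zero>\<^bsub>A\<^esub>" if "u \<in> hs_span K tensor diffs" for u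
    using that by (auto simp: a_kernel_def')
  note desc = E.descend[OF b.W.vs g ker]
  show "h \<in> hs_hom K ext A" unfolding h_def by (rule desc(1))
  have "h (ecls t) = hl_eval A (symbol_value b) t" if "t \<in> terms" for t
    unfolding h_def exterior_class_def using that by (subst desc(2)) (simp_all add: g_cls)
  then show "h (wedge K L M x y) = b x y" if "x \<in> carrier L" "y \<in> carrier L" "x \<in> M \<or> y \<in> M"
    using that by (auto simp: wedge_Star wedge_Star')
qed

lemma exterior_map_hom: "exterior_map L \<in> hs_hom K ext L"
  and exterior_map_wedge:
    "\<lbrakk>x \<in> carrier L; y \<in> carrier L; x \<in> M \<or> y \<in> M\<rbrakk> \<Longrightarrow> exterior_map L (wedge K L M x y) = \<langle>x, y\<rangle>\<^bsub>L\<^esub>"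
  using exterior_eval_map[OF hom_leibniz_axioms bracket_pairing]
  unfolding exterior_map_def[abs_def] symbol_bracket_value by auto

sublocale lam: hs_map K ext L "exterior_map L"
  by (rule hs_mapI[OF EV.vs vs exterior_map_hom])

lemma wedge_ext:
  assumes "hom_vector_space K W" "f \<in> hs_hom K ext W" "g \<in> hs_hom K ext W"
    and "\<And>x y. \<lbrakk>x \<in> carrier L; y \<in> carrier L; x \<in> M \<or> y \<in> M\<rbrakk> \<Longrightarrow> f (wedge K L M x y) = g (wedge K L M x y)"
    and "u \<in> carrier ext"
  shows "f u = g u"
proof -
  have "carrier ext \<subseteq> {u \<in> carrier ext. f u = g u}"
    using assms(4) by (intro wedge_span EV.equalizer_submodule[OF assms(1-3)]) (auto intro: wedge.pair_closed)
  with assms(5) show ?thesis by auto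
qed

end

text \<open>The element \<open>x \<and> y\<close> is evaluated as \<open>([x,y], \<beta> x y)\<close> in the pairing algebra. There the
  bracket depends on the first components alone, which is what the bracket relations demand.\<close>

lemma (in leibniz_pairing) wedge_universal:
  obtains f where "f \<in> hs_hom K (exterior_product K L M (carrier L)) W"
    and "\<And>x y. \<lbrakk>x \<in> carrier L; y \<in> carrier L; x \<in> M \<or> y \<in> M\<rbrakk> \<Longrightarrow> f (wedge K L M x y) = \<beta> x y"
proof -
  let ?A = "pairing_algebra L M W \<beta>" and ?b = "\<lambda>x y. (\<langle>x, y\<rangle>\<^bsub>L\<^esub>, \<beta> x y)"
  interpret A: hom_leibniz K ?A by (rule pairing_algebra_hom_leibniz)
  have b: "leibniz_pairing K L M ?A ?b"
    by (intro leibniz_pairing.intro leibniz_ideal_axioms A.vs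
        leibniz_pairing_axioms.intro)
      (auto simp: bracket_add_left bracket_add_right bracket_smult_left bracket_smult_right
        twist_bracket leibniz_add pair_closed pair_add_left pair_add_right pair_smult_left
        pair_smult_right pair_twist pair_leibniz)
  have mult: "\<langle>?b x y, ?b x' y'\<rangle>\<^bsub>?A\<^esub> = ?b \<langle>x, y\<rangle>\<^bsub>L\<^esub> \<langle>x', y'\<rangle>\<^bsub>L\<^esub>" for x y x' y'
    by simp
  note h = exterior_eval_map[OF A.hom_leibniz_axioms b mult]
  show ?thesis
    by (rule that[OF hs_hom_comp[OF h(1) snd_hom]]) (simp add: h(2))
qed

section \<open>Functoriality and right exactness of the exterior product\<close>

lemma hl_homD:
  assumes "p \<in> hl_hom K A B"
  shows "p \<in> hs_hom K A B"
    and "\<lbrakk>x \<in> carrier A; y \<in> carrier A\<rbrakk> \<Longrightarrow> p \<langle>x, y\<rangle>\<^bsub>A\<^esub> = \<langle>p x, p y\<rangle>\<^bsub>B\<^esub>"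
  using assms by (auto simp: hl_hom_def)

lemma exterior_functorial:
  assumes "leibniz_ideal K L M" "leibniz_ideal K L' M'"
    and p: "p \<in> hl_hom K L L'" and M: "p ` M \<subseteq> M'"
  obtains f where
    "f \<in> hs_hom K (exterior_product K L M (carrier L)) (exterior_product K L' M' (carrier L'))"
    and "\<And>x y. \<lbrakk>x \<in> carrier L; y \<in> carrier L; x \<in> M \<or> y \<in> M\<rbrakk>
      \<Longrightarrow> f (wedge K L M x y) = wedge K L' M' (p x) (p y)"
    and "\<And>u. u \<in> carrier (exterior_product K L M (carrier L))
      \<Longrightarrow> exterior_map L' (f u) = p (exterior_map L u)"
proof -
  interpret L: leibniz_ideal K L M by fact
  interpret L': leibniz_ideal K L' M' by fact
  interpret p: hs_map K L L' p
    by (rule hs_mapI[OF L.vs L'.vs hl_homD(1)[OF p]])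
  have pM: "p x \<in> M'" if "x \<in> M" for x using M that by auto
  note br = hl_homD(2)[OF p]
  have "leibniz_pairing K L M L'.ext (\<lambda>x y. wedge K L' M' (p x) (p y))"
    by unfold_locales
      (auto simp: p.add p.smult p.tw br pM L'.wedge.pair_add_left L'.wedge.pair_add_right
        L'.wedge.pair_smult_left L'.wedge.pair_smult_right L'.wedge.pair_twist
        L'.wedge.pair_leibniz intro: L'.wedge.pair_closed)
  then obtain f where f: "f \<in> hs_hom K L.ext L'.ext"
    "\<And>x y. \<lbrakk>x \<in> carrier L; y \<in> carrier L; x \<in> M \<or> y \<in> M\<rbrakk>
      \<Longrightarrow> f (wedge K L M x y) = wedge K L' M' (p x) (p y)"
    by (rule leibniz_pairing.wedge_universal) blast
  have "exterior_map L' (f u) = p (exterior_map L u)" if "u \<in> carrier L.ext" for u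
  proof (rule L.wedge_ext[OF L'.vs hs_hom_comp[OF f(1) L'.exterior_map_hom]
        hs_hom_comp[OF L.exterior_map_hom p.hs] _ that])
    fix x y assume "x \<in> carrier L" "y \<in> carrier L" "x \<in> M \<or> y \<in> M"
    then show "exterior_map L' (f (wedge K L M x y)) = p (exterior_map L (wedge K L M x y))"
      by (auto simp: f(2) L.exterior_map_wedge L'.exterior_map_wedge pM br)
  qed
  with f show ?thesis by (rule that)
qed

text \<open>Exactness in the middle comes from an inverse. Choose a preimage \<open>s x'\<close> of each \<open>x'\<close>; modulo
  the image of \<open>a\<close> the element \<open>s x' \<and> s y'\<close> does not depend on the choice, hence is a pairing
  on \<open>L'\<close>, and the linear map that it induces satisfies \<open>f (b u) = u\<close> modulo the image of \<open>a\<close>.\<close>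

lemma exterior_right_exact:
  assumes "leibniz_ideal K L R" "leibniz_ideal K L S" "leibniz_ideal K L' M'"
    and p: "p \<in> hl_hom K L L'" "p ` carrier L = carrier L'"
    and R: "R = a_kernel L L' p" "R \<subseteq> S" and S: "p ` S = M'"
    and a: "a \<in> hs_hom K (exterior_product K L R (carrier L)) (exterior_product K L S (carrier L))"
      "\<And>x y. \<lbrakk>x \<in> carrier L; y \<in> carrier L; x \<in> R \<or> y \<in> R\<rbrakk> \<Longrightarrow> a (wedge K L R x y) = wedge K L S x y"
    and b: "b \<in> hs_hom K (exterior_product K L S (carrier L)) (exterior_product K L' M' (carrier L'))"
      "\<And>x y. \<lbrakk>x \<in> carrier L; y \<in> carrier L; x \<in> S \<or> y \<in> S\<rbrakk>
        \<Longrightarrow> b (wedge K L S x y) = wedge K L' M' (p x) (p y)"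
  shows "a ` carrier (exterior_product K L R (carrier L))
      = a_kernel (exterior_product K L S (carrier L)) (exterior_product K L' M' (carrier L')) b"
    and "b ` carrier (exterior_product K L S (carrier L)) = carrier (exterior_product K L' M' (carrier L'))"
proof -
  interpret R: leibniz_ideal K L R by fact
  interpret S: leibniz_ideal K L S by fact
  interpret M: leibniz_ideal K L' M' by fact
  interpret p: hs_map K L L' p
    by (rule hs_mapI[OF R.vs M.vs hl_homD(1)[OF p(1)]])
  interpret a: hs_map K R.ext S.ext a
    by (rule hs_mapI[OF R.EV.vs S.EV.vs a(1)])
  interpret b: hs_map K S.ext M.ext b
    by (rule hs_mapI[OF S.EV.vs M.EV.vs b(1)])
  have R_iff: "x \<in> R \<longleftrightarrow> x \<in> carrier L \<and> p x = \<zero>\<^bsub>L'\<^esub>" for x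
    unfolding R(1) a_kernel_def' by blast
  have diffR: "x \<ominus>\<^bsub>L\<^esub> y \<in> R" if "x \<in> carrier L" "y \<in> carrier L" "p x = p y" for x y
    using that by (simp add: R_iff p.diff)
  have S_iff: "p x \<in> M' \<longleftrightarrow> x \<in> S" if x: "x \<in> carrier L" for x
  proof
    assume "p x \<in> M'"
    then obtain s where s: "s \<in> S" "p x = p s" using S by auto
    then have "x \<ominus>\<^bsub>L\<^esub> s \<in> S" using diffR[of x s] x R(2) by auto
    then have "(x \<ominus>\<^bsub>L\<^esub> s) \<oplus>\<^bsub>L\<^esub> s \<in> S" using s by simp
    moreover have "(x \<ominus>\<^bsub>L\<^esub> s) \<oplus>\<^bsub>L\<^esub> s = x" using x s R.eq_diff_iff[of "x \<ominus>\<^bsub>L\<^esub> s" x s] by simp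
    ultimately show "x \<in> S" by simp
  qed (use S in auto)
  let ?B = "a ` carrier R.ext"
  have subB: "hs_subspace K S.ext ?B" by (rule a.image_subspace[OF R.EV.whole_subspace])
  have "(\<lambda>u. b (a u)) ` carrier R.ext \<subseteq> {\<zero>\<^bsub>M.ext\<^esub>}"
  proof -
    have "b (a u) = \<zero>\<^bsub>M.ext\<^esub>" if "u \<in> carrier R.ext" for u
    proof (rule R.wedge_ext[OF M.EV.vs hs_hom_comp[OF a(1) b(1)] M.EV.hs_hom_zero _ that])
      fix x y assume xy: "x \<in> carrier L" "y \<in> carrier L" "x \<in> R \<or> y \<in> R"
      then have "x \<in> S \<or> y \<in> S" using R(2) by auto
      then show "b (a (wedge K L R x y)) = \<zero>\<^bsub>M.ext\<^esub>"
        using xy by (auto simp: a(2) b(2) R_iff)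
    qed
    then show ?thesis by auto
  qed
  then have ba: "b v = \<zero>\<^bsub>M.ext\<^esub>" if "v \<in> ?B" for v using that by auto
  interpret Q: subspace_quotient K S.ext ?B "hs_quot S.ext ?B"
    by (rule subspace_quotient_hs_quot[OF S.EV.vs subB])
  interpret QV: hom_vector_space K "hs_quot S.ext ?B" by (rule Q.quotient_hom_vector_space)
  define q where "q u = ?B +>\<^bsub>S.ext\<^esub> u" for u
  define w where "w = wedge K L S"
  note w_closed [simp] = S.wedge.pair_closed[folded w_def]
  have q_hom: "q \<in> hs_hom K S.ext (hs_quot S.ext ?B)"
    unfolding q_def[abs_def] by (rule Q.projection)
  interpret q: hs_map K S.ext "hs_quot S.ext ?B" q
    by (rule hs_mapI[OF S.EV.vs QV.vs q_hom])
  \<comment> \<open>preimages may be replaced one at a time: \<open>x \<and> y - x' \<and> y = (x - x') \<and> y\<close> and \<open>x - x'\<close> is in \<open>R\<close>\<close>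
  have key: "q (w x y) = q (w x' y')"
    if x: "x \<in> carrier L" "x' \<in> carrier L" "p x = p x'"
      and y: "y \<in> carrier L" "y' \<in> carrier L" "p y = p y'" and xy: "x \<in> S \<or> y \<in> S" for x x' y y'
  proof -
    have x'S: "x' \<in> S" if "x \<in> S" using S_iff[OF x(1)] S_iff[OF x(2)] x(3) that by simp
    have y'S: "y' \<in> S" if "y \<in> S" using S_iff[OF y(1)] S_iff[OF y(2)] y(3) that by simp
    have "w x y \<ominus>\<^bsub>S.ext\<^esub> w x' y = w (x \<ominus>\<^bsub>L\<^esub> x') y"
      unfolding w_def by (rule S.wedge.pair_diff_left[symmetric]) (use x y xy x'S in auto)
    also have "\<dots> = a (wedge K L R (x \<ominus>\<^bsub>L\<^esub> x') y)"
      unfolding w_def by (rule a(2)[symmetric]) (use x y diffR in auto)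
    also have "\<dots> \<in> ?B" using x y diffR by (intro imageI R.wedge.pair_closed) auto
    finally have 1: "q (w x y) = q (w x' y)"
      unfolding q_def using x y xy x'S by (subst Q.coset_eq_iff) auto
    have "w x' y \<ominus>\<^bsub>S.ext\<^esub> w x' y' = w x' (y \<ominus>\<^bsub>L\<^esub> y')"
      unfolding w_def by (rule S.wedge.pair_diff_right[symmetric]) (use x y xy x'S y'S in auto)
    also have "\<dots> = a (wedge K L R x' (y \<ominus>\<^bsub>L\<^esub> y'))"
      unfolding w_def by (rule a(2)[symmetric]) (use x y diffR in auto)
    also have "\<dots> \<in> ?B" using x y diffR by (intro imageI R.wedge.pair_closed) auto
    finally have 2: "q (w x' y) = q (w x' y')"
      unfolding q_def using x y xy x'S y'S by (subst Q.coset_eq_iff) auto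
    from 1 2 show ?thesis by simp
  qed
  define s where "s = (\<lambda>x'. SOME x. x \<in> carrier L \<and> p x = x')"
  have lift: "\<exists>x. x \<in> carrier L \<and> x' = p x" if "x' \<in> carrier L'" for x'
  proof -
    have "x' \<in> p ` carrier L" unfolding p(2) by (rule that)
    then show ?thesis by blast
  qed
  have "s x' \<in> carrier L \<and> p (s x') = x'" if "x' \<in> carrier L'" for x'
    unfolding s_def by (rule someI_ex) (use lift[OF that] in blast)
  then have s: "s x' \<in> carrier L" "p (s x') = x'" if "x' \<in> carrier L'" for x'
    using that by blast+
  have sS: "s x' \<in> S" if "x' \<in> M'" for x'
    using that S_iff[of "s x'"] s by simp
  define \<beta> where "\<beta> x' y' = q (w (s x') (s y'))" for x' y'
  have \<beta>: "\<beta> (p x) (p y) = q (w x y)" if "x \<in> carrier L" "y \<in> carrier L" "x \<in> S \<or> y \<in> S" for x y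
    unfolding \<beta>_def by (rule key[symmetric]) (use that s in auto)
  note br = hl_homD(2)[OF p(1)]
  have "leibniz_pairing K L' M' (hs_quot S.ext ?B) \<beta>"
  proof (intro leibniz_pairing.intro M.leibniz_ideal_axioms QV.vs
      leibniz_pairing_axioms.intro)
    fix x' y' assume xy': "x' \<in> carrier L'" "y' \<in> carrier L'"
    obtain x where x: "x \<in> carrier L" "x' = p x" using lift xy' by blast
    obtain y where y: "y \<in> carrier L" "y' = p y" using lift xy' by blast
    show "\<beta> x' y' \<in> carrier (hs_quot S.ext ?B)" if "x' \<in> M' \<or> y' \<in> M'"
      using that x y by (simp add: S_iff \<beta>)
    show "\<beta> (twist L' x') (twist L' y') = twist (hs_quot S.ext ?B) (\<beta> x' y')" if "x' \<in> M' \<or> y' \<in> M'"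
    proof -
      have "x \<in> S \<or> y \<in> S" using that x y by (simp add: S_iff)
      then show ?thesis using x y
        by (auto simp: p.tw[symmetric] \<beta> q.tw[symmetric] w_def S.wedge.pair_twist S.wedge.pair_closed)
    qed
    fix z' assume z': "z' \<in> carrier L'"
    then obtain z where z: "z \<in> carrier L" "z' = p z" using lift by blast
    show "\<beta> (x' \<oplus>\<^bsub>L'\<^esub> y') z' = \<beta> x' z' \<oplus>\<^bsub>hs_quot S.ext ?B\<^esub> \<beta> y' z'"
      if "x' \<in> M' \<and> y' \<in> M' \<or> z' \<in> M'"
    proof -
      have "x \<in> S \<and> y \<in> S \<or> z \<in> S" using that x y z by (simp add: S_iff)
      then show ?thesis using x y z
        by (auto simp: p.add[symmetric] \<beta> q.add[symmetric] w_def S.wedge.pair_add_left S.wedge.pair_closed)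
    qed
    show "\<beta> x' (y' \<oplus>\<^bsub>L'\<^esub> z') = \<beta> x' y' \<oplus>\<^bsub>hs_quot S.ext ?B\<^esub> \<beta> x' z'"
      if "x' \<in> M' \<or> y' \<in> M' \<and> z' \<in> M'"
    proof -
      have "x \<in> S \<or> y \<in> S \<and> z \<in> S" using that x y z by (simp add: S_iff)
      then show ?thesis using x y z
        by (auto simp: p.add[symmetric] \<beta> q.add[symmetric] w_def S.wedge.pair_add_right S.wedge.pair_closed)
    qed
    show "\<beta> (twist L' x') \<langle>y', z'\<rangle>\<^bsub>L'\<^esub> \<oplus>\<^bsub>hs_quot S.ext ?B\<^esub> \<beta> \<langle>x', z'\<rangle>\<^bsub>L'\<^esub> (twist L' y')
        = \<beta> \<langle>x', y'\<rangle>\<^bsub>L'\<^esub> (twist L' z')"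
      if "x' \<in> M' \<or> y' \<in> M' \<or> z' \<in> M'"
    proof -
      have m: "x \<in> S \<or> y \<in> S \<or> z \<in> S" using that x y z by (simp add: S_iff)
      then have m': "twist L x \<in> S \<or> \<langle>y, z\<rangle>\<^bsub>L\<^esub> \<in> S" "\<langle>x, z\<rangle>\<^bsub>L\<^esub> \<in> S \<or> twist L y \<in> S"
        "\<langle>x, y\<rangle>\<^bsub>L\<^esub> \<in> S \<or> twist L z \<in> S"
        using x y z by auto
      then have "\<beta> (twist L' x') \<langle>y', z'\<rangle>\<^bsub>L'\<^esub> = q (w (twist L x) \<langle>y, z\<rangle>\<^bsub>L\<^esub>)"
        "\<beta> \<langle>x', z'\<rangle>\<^bsub>L'\<^esub> (twist L' y') = q (w \<langle>x, z\<rangle>\<^bsub>L\<^esub> (twist L y))"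
        "\<beta> \<langle>x', y'\<rangle>\<^bsub>L'\<^esub> (twist L' z') = q (w \<langle>x, y\<rangle>\<^bsub>L\<^esub> (twist L z))"
        using x y z by (simp_all add: p.tw[symmetric] br[symmetric] \<beta>)
      with m m' x y z show ?thesis
        by (simp add: q.add[symmetric] w_def S.wedge.pair_leibniz S.wedge.pair_closed)
    qed
  next
    fix c x' y' assume c: "c \<in> carrier K" and xy': "x' \<in> carrier L'" "y' \<in> carrier L'"
      and m: "x' \<in> M' \<or> y' \<in> M'"
    obtain x where x: "x \<in> carrier L" "x' = p x" using lift xy' by blast
    obtain y where y: "y \<in> carrier L" "y' = p y" using lift xy' by blast
    have "x \<in> S \<or> y \<in> S" using m x y by (simp add: S_iff)
    with c x y show "\<beta> (c \<odot>\<^bsub>L'\<^esub> x') y' = c \<odot>\<^bsub>hs_quot S.ext ?B\<^esub> \<beta> x' y'"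
      "\<beta> x' (c \<odot>\<^bsub>L'\<^esub> y') = c \<odot>\<^bsub>hs_quot S.ext ?B\<^esub> \<beta> x' y'"
      by (auto simp: p.smult[symmetric] \<beta> q.smult[symmetric] w_def S.wedge.pair_smult_left
          S.wedge.pair_smult_right S.wedge.pair_closed)
  qed
  then obtain f where f: "f \<in> hs_hom K M.ext (hs_quot S.ext ?B)"
    "\<And>x y. \<lbrakk>x \<in> carrier L'; y \<in> carrier L'; x \<in> M' \<or> y \<in> M'\<rbrakk> \<Longrightarrow> f (wedge K L' M' x y) = \<beta> x y"
    by (rule leibniz_pairing.wedge_universal) blast
  interpret f: hs_map K M.ext "hs_quot S.ext ?B" f
    by (rule hs_mapI[OF M.EV.vs QV.vs f(1)])
  have fb: "f (b u) = q u" if "u \<in> carrier S.ext" for u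
  proof (rule S.wedge_ext[OF QV.vs hs_hom_comp[OF b(1) f(1)] q_hom _ that])
    fix x y assume xy: "x \<in> carrier L" "y \<in> carrier L" "x \<in> S \<or> y \<in> S"
    then show "f (b (wedge K L S x y)) = q (wedge K L S x y)"
      by (simp add: b(2) f(2) S_iff \<beta> w_def)
  qed
  show "a ` carrier R.ext = a_kernel S.ext M.ext b"
  proof
    show "?B \<subseteq> a_kernel S.ext M.ext b"
      using ba by (auto simp: a_kernel_def')
    show "a_kernel S.ext M.ext b \<subseteq> ?B"
    proof
      fix u assume "u \<in> a_kernel S.ext M.ext b"
      then have u: "u \<in> carrier S.ext" "b u = \<zero>\<^bsub>M.ext\<^esub>" by (auto simp: a_kernel_def')
      then have "q u = ?B" using fb[of u] by (simp add: Q.quotient)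
      then show "u \<in> ?B" using u unfolding q_def by (simp add: Q.coset_zero_iff)
    qed
  qed
  have "carrier M.ext \<subseteq> b ` carrier S.ext"
  proof (rule M.wedge_span)
    show "submodule (b ` carrier S.ext) K M.ext"
      using b.image_subspace[OF S.EV.whole_subspace] by (simp add: hs_subspace_def)
    fix x' y' assume xy': "x' \<in> carrier L'" "y' \<in> carrier L'" "x' \<in> M' \<or> y' \<in> M'"
    then have "wedge K L' M' x' y' = b (wedge K L S (s x') (s y'))"
      using b(2)[of "s x'" "s y'"] s sS by auto
    moreover have "wedge K L S (s x') (s y') \<in> carrier S.ext"
      using xy' s sS by (auto intro!: S.wedge.pair_closed)
    ultimately show "wedge K L' M' x' y' \<in> b ` carrier S.ext" by blast
  qed
  then show "b ` carrier S.ext = carrier M.ext" by auto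
qed

section \<open>Injectivity of two comparison maps\<close>

text \<open>The vanishing of the second homology of a free algebra. The homomorphism
  \<open>\<psi> : F \<rightarrow> F \<times> E(F,F)\<close> determined by \<open>v \<mapsto> (\<iota> v, 0)\<close> has the identity as first component, because
  homomorphisms from \<open>F\<close> are determined on \<open>V\<close>. Its second component \<open>s\<close> therefore sends \<open>[x,y]\<close> to
  \<open>x \<and> y\<close> and is a left inverse of \<open>\<lambda>\<close>.\<close>

lemma exterior_map_free_injective:
  fixes V :: "('k, 'v) hom_space" and F :: "('k, 'f) hom_alg"
  assumes free: "free_hom_leibniz K V \<iota> F"
    and u: "u \<in> carrier (exterior_product K F (carrier F) (carrier F))" "exterior_map F u = \<zero>\<^bsub>F\<^esub>"
  shows "u = \<zero>\<^bsub>exterior_product K F (carrier F) (carrier F)\<^esub>"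
proof -
  have V: "hom_vector_space K V" and F: "hom_leibniz K F" and \<iota>: "\<iota> \<in> hs_hom K V F"
    using free by (auto simp: free_hom_leibniz_def)
  interpret V: hom_vector_space K V by fact
  interpret F: leibniz_ideal K F "carrier F"
    using F hom_leibniz.whole_ideal[OF F] by (simp add: leibniz_ideal_def leibniz_ideal_axioms_def)
  let ?A = "pairing_algebra F (carrier F) F.ext (wedge K F (carrier F))"
  have A: "hom_leibniz K ?A" by (rule F.wedge.pairing_algebra_hom_leibniz)
  have "(\<lambda>v. (\<iota> v, \<zero>\<^bsub>F.ext\<^esub>)) \<in> hs_hom K V ?A"
    using \<iota> by (intro hs_homI) (auto simp: hs_hom_def)
  from free_hom_leibniz_universal[OF free A this]
  obtain \<psi> where \<psi>: "\<psi> \<in> hl_hom K F ?A" "\<And>v. v \<in> carrier V \<Longrightarrow> \<psi> (\<iota> v) = (\<iota> v, \<zero>\<^bsub>F.ext\<^esub>)"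
    by blast
  have fst_id: "fst (\<psi> x) = x" if x: "x \<in> carrier F" for x
  proof -
    have "\<exists>!\<phi>. \<phi> \<in> hl_hom K F F \<and> \<phi> \<in> extensional (carrier F) \<and> (\<forall>v\<in>carrier V. \<phi> (\<iota> v) = \<iota> v)"
      by (rule free_hom_leibniz_universal[OF free F \<iota>])
    moreover have "restrict (fst \<circ> \<psi>) (carrier F) \<in> hl_hom K F F"
      by (rule hl_hom_compose[OF F \<psi>(1) F.wedge.fst_hom])
    moreover have "restrict id (carrier F) \<in> hl_hom K F F"
      by (auto simp: hl_hom_def hs_hom_def)
    moreover have "\<iota> v \<in> carrier F" if "v \<in> carrier V" for v
      using \<iota> that by (rule hs_homD)
    ultimately have "restrict (fst \<circ> \<psi>) (carrier F) = restrict id (carrier F)"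
      using \<psi>(2) by (smt (verit, ccfv_SIG) comp_apply fst_conv id_apply restrict_apply' restrict_extensional)
    then show ?thesis using x by (metis comp_apply id_apply restrict_apply')
  qed
  define s where "s x = snd (\<psi> x)" for x
  have s: "s \<in> hs_hom K F F.ext"
    unfolding s_def[abs_def] by (rule hs_hom_comp[OF hl_homD(1)[OF \<psi>(1)] F.wedge.snd_hom])
  have "s (exterior_map F u) = u"
  proof (rule F.wedge_ext[OF F.EV.vs hs_hom_comp[OF F.exterior_map_hom s] hs_hom_id _ u(1)])
    fix x y assume xy: "x \<in> carrier F" "y \<in> carrier F"
    then have "\<psi> \<langle>x, y\<rangle>\<^bsub>F\<^esub> = \<langle>\<psi> x, \<psi> y\<rangle>\<^bsub>?A\<^esub>" by (rule hl_homD(2)[OF \<psi>(1)])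
    then have "s \<langle>x, y\<rangle>\<^bsub>F\<^esub> = wedge K F (carrier F) x y"
      using xy by (simp add: s_def fst_id)
    then show "s (exterior_map F (wedge K F (carrier F) x y)) = wedge K F (carrier F) x y"
      using xy by (simp add: F.exterior_map_wedge)
  qed
  moreover have "s \<zero>\<^bsub>F\<^esub> = \<zero>\<^bsub>F.ext\<^esub>"
    using hs_map.zero[OF hs_mapI[OF F.vs F.EV.vs s]] .
  ultimately show ?thesis using u(2) by simp
qed

text \<open>Here \<open>e\<close> is a homomorphic projection with kernel \<open>M\<close>. Put \<open>d x = x - e x\<close>, an element of \<open>M\<close>. Then
  \<open>\<beta> x y = d x \<and> y + e x \<and> d y\<close> is a pairing on all of \<open>L\<close> that extends the wedge of \<open>E(L,M)\<close>, so it
  induces a left inverse of \<open>a\<close>.\<close>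

lemma exterior_split_injective:
  assumes "leibniz_ideal K L M"
    and e: "e \<in> hl_hom K L L"
    and eM: "\<And>x. x \<in> carrier L \<Longrightarrow> x \<ominus>\<^bsub>L\<^esub> e x \<in> M" "\<And>x. x \<in> M \<Longrightarrow> e x = \<zero>\<^bsub>L\<^esub>"
    and a: "a \<in> hs_hom K (exterior_product K L M (carrier L)) (exterior_product K L (carrier L) (carrier L))"
      "\<And>x y. \<lbrakk>x \<in> carrier L; y \<in> carrier L; x \<in> M \<or> y \<in> M\<rbrakk>
        \<Longrightarrow> a (wedge K L M x y) = wedge K L (carrier L) x y"
  shows "inj_on a (carrier (exterior_product K L M (carrier L)))"
proof -
  interpret L: leibniz_ideal K L M by fact
  interpret W: leibniz_ideal K L "carrier L"
    using L.hom_leibniz_axioms L.whole_ideal by (simp add: leibniz_ideal_def leibniz_ideal_axioms_def)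
  interpret e: hs_map K L L e
    by (rule hs_mapI[OF L.vs L.vs hl_homD(1)[OF e]])
  define d where "d x = x \<ominus>\<^bsub>L\<^esub> e x" for x
  define w where "w = wedge K L M"
  have dM [simp]: "d x \<in> M" if "x \<in> carrier L" for x using eM(1)[OF that] by (simp add: d_def)
  have d_closed [simp]: "d x \<in> carrier L" if "x \<in> carrier L" for x
    using L.M_carrier[OF dM[OF that]] .
  have sum: "d x \<oplus>\<^bsub>L\<^esub> e x = x" if "x \<in> carrier L" for x
    using that L.eq_diff_iff[of "d x" x "e x"] by (simp add: d_def)
  have d_add: "d (x \<oplus>\<^bsub>L\<^esub> y) = d x \<oplus>\<^bsub>L\<^esub> d y" if "x \<in> carrier L" "y \<in> carrier L" for x y
    using that by (simp add: d_def a_minus_def e.add L.minus_add L.a_ac)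
  have d_smult: "d (c \<odot>\<^bsub>L\<^esub> x) = c \<odot>\<^bsub>L\<^esub> d x" if "c \<in> carrier K" "x \<in> carrier L" for c x
    using that by (simp add: d_def a_minus_def e.smult L.smult_r_distr L.smult_r_minus)
  have d_twist: "d (twist L x) = twist L (d x)" if "x \<in> carrier L" for x
    using that by (simp add: d_def e.tw L.twist_diff)
  have e_br: "e \<langle>x, y\<rangle>\<^bsub>L\<^esub> = \<langle>e x, e y\<rangle>\<^bsub>L\<^esub>" if "x \<in> carrier L" "y \<in> carrier L" for x y
    using hl_homD(2)[OF e that] .
  have d_br: "d \<langle>x, y\<rangle>\<^bsub>L\<^esub> = \<langle>d x, y\<rangle>\<^bsub>L\<^esub> \<oplus>\<^bsub>L\<^esub> \<langle>e x, d y\<rangle>\<^bsub>L\<^esub>"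
    if xy: "x \<in> carrier L" "y \<in> carrier L" for x y
  proof -
    have "\<langle>x, y\<rangle>\<^bsub>L\<^esub> = \<langle>d x, y\<rangle>\<^bsub>L\<^esub> \<oplus>\<^bsub>L\<^esub> \<langle>e x, y\<rangle>\<^bsub>L\<^esub>"
      using xy L.bracket_add_left[of "d x" "e x" y] by (simp add: sum)
    also have "\<langle>e x, y\<rangle>\<^bsub>L\<^esub> = \<langle>e x, d y\<rangle>\<^bsub>L\<^esub> \<oplus>\<^bsub>L\<^esub> \<langle>e x, e y\<rangle>\<^bsub>L\<^esub>"
      using xy L.bracket_add_right[of "e x" "d y" "e y"] by (simp add: sum)
    finally have "(\<langle>d x, y\<rangle>\<^bsub>L\<^esub> \<oplus>\<^bsub>L\<^esub> \<langle>e x, d y\<rangle>\<^bsub>L\<^esub>) \<oplus>\<^bsub>L\<^esub> \<langle>e x, e y\<rangle>\<^bsub>L\<^esub> = \<langle>x, y\<rangle>\<^bsub>L\<^esub>"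
      using xy by (simp add: L.a_assoc)
    then have "\<langle>d x, y\<rangle>\<^bsub>L\<^esub> \<oplus>\<^bsub>L\<^esub> \<langle>e x, d y\<rangle>\<^bsub>L\<^esub> = \<langle>x, y\<rangle>\<^bsub>L\<^esub> \<ominus>\<^bsub>L\<^esub> \<langle>e x, e y\<rangle>\<^bsub>L\<^esub>"
      using xy by (subst L.eq_diff_iff) auto
    then show ?thesis using xy by (simp add: d_def[of "\<langle>x, y\<rangle>\<^bsub>L\<^esub>"] e_br)
  qed
  note w_closed [simp] = L.wedge.pair_closed[folded w_def]
  note w_simps = L.wedge.pair_add_left[folded w_def] L.wedge.pair_add_right[folded w_def]
    L.wedge.pair_smult_left[folded w_def] L.wedge.pair_smult_right[folded w_def]
    L.wedge.pair_twist[folded w_def]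
  define \<beta> where "\<beta> x y = w (d x) y \<oplus>\<^bsub>L.ext\<^esub> w (e x) (d y)" for x y
  have "leibniz_pairing K L (carrier L) L.ext \<beta>"
  proof (intro leibniz_pairing.intro W.leibniz_ideal_axioms L.EV.vs
      leibniz_pairing_axioms.intro)
    fix x y z assume xyz [simp]: "x \<in> carrier L" "y \<in> carrier L" "z \<in> carrier L"
    show "\<beta> (x \<oplus>\<^bsub>L\<^esub> y) z = \<beta> x z \<oplus>\<^bsub>L.ext\<^esub> \<beta> y z"
      by (simp add: \<beta>_def d_add e.add w_simps L.EV.M.a_ac)
    show "\<beta> x (y \<oplus>\<^bsub>L\<^esub> z) = \<beta> x y \<oplus>\<^bsub>L.ext\<^esub> \<beta> x z"
      by (simp add: \<beta>_def d_add e.add w_simps L.EV.M.a_ac)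
    note leib = L.wedge.pair_leibniz[folded w_def]
    \<comment> \<open>in the Leibniz rule for \<open>\<beta>\<close> the triples \<open>(d x, y, z)\<close>, \<open>(e x, d y, z)\<close>, \<open>(e x, e y, d z)\<close>
    contribute the terms \<open>p\<close>, \<open>q\<close>, \<open>r\<close>; the rest is \<open>t1 + t2 = q2 + r2\<close>, both being \<open>t0 + t2 + r2\<close>\<close>
    define p1 where "p1 = w (twist L (d x)) \<langle>y, z\<rangle>\<^bsub>L\<^esub>"
    define p2 where "p2 = w \<langle>d x, z\<rangle>\<^bsub>L\<^esub> (twist L y)"
    define p3 where "p3 = w \<langle>d x, y\<rangle>\<^bsub>L\<^esub> (twist L z)"
    define q1 where "q1 = w (twist L (e x)) \<langle>d y, z\<rangle>\<^bsub>L\<^esub>"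
    define q2 where "q2 = w \<langle>e x, z\<rangle>\<^bsub>L\<^esub> (twist L (d y))"
    define q3 where "q3 = w \<langle>e x, d y\<rangle>\<^bsub>L\<^esub> (twist L z)"
    define r1 where "r1 = w (twist L (e x)) \<langle>e y, d z\<rangle>\<^bsub>L\<^esub>"
    define r2 where "r2 = w \<langle>e x, d z\<rangle>\<^bsub>L\<^esub> (twist L (e y))"
    define r3 where "r3 = w \<langle>e x, e y\<rangle>\<^bsub>L\<^esub> (twist L (d z))"
    define t1 where "t1 = w \<langle>e x, d z\<rangle>\<^bsub>L\<^esub> (twist L y)"
    define t2 where "t2 = w \<langle>e x, e z\<rangle>\<^bsub>L\<^esub> (twist L (d y))"
    define t0 where "t0 = w \<langle>e x, d z\<rangle>\<^bsub>L\<^esub> (twist L (d y))"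
    note defs = p1_def p2_def p3_def q1_def q2_def q3_def r1_def r2_def r3_def t1_def t2_def t0_def
    have cl [simp]: "p1 \<in> carrier L.ext" "p2 \<in> carrier L.ext" "q1 \<in> carrier L.ext" "q2 \<in> carrier L.ext"
      "r1 \<in> carrier L.ext" "r2 \<in> carrier L.ext" "t1 \<in> carrier L.ext" "t2 \<in> carrier L.ext"
      "t0 \<in> carrier L.ext"
      by (simp_all add: defs)
    have 1: "p3 = p1 \<oplus>\<^bsub>L.ext\<^esub> p2" unfolding defs by (rule leib[symmetric]) auto
    have 2: "q3 = q1 \<oplus>\<^bsub>L.ext\<^esub> q2" unfolding defs by (rule leib[symmetric]) auto
    have 3: "r3 = r1 \<oplus>\<^bsub>L.ext\<^esub> r2" unfolding defs by (rule leib[symmetric]) auto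
    have "twist L (d y) \<oplus>\<^bsub>L\<^esub> twist L (e y) = twist L y"
      by (simp add: L.twist_add[symmetric] sum)
    then have t1: "t1 = t0 \<oplus>\<^bsub>L.ext\<^esub> r2"
      unfolding defs using L.wedge.pair_add_right[folded w_def, of "\<langle>e x, d z\<rangle>\<^bsub>L\<^esub>" "twist L (d y)" "twist L (e y)"]
      by simp
    have "\<langle>e x, d z\<rangle>\<^bsub>L\<^esub> \<oplus>\<^bsub>L\<^esub> \<langle>e x, e z\<rangle>\<^bsub>L\<^esub> = \<langle>e x, z\<rangle>\<^bsub>L\<^esub>"
      by (simp add: L.bracket_add_right[symmetric] sum)
    then have q2: "q2 = t0 \<oplus>\<^bsub>L.ext\<^esub> t2"
      unfolding defs using L.wedge.pair_add_left[folded w_def, of "\<langle>e x, d z\<rangle>\<^bsub>L\<^esub>" "\<langle>e x, e z\<rangle>\<^bsub>L\<^esub>" "twist L (d y)"]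
      by simp
    have b1: "\<beta> (twist L x) \<langle>y, z\<rangle>\<^bsub>L\<^esub> = p1 \<oplus>\<^bsub>L.ext\<^esub> (q1 \<oplus>\<^bsub>L.ext\<^esub> r1)"
      by (simp add: \<beta>_def d_twist e.tw d_br w_simps defs)
    have b2: "\<beta> \<langle>x, z\<rangle>\<^bsub>L\<^esub> (twist L y) = (p2 \<oplus>\<^bsub>L.ext\<^esub> t1) \<oplus>\<^bsub>L.ext\<^esub> t2"
      by (simp add: \<beta>_def d_twist e.tw d_br e_br w_simps defs)
    have b3: "\<beta> \<langle>x, y\<rangle>\<^bsub>L\<^esub> (twist L z) = (p3 \<oplus>\<^bsub>L.ext\<^esub> q3) \<oplus>\<^bsub>L.ext\<^esub> r3"
      by (simp add: \<beta>_def d_twist e.tw d_br e_br w_simps defs)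
    show "\<beta> (twist L x) \<langle>y, z\<rangle>\<^bsub>L\<^esub> \<oplus>\<^bsub>L.ext\<^esub> \<beta> \<langle>x, z\<rangle>\<^bsub>L\<^esub> (twist L y) = \<beta> \<langle>x, y\<rangle>\<^bsub>L\<^esub> (twist L z)"
      unfolding b1 b2 b3 1 2 3 q2 t1 by (simp add: L.EV.M.a_ac)
  qed (simp_all add: \<beta>_def d_smult d_twist e.smult e.tw w_simps L.EV.smult_r_distr L.EV.twist_add)
  then obtain r where r: "r \<in> hs_hom K W.ext L.ext"
    "\<And>x y. \<lbrakk>x \<in> carrier L; y \<in> carrier L\<rbrakk> \<Longrightarrow> r (wedge K L (carrier L) x y) = \<beta> x y"
    by (rule leibniz_pairing.wedge_universal) blast
  have ra: "r (a u) = u" if "u \<in> carrier L.ext" for u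
  proof (rule L.wedge_ext[OF L.EV.vs hs_hom_comp[OF a(1) r(1)] hs_hom_id _ that])
    fix x y assume xy: "x \<in> carrier L" "y \<in> carrier L" "x \<in> M \<or> y \<in> M"
    have "\<beta> x y = w x y"
      using xy(3)
    proof
      assume "x \<in> M"
      then have "d x = x" "e x = \<zero>\<^bsub>L\<^esub>" using sum[OF xy(1)] xy eM(2) by simp_all
      with xy show ?thesis by (simp add: \<beta>_def L.wedge.pair_zero_left[folded w_def])
    next
      assume "y \<in> M"
      then have "d y = y" using sum[OF xy(2)] xy eM(2) by simp
      with xy \<open>y \<in> M\<close> show ?thesis
        by (simp add: \<beta>_def L.wedge.pair_add_left[folded w_def, symmetric] sum)
    qed
    then show "r (a (wedge K L M x y)) = wedge K L M x y"
      using xy by (simp add: a(2) r(2) w_def)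
  qed
  then show ?thesis by (metis inj_on_inverseI)
qed

section \<open>Tensor powers and low-dimensional homology\<close>

context hom_vector_space
begin

abbreviation "tsym n \<equiv> tensor_symbols V n"
abbreviation "tcls n t \<equiv> tensor_cong K V n `` {t}"
abbreviation "tpow n \<equiv> tensor_power K V n"

lemma tensor_cong_terms:
  assumes "(s, t) \<in> tensor_cong K V n"
  shows "s \<in> lin_terms K (tsym n)" "t \<in> lin_terms K (tsym n)"
proof -
  have "s \<in> lin_terms K (tsym n) \<and> t \<in> lin_terms K (tsym n)"
    using assms unfolding tensor_cong_def by induction (auto intro!: lin_terms.intros)
  then show "s \<in> lin_terms K (tsym n)" "t \<in> lin_terms K (tsym n)" by auto
qed

lemma tensor_cong_equiv: "equiv (lin_terms K (tsym n)) (tensor_cong K V n)"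
proof (rule equivI)
  show "tensor_cong K V n \<subseteq> lin_terms K (tsym n) \<times> lin_terms K (tsym n)"
    by (auto dest: tensor_cong_terms)
  show "refl_on (lin_terms K (tsym n)) (tensor_cong K V n)"
    by (auto intro: refl_onI lin_cong.refl simp: tensor_cong_def)
  show "sym (tensor_cong K V n)" unfolding tensor_cong_def by (rule symI) (rule lin_cong.sym)
  show "trans (tensor_cong K V n)" unfolding tensor_cong_def by (rule transI) (rule lin_cong.trans)
qed

lemma tcls_eq_iff:
  "\<lbrakk>s \<in> lin_terms K (tsym n); t \<in> lin_terms K (tsym n)\<rbrakk> \<Longrightarrow> tcls n s = tcls n t \<longleftrightarrow> (s, t) \<in> tensor_cong K V n"
  by (rule eq_equiv_class_iff[OF tensor_cong_equiv])

text \<open>The self-map of the tensor power, on representing terms.\<close>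

definition ttw :: "('a, 'c list) lin_term \<Rightarrow> ('a, 'c list) lin_term"
  where "ttw = map_lin_term id (map (twist V))"

lemma ttw_simps [simp]:
  "ttw (LGen xs) = LGen (map (twist V) xs)" "ttw LZero = LZero"
  "ttw (LAdd s t) = LAdd (ttw s) (ttw t)" "ttw (LSmult c t) = LSmult c (ttw t)"
  by (simp_all add: ttw_def)

lemma tsym_twist: "xs \<in> tsym n \<Longrightarrow> map (twist V) xs \<in> tsym n"
  by (auto simp: tensor_symbols_def)

lemma ttw_terms: "t \<in> lin_terms K (tsym n) \<Longrightarrow> ttw t \<in> lin_terms K (tsym n)"
  by (induction rule: lin_terms.induct) (auto intro: lin_terms.intros tsym_twist)

lemma ttw_rels:
  assumes "(s, t) \<in> multilinear_rels K V n"
  shows "(ttw s, ttw t) \<in> multilinear_rels K V n"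
proof -
  let ?f = "map (twist V)"
  from assms consider
      (add) xs ys x y where "s = LGen (xs @ (x \<oplus>\<^bsub>V\<^esub> y) # ys)"
        "t = LAdd (LGen (xs @ x # ys)) (LGen (xs @ y # ys))" "xs @ x # ys \<in> tsym n" "y \<in> carrier V"
    | (smult) xs ys x c where "s = LGen (xs @ (c \<odot>\<^bsub>V\<^esub> x) # ys)"
        "t = LSmult c (LGen (xs @ x # ys))" "xs @ x # ys \<in> tsym n" "c \<in> carrier K"
    unfolding multilinear_rels_def by blast
  then show ?thesis
  proof cases
    case add
    then have "x \<in> carrier V" by (auto simp: tensor_symbols_def)
    then have "ttw s = LGen (?f xs @ (twist V x \<oplus>\<^bsub>V\<^esub> twist V y) # ?f ys)"
      "ttw t = LAdd (LGen (?f xs @ twist V x # ?f ys)) (LGen (?f xs @ twist V y # ?f ys))"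
      using add by (auto simp: twist_add)
    moreover have "?f xs @ twist V x # ?f ys \<in> tsym n" using tsym_twist[OF add(3)] by simp
    ultimately show ?thesis
      using add(4) twist_closed unfolding multilinear_rels_def by blast
  next
    case smult
    then have "x \<in> carrier V" by (auto simp: tensor_symbols_def)
    then have "ttw s = LGen (?f xs @ (c \<odot>\<^bsub>V\<^esub> twist V x) # ?f ys)"
      "ttw t = LSmult c (LGen (?f xs @ twist V x # ?f ys))"
      using smult by (auto simp: twist_smult)
    moreover have "?f xs @ twist V x # ?f ys \<in> tsym n" using tsym_twist[OF smult(3)] by simp
    ultimately show ?thesis using smult(4) unfolding multilinear_rels_def by blast
  qed
qed

lemma ttw_cong: "(s, t) \<in> tensor_cong K V n \<Longrightarrow> (ttw s, ttw t) \<in> tensor_cong K V n"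
  unfolding tensor_cong_def
proof (induction rule: lin_cong.induct)
  case (relation s t)
  then show ?case by (intro lin_cong.relation ttw_rels ttw_terms)
next
  case (sym s t)
  then show ?case by (metis lin_cong.sym)
next
  case (trans s t u)
  then show ?case by (metis lin_cong.trans)
next
  case (cong_add s s' t t')
  then show ?case by (simp add: lin_cong.cong_add)
next
  case (cong_smult c t t')
  then show ?case by (simp add: lin_cong.cong_smult)
qed (simp_all add: ttw_terms lin_cong.refl lin_cong.add_assoc lin_cong.add_comm
      lin_cong.add_zero lin_cong.add_inv lin_cong.smult_add_left lin_cong.smult_add_right
      lin_cong.smult_smult lin_cong.smult_one)

lemma tensor_power_ops:
  shows "carrier (tpow n) = tcls n ` lin_terms K (tsym n)"
    and "\<zero>\<^bsub>tpow n\<^esub> = tcls n LZero"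
    and "\<lbrakk>s \<in> lin_terms K (tsym n); t \<in> lin_terms K (tsym n)\<rbrakk>
      \<Longrightarrow> tcls n s \<oplus>\<^bsub>tpow n\<^esub> tcls n t = tcls n (LAdd s t)"
    and "\<lbrakk>c \<in> carrier K; t \<in> lin_terms K (tsym n)\<rbrakk> \<Longrightarrow> c \<odot>\<^bsub>tpow n\<^esub> tcls n t = tcls n (LSmult c t)"
    and "t \<in> lin_terms K (tsym n) \<Longrightarrow> twist (tpow n) (tcls n t) = tcls n (ttw t)"
proof -
  have cong_add: "(LAdd s t, LAdd s' t') \<in> tensor_cong K V n"
    if "(s, s') \<in> tensor_cong K V n" "(t, t') \<in> tensor_cong K V n" for s s' t t'
    using that unfolding tensor_cong_def by (rule lin_cong.cong_add)
  have cong_smult: "(LSmult c t, LSmult c t') \<in> tensor_cong K V n"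
    if "c \<in> carrier K" "(t, t') \<in> tensor_cong K V n" for c t t'
    using that unfolding tensor_cong_def by (rule lin_cong.cong_smult)
  show "carrier (tpow n) = tcls n ` lin_terms K (tsym n)" "\<zero>\<^bsub>tpow n\<^esub> = tcls n LZero"
    by (auto simp: tensor_power_def Let_def quotient_def)
  show "tcls n s \<oplus>\<^bsub>tpow n\<^esub> tcls n t = tcls n (LAdd s t)"
    if "s \<in> lin_terms K (tsym n)" "t \<in> lin_terms K (tsym n)"
    using UN_class2[OF tensor_cong_equiv that cong_add] by (simp add: tensor_power_def Let_def)
  show "c \<odot>\<^bsub>tpow n\<^esub> tcls n t = tcls n (LSmult c t)" if "c \<in> carrier K" "t \<in> lin_terms K (tsym n)"
    using UN_class[OF tensor_cong_equiv that(2) cong_smult[OF that(1)]] by (simp add: tensor_power_def Let_def)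
  show "twist (tpow n) (tcls n t) = tcls n (ttw t)" if "t \<in> lin_terms K (tsym n)"
    using UN_class[OF tensor_cong_equiv that ttw_cong] by (simp add: tensor_power_def Let_def ttw_def)
qed

lemma tensor_power_hom_vector_space: "hom_vector_space K (tpow n)"
  by (rule hom_vector_space_image[where cl = "tcls n" and T = "lin_terms K (tsym n)"
        and z = LZero and ad = LAdd and sm = LSmult and tw = ttw])
    (simp_all add: field_axioms tensor_power_ops lin_terms.intros tcls_eq_iff ttw_terms,
      simp_all add: tensor_cong_def lin_terms.intros ttw_terms lin_cong.refl lin_cong.add_assoc lin_cong.add_comm
      lin_cong.add_zero lin_cong.add_inv lin_cong.smult_add_left lin_cong.smult_add_right
      lin_cong.smult_smult lin_cong.smult_one)

lemma pure_tensor_class: "xs \<in> tsym n \<Longrightarrow> pure_tensor K V xs = tcls n (LGen xs)"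
  by (simp add: pure_tensor_def tensor_symbols_def)

lemma pure_tensor_closed [simp]: "xs \<in> tsym n \<Longrightarrow> pure_tensor K V xs \<in> carrier (tpow n)"
  by (simp add: pure_tensor_class tensor_power_ops lin_terms.intros)

lemma pure_tensor_add:
  assumes "xs @ x # ys \<in> tsym n" "y \<in> carrier V"
  shows "pure_tensor K V (xs @ (x \<oplus>\<^bsub>V\<^esub> y) # ys)
    = pure_tensor K V (xs @ x # ys) \<oplus>\<^bsub>tpow n\<^esub> pure_tensor K V (xs @ y # ys)"
proof -
  have sym: "xs @ (x \<oplus>\<^bsub>V\<^esub> y) # ys \<in> tsym n" "xs @ y # ys \<in> tsym n"
    using assms by (auto simp: tensor_symbols_def)
  have "(LGen (xs @ (x \<oplus>\<^bsub>V\<^esub> y) # ys), LAdd (LGen (xs @ x # ys)) (LGen (xs @ y # ys))) \<in> tensor_cong K V n"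
    unfolding tensor_cong_def using assms sym
    by (intro lin_cong.relation lin_terms.intros) (auto simp: multilinear_rels_def)
  then show ?thesis using assms sym
    by (simp add: pure_tensor_class tensor_power_ops lin_terms.intros tcls_eq_iff)
qed

lemma pure_tensor_smult:
  assumes "xs @ x # ys \<in> tsym n" "c \<in> carrier K"
  shows "pure_tensor K V (xs @ (c \<odot>\<^bsub>V\<^esub> x) # ys) = c \<odot>\<^bsub>tpow n\<^esub> pure_tensor K V (xs @ x # ys)"
proof -
  have sym: "xs @ (c \<odot>\<^bsub>V\<^esub> x) # ys \<in> tsym n"
    using assms by (auto simp: tensor_symbols_def)
  have "(LGen (xs @ (c \<odot>\<^bsub>V\<^esub> x) # ys), LSmult c (LGen (xs @ x # ys))) \<in> tensor_cong K V n"
    unfolding tensor_cong_def using assms sym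
    by (intro lin_cong.relation lin_terms.intros) (auto simp: multilinear_rels_def)
  then show ?thesis using assms sym
    by (simp add: pure_tensor_class tensor_power_ops lin_terms.intros tcls_eq_iff)
qed

lemma pure_tensor_twist:
  "xs \<in> tsym n \<Longrightarrow> twist (tpow n) (pure_tensor K V xs) = pure_tensor K V (map (twist V) xs)"
  using tsym_twist[of xs n] by (simp add: pure_tensor_class tensor_power_ops lin_terms.intros)

lemma pure_tensor_span:
  assumes D: "submodule D K (tpow n)" and gen: "\<And>xs. xs \<in> tsym n \<Longrightarrow> pure_tensor K V xs \<in> D"
  shows "carrier (tpow n) \<subseteq> D"
proof
  interpret T: hom_vector_space K "tpow n" by (rule tensor_power_hom_vector_space)
  fix u assume "u \<in> carrier (tpow n)"
  then obtain t where t: "t \<in> lin_terms K (tsym n)" "u = tcls n t" by (auto simp: tensor_power_ops)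
  have "tcls n t \<in> D" using t(1)
  proof induction
    case (1 xs)
    then show ?case using gen by (simp add: pure_tensor_class)
  next
    case 2
    show ?case using T.submodule_zero[OF D] by (simp add: tensor_power_ops)
  next
    case (3 s t)
    then show ?case using T.submoduleE(5)[OF D] by (simp add: tensor_power_ops(3)[symmetric])
  next
    case (4 c t)
    then show ?case using T.submoduleE(4)[OF D] by (simp add: tensor_power_ops(4)[symmetric])
  qed
  with t show "u \<in> D" by simp
qed

lemma pure_tensor_ext:
  assumes "hom_vector_space K W" "f \<in> hs_hom K (tpow n) W" "g \<in> hs_hom K (tpow n) W"
    and "\<And>xs. xs \<in> tsym n \<Longrightarrow> f (pure_tensor K V xs) = g (pure_tensor K V xs)"
    and "u \<in> carrier (tpow n)"
  shows "f u = g u"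
proof -
  interpret T: hom_vector_space K "tpow n" by (rule tensor_power_hom_vector_space)
  have "carrier (tpow n) \<subseteq> {u \<in> carrier (tpow n). f u = g u}"
    using assms(4) by (intro pure_tensor_span T.equalizer_submodule[OF assms(1-3)]) auto
  with assms(5) show ?thesis by auto
qed

lemma tensor_universal:
  assumes W: "hom_vector_space K W"
    and closed: "\<And>xs. xs \<in> tsym n \<Longrightarrow> \<phi> xs \<in> carrier W"
    and add: "\<And>xs ys x y. \<lbrakk>xs @ x # ys \<in> tsym n; y \<in> carrier V\<rbrakk>
      \<Longrightarrow> \<phi> (xs @ (x \<oplus>\<^bsub>V\<^esub> y) # ys) = \<phi> (xs @ x # ys) \<oplus>\<^bsub>W\<^esub> \<phi> (xs @ y # ys)"
    and smult: "\<And>xs ys x c. \<lbrakk>xs @ x # ys \<in> tsym n; c \<in> carrier K\<rbrakk>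
      \<Longrightarrow> \<phi> (xs @ (c \<odot>\<^bsub>V\<^esub> x) # ys) = c \<odot>\<^bsub>W\<^esub> \<phi> (xs @ x # ys)"
    and tw: "\<And>xs. xs \<in> tsym n \<Longrightarrow> \<phi> (map (twist V) xs) = twist W (\<phi> xs)"
  shows "(\<lambda>A. the_elem (lin_eval W \<phi> ` A)) \<in> hs_hom K (tpow n) W"
    and "\<And>xs. xs \<in> tsym n \<Longrightarrow> the_elem (lin_eval W \<phi> ` pure_tensor K V xs) = \<phi> xs"
proof -
  interpret W: hom_vector_space K W by fact
  have cl: "lin_eval W \<phi> t \<in> carrier W" if "t \<in> lin_terms K (tsym n)" for t
    using that by induction (auto simp: closed)
  have twl: "lin_eval W \<phi> (ttw t) = twist W (lin_eval W \<phi> t)" if "t \<in> lin_terms K (tsym n)" for t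
    using that by induction (auto simp: tw cl W.twist_add W.twist_smult)
  have rel: "lin_eval W \<phi> s = lin_eval W \<phi> t" if "(s, t) \<in> multilinear_rels K V n" for s t
    using that by (auto simp: multilinear_rels_def add smult)
  have ev: "lin_eval W \<phi> s = lin_eval W \<phi> t" if "(t, s) \<in> tensor_cong K V n" for s t
  proof -
    have "lin_eval W \<phi> t = lin_eval W \<phi> s"
      using that unfolding tensor_cong_def
    proof induction
      case (relation s t)
      then show ?case by (intro rel)
    next
      case (add_comm s t)
      then show ?case by (simp add: cl W.M.a_comm)
    qed (auto simp: cl W.M.a_assoc W.minus_one_smult W.M.r_neg W.smult_l_distr W.smult_r_distr
        W.smult_assoc1)
    then show ?thesis by simp
  qed
  have val: "the_elem (lin_eval W \<phi> ` tcls n t) = lin_eval W \<phi> t" if "t \<in> lin_terms K (tsym n)" for t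
  proof (rule the_elem_image)
    have "(t, t) \<in> tensor_cong K V n" using that by (simp add: tensor_cong_def lin_cong.refl)
    then show "tcls n t \<noteq> {}" by blast
  qed (rule ev, simp)
  show "(\<lambda>A. the_elem (lin_eval W \<phi> ` A)) \<in> hs_hom K (tpow n) W"
    by (rule hs_homI) (auto simp: tensor_power_ops val lin_terms.intros cl ttw_terms twl)
  show "the_elem (lin_eval W \<phi> ` pure_tensor K V xs) = \<phi> xs" if "xs \<in> tsym n" for xs
    using that by (simp add: pure_tensor_class val lin_terms.intros)
qed

lemma tsym_1: "xs \<in> tsym 1 \<longleftrightarrow> (\<exists>x\<in>carrier V. xs = [x])"
  by (auto simp: tensor_symbols_def length_Suc_conv)

lemma tsym_2: "xs \<in> tsym 2 \<longleftrightarrow> (\<exists>x\<in>carrier V. \<exists>y\<in>carrier V. xs = [x, y])"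
  by (auto simp: tensor_symbols_def length_Suc_conv numeral_2_eq_2)

lemma tsym_3: "xs \<in> tsym 3 \<longleftrightarrow> (\<exists>x\<in>carrier V. \<exists>y\<in>carrier V. \<exists>z\<in>carrier V. xs = [x, y, z])"
  by (auto simp: tensor_symbols_def length_Suc_conv numeral_3_eq_3)

end

definition hs_iso ::
  "('k, 'z) ring_scheme \<Rightarrow> ('k, 'a, 'm) hom_space_scheme \<Rightarrow> ('k, 'b, 'n) hom_space_scheme \<Rightarrow> ('a \<Rightarrow> 'b) \<Rightarrow> bool"
  where "hs_iso K V W f \<longleftrightarrow> hs_map K V W f \<and> bij_betw f (carrier V) (carrier W)"

lemma hs_iso_id: "hom_vector_space K V \<Longrightarrow> hs_iso K V V (\<lambda>x. x)"
  by (simp add: hs_iso_def hs_hom_id bij_betw_def hs_mapI)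

lemma hs_iso_hom: "hs_iso K V W f \<Longrightarrow> f \<in> hs_hom K V W"
  by (simp add: hs_iso_def hs_map_def hs_map_axioms_def)

lemma hs_iso_inverse:
  assumes f: "hs_iso K V W f"
  shows "hs_iso K W V (inv_into (carrier V) f)"
proof -
  interpret f: hs_map K V W f using f by (simp add: hs_iso_def)
  let ?h = "inv_into (carrier V) f"
  have bij: "inj_on f (carrier V)" "f ` carrier V = carrier W"
    using f by (auto simp: hs_iso_def bij_betw_def)
  have h: "?h (f x) = x" if "x \<in> carrier V" for x using bij(1) that by simp
  have lift: "\<exists>x. x \<in> carrier V \<and> y = f x" if "y \<in> carrier W" for y
    using that unfolding bij(2)[symmetric] by blast
  have "?h \<in> hs_hom K W V"
  proof (rule hs_homI)
    fix y assume "y \<in> carrier W"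
    then obtain x where x: "x \<in> carrier V" "y = f x" using lift by blast
    show "?h y \<in> carrier V" using x h by simp
    show "?h (twist W y) = twist V (?h y)" using x h by (simp add: f.tw[symmetric])
    show "?h (c \<odot>\<^bsub>W\<^esub> y) = c \<odot>\<^bsub>V\<^esub> ?h y" if "c \<in> carrier K" for c
      using x h that by (simp add: f.smult[symmetric])
    fix y' assume "y' \<in> carrier W"
    then obtain x' where "x' \<in> carrier V" "y' = f x'" using lift by blast
    then show "?h (y \<oplus>\<^bsub>W\<^esub> y') = ?h y \<oplus>\<^bsub>V\<^esub> ?h y'" using x h by (simp add: f.add[symmetric])
  qed
  then have "hs_map K W V ?h"
    by (rule hs_mapI[OF f.W.vs f.V.vs])
  then show ?thesis
    using f bij_betw_inv_into unfolding hs_iso_def by blast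
qed

text \<open>The isomorphism is directed from \<open>W\<close> to the quotient, the direction in which the homology
  spaces replace the kernels and cokernels of \<open>\<lambda>\<close>.\<close>

lemma quotient_iso:
  assumes "hs_map K V W u" and onto: "u ` carrier V = carrier W"
  shows "\<exists>\<Phi>. hs_iso K W (hs_quot V (a_kernel V W u)) \<Phi>"
proof -
  interpret u: hs_map K V W u by fact
  let ?B = "a_kernel V W u"
  interpret Q: subspace_quotient K V ?B "hs_quot V ?B"
    by (rule subspace_quotient_hs_quot[OF u.V.vs u.kernel_subspace])
  have ker: "u b = \<zero>\<^bsub>W\<^esub>" if "b \<in> ?B" for b using that by (simp add: a_kernel_def')
  note desc = Q.descend[OF u.W.vs u.hs ker]
  let ?\<Phi> = "\<lambda>A. the_elem (u ` A)"
  have "inj_on ?\<Phi> (carrier (hs_quot V ?B))"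
  proof (rule inj_onI)
    fix A A' assume "A \<in> carrier (hs_quot V ?B)" "A' \<in> carrier (hs_quot V ?B)" and eq: "?\<Phi> A = ?\<Phi> A'"
    then obtain x y where xy: "x \<in> carrier V" "y \<in> carrier V" "A = ?B +>\<^bsub>V\<^esub> x" "A' = ?B +>\<^bsub>V\<^esub> y"
      unfolding Q.carrier_Q by blast
    then have "u x = u y" using eq by (simp add: desc(2))
    then have "x \<ominus>\<^bsub>V\<^esub> y \<in> ?B" using xy by (simp add: a_kernel_def' u.diff)
    with xy show "A = A'" by (simp add: Q.coset_eq_iff)
  qed
  moreover have "?\<Phi> ` carrier (hs_quot V ?B) = carrier W"
    unfolding Q.carrier_Q onto[symmetric] by (auto simp: desc(2) image_image)
  moreover have "hs_map K (hs_quot V ?B) W ?\<Phi>"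
    by (rule hs_mapI[OF Q.quotient_hom_vector_space u.W.vs desc(1)])
  ultimately have "hs_iso K (hs_quot V ?B) W ?\<Phi>"
    by (simp add: hs_iso_def bij_betw_def)
  then show ?thesis using hs_iso_inverse by blast
qed

text \<open>The degree 1 has to survive simplification, as it occurs in \<open>tensor_power K L 1\<close>.\<close>

declare One_nat_def [simp del]

context hom_leibniz
begin

interpretation W: leibniz_ideal K L "carrier L"
  using hom_leibniz_axioms whole_ideal by (simp add: leibniz_ideal_def leibniz_ideal_axioms_def)
interpretation T0: hom_vector_space K "tensor_power K L 0" by (rule tensor_power_hom_vector_space)
interpretation T1: hom_vector_space K "tensor_power K L 1" by (rule tensor_power_hom_vector_space)
interpretation T2: hom_vector_space K "tensor_power K L 2" by (rule tensor_power_hom_vector_space)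
interpretation T3: hom_vector_space K "tensor_power K L 3" by (rule tensor_power_hom_vector_space)

abbreviation (input) "T n \<equiv> tensor_power K L n"
abbreviation (input) "p xs \<equiv> pure_tensor K L xs"

lemma pure_closed [simp]:
  "x \<in> carrier L \<Longrightarrow> p [x] \<in> carrier (T 1)"
  "\<lbrakk>x \<in> carrier L; y \<in> carrier L\<rbrakk> \<Longrightarrow> p [x, y] \<in> carrier (T 2)"
  "\<lbrakk>x \<in> carrier L; y \<in> carrier L; z \<in> carrier L\<rbrakk> \<Longrightarrow> p [x, y, z] \<in> carrier (T 3)"
  using pure_tensor_closed[of "[x]" 1] pure_tensor_closed[of "[x, y]" 2]
    pure_tensor_closed[of "[x, y, z]" 3]
  by (simp_all add: tsym_1 tsym_2 tsym_3)

lemma pure_add: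
  "\<lbrakk>x \<in> carrier L; x' \<in> carrier L\<rbrakk> \<Longrightarrow> p [x \<oplus>\<^bsub>L\<^esub> x'] = p [x] \<oplus>\<^bsub>T 1\<^esub> p [x']"
  "\<lbrakk>x \<in> carrier L; x' \<in> carrier L; y \<in> carrier L\<rbrakk> \<Longrightarrow> p [x \<oplus>\<^bsub>L\<^esub> x', y] = p [x, y] \<oplus>\<^bsub>T 2\<^esub> p [x', y]"
  "\<lbrakk>x \<in> carrier L; y \<in> carrier L; y' \<in> carrier L\<rbrakk> \<Longrightarrow> p [x, y \<oplus>\<^bsub>L\<^esub> y'] = p [x, y] \<oplus>\<^bsub>T 2\<^esub> p [x, y']"
  using pure_tensor_add[of "[]" x "[]" 1 x'] pure_tensor_add[of "[]" x "[y]" 2 x']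
    pure_tensor_add[of "[x]" y "[]" 2 y']
  by (simp_all add: tsym_1 tsym_2)

lemma pure_smult:
  "\<lbrakk>c \<in> carrier K; x \<in> carrier L\<rbrakk> \<Longrightarrow> p [c \<odot>\<^bsub>L\<^esub> x] = c \<odot>\<^bsub>T 1\<^esub> p [x]"
  "\<lbrakk>c \<in> carrier K; x \<in> carrier L; y \<in> carrier L\<rbrakk> \<Longrightarrow> p [c \<odot>\<^bsub>L\<^esub> x, y] = c \<odot>\<^bsub>T 2\<^esub> p [x, y]"
  "\<lbrakk>c \<in> carrier K; x \<in> carrier L; y \<in> carrier L\<rbrakk> \<Longrightarrow> p [x, c \<odot>\<^bsub>L\<^esub> y] = c \<odot>\<^bsub>T 2\<^esub> p [x, y]"
  using pure_tensor_smult[of "[]" x "[]" 1 c] pure_tensor_smult[of "[]" x "[y]" 2 c]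
    pure_tensor_smult[of "[x]" y "[]" 2 c]
  by (simp_all add: tsym_1 tsym_2)

lemma pure_twist:
  "x \<in> carrier L \<Longrightarrow> twist (T 1) (p [x]) = p [twist L x]"
  "\<lbrakk>x \<in> carrier L; y \<in> carrier L\<rbrakk> \<Longrightarrow> twist (T 2) (p [x, y]) = p [twist L x, twist L y]"
  using pure_tensor_twist[of "[x]" 1] pure_tensor_twist[of "[x, y]" 2] by (simp_all add: tsym_1 tsym_2)

lemma tsym_split1:
  "xs @ x # ys \<in> tensor_symbols L 1 \<longleftrightarrow> x \<in> carrier L \<and> xs = [] \<and> ys = []"
  by (auto simp: tensor_symbols_def)

lemma tsym_split2:
  assumes "xs @ x # ys \<in> tensor_symbols L 2"
  obtains b where "x \<in> carrier L" "b \<in> carrier L" "xs = []" "ys = [b]"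
    | a where "x \<in> carrier L" "a \<in> carrier L" "xs = [a]" "ys = []"
  using assms by (cases xs; cases ys) (auto simp: tensor_symbols_def)

lemma tsym_split3:
  assumes "xs @ x # ys \<in> tensor_symbols L 3"
  obtains b c where "x \<in> carrier L" "b \<in> carrier L" "c \<in> carrier L" "xs = []" "ys = [b, c]"
    | a c where "x \<in> carrier L" "a \<in> carrier L" "c \<in> carrier L" "xs = [a]" "ys = [c]"
    | a b where "x \<in> carrier L" "a \<in> carrier L" "b \<in> carrier L" "xs = [a, b]" "ys = []"
proof -
  from assms have "length xs + length ys = 2" by (simp add: tensor_symbols_def)
  then have "length xs = 0 \<and> length ys = 2 \<or> length xs = 1 \<and> length ys = 1
      \<or> length xs = 2 \<and> length ys = 0"
    by linarith
  then show ?thesis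
    using assms that
    by (auto simp: tensor_symbols_def length_Suc_conv numeral_2_eq_2 One_nat_def)
qed

lemma leibniz_d_pure_2:
  assumes "x \<in> carrier L" "y \<in> carrier L"
  shows "leibniz_d_pure K L 2 [x, y] = \<ominus>\<^bsub>T 1\<^esub> p [\<langle>x, y\<rangle>\<^bsub>L\<^esub>]"
proof -
  have pairs: "{(i, j). i < j \<and> j < (2::nat)} = {(0, 1)}" by auto
  have nat: "(2::nat) - 1 = 1" "[0..<2] = [0, 1::nat]"
    by (simp_all add: upt_rec One_nat_def)
  define f where "f = (\<lambda>(i, j). ((\<ominus> \<one>) [^] j) \<odot>\<^bsub>T 1\<^esub>
    p (map (\<lambda>l. if l = i then \<langle>[x, y] ! i, [x, y] ! j\<rangle>\<^bsub>L\<^esub> else twist L ([x, y] ! l)) (filter (\<lambda>l. l \<noteq> j) [0, 1])))"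
  have one: "(\<ominus> \<one>) [^] (1::nat) = \<ominus> \<one>"
    by (simp add: One_nat_def)
  have f: "f (0, 1) = \<ominus>\<^bsub>T 1\<^esub> p [\<langle>x, y\<rangle>\<^bsub>L\<^esub>]"
    using assms by (simp add: f_def T1.minus_one_smult one)
  have "leibniz_d_pure K L 2 [x, y] = finsum (T 1) f {(0, 1)}"
    unfolding leibniz_d_pure_def nat pairs f_def ..
  also have "\<dots> = f (0, 1) \<oplus>\<^bsub>T 1\<^esub> finsum (T 1) f {}"
    by (rule T1.M.finsum_insert) (use assms in \<open>auto simp: f\<close>)
  finally show ?thesis using assms by (simp add: f)
qed

lemma leibniz_d_pure_3:
  assumes "x \<in> carrier L" "y \<in> carrier L" "z \<in> carrier L"
  shows "leibniz_d_pure K L 3 [x, y, z]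
    = \<ominus>\<^bsub>T 2\<^esub> p [\<langle>x, y\<rangle>\<^bsub>L\<^esub>, twist L z] \<oplus>\<^bsub>T 2\<^esub>
      (p [\<langle>x, z\<rangle>\<^bsub>L\<^esub>, twist L y] \<oplus>\<^bsub>T 2\<^esub> p [twist L x, \<langle>y, z\<rangle>\<^bsub>L\<^esub>])"
proof -
  have pairs: "{(i, j). i < j \<and> j < (3::nat)} = {(0, 1), (0, 2), (1, 2)}" by auto
  have nat: "(3::nat) - 1 = 2" "[0..<3] = [0, 1, 2::nat]"
    by (simp_all add: upt_rec One_nat_def numeral_2_eq_2)
  define f where "f = (\<lambda>(i, j). ((\<ominus> \<one>) [^] j) \<odot>\<^bsub>T 2\<^esub>
    p (map (\<lambda>l. if l = i then \<langle>[x, y, z] ! i, [x, y, z] ! j\<rangle>\<^bsub>L\<^esub> else twist L ([x, y, z] ! l))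
      (filter (\<lambda>l. l \<noteq> j) [0, 1, 2])))"
  have sq: "(\<ominus> \<one>) [^] (2::nat) = \<one>"
    by (simp add: numeral_2_eq_2 l_minus)
  have one: "(\<ominus> \<one>) [^] (1::nat) = \<ominus> \<one>"
    by (simp add: One_nat_def)
  have f: "f (0, 1) = \<ominus>\<^bsub>T 2\<^esub> p [\<langle>x, y\<rangle>\<^bsub>L\<^esub>, twist L z]" "f (0, 2) = p [\<langle>x, z\<rangle>\<^bsub>L\<^esub>, twist L y]"
    "f (1, 2) = p [twist L x, \<langle>y, z\<rangle>\<^bsub>L\<^esub>]"
    using assms by (simp_all add: f_def T2.minus_one_smult one sq)
  have "leibniz_d_pure K L 3 [x, y, z] = finsum (T 2) f {(0, 1), (0, 2), (1, 2)}"
    unfolding leibniz_d_pure_def nat pairs f_def ..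
  also have "\<dots> = f (0, 1) \<oplus>\<^bsub>T 2\<^esub> finsum (T 2) f {(0, 2), (1, 2)}"
    by (rule T2.M.finsum_insert) (use assms in \<open>auto simp: f\<close>)
  also have "finsum (T 2) f {(0, 2), (1, 2)} = f (0, 2) \<oplus>\<^bsub>T 2\<^esub> finsum (T 2) f {(1, 2)}"
    by (rule T2.M.finsum_insert) (use assms in \<open>auto simp: f\<close>)
  also have "finsum (T 2) f {(1, 2)} = f (1, 2) \<oplus>\<^bsub>T 2\<^esub> finsum (T 2) f {}"
    by (rule T2.M.finsum_insert) (use assms in \<open>auto simp: f\<close>)
  finally show ?thesis using assms by (simp add: f)
qed

lemma leibniz_d_1: "A \<in> carrier (T 1) \<Longrightarrow> leibniz_d K L 1 A = \<zero>\<^bsub>T 0\<^esub>"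
proof -
  have pairs: "{(i, j). i < j \<and> j < (1::nat)} = {}" by auto
  have zero: "leibniz_d_pure K L 1 xs = \<zero>\<^bsub>T 0\<^esub>" for xs
    unfolding leibniz_d_pure_def pairs by simp
  have hom: "leibniz_d K L 1 \<in> hs_hom K (T 1) (T 0)"
    and val: "\<And>xs. xs \<in> tensor_symbols L 1 \<Longrightarrow> leibniz_d K L 1 (p xs) = \<zero>\<^bsub>T 0\<^esub>"
    using tensor_universal[OF T0.vs, of 1 "leibniz_d_pure K L 1"]
    unfolding leibniz_d_def[abs_def] by (simp_all add: zero)
  assume A: "A \<in> carrier (T 1)"
  show ?thesis
    by (rule pure_tensor_ext[OF T0.vs hom T0.hs_hom_zero _ A]) (rule val)
qed

lemma leibniz_d_2:
  "leibniz_d K L 2 \<in> hs_hom K (T 2) (T 1)"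
  "\<lbrakk>x \<in> carrier L; y \<in> carrier L\<rbrakk> \<Longrightarrow> leibniz_d K L 2 (p [x, y]) = \<ominus>\<^bsub>T 1\<^esub> p [\<langle>x, y\<rangle>\<^bsub>L\<^esub>]"
proof -
  let ?\<phi> = "leibniz_d_pure K L 2"
  note simps = leibniz_d_pure_2 pure_add pure_smult bracket_add_left bracket_add_right bracket_smult_left
    bracket_smult_right T1.M.minus_add T1.smult_r_minus T1.twist_neg pure_twist twist_bracket
  have closed: "\<And>xs. xs \<in> tensor_symbols L 2 \<Longrightarrow> ?\<phi> xs \<in> carrier (T 1)"
    by (auto simp: tsym_2 leibniz_d_pure_2)
  have tw: "\<And>xs. xs \<in> tensor_symbols L 2 \<Longrightarrow> ?\<phi> (map (twist L) xs) = twist (T 1) (?\<phi> xs)"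
    by (auto simp: tsym_2 simps)
  have add: "?\<phi> (xs @ (x \<oplus>\<^bsub>L\<^esub> y) # ys) = ?\<phi> (xs @ x # ys) \<oplus>\<^bsub>T 1\<^esub> ?\<phi> (xs @ y # ys)"
    if "xs @ x # ys \<in> tensor_symbols L 2" "y \<in> carrier L" for xs x ys y
    using that(1) by (cases rule: tsym_split2) (use that(2) in \<open>simp_all add: simps\<close>)
  have smult: "?\<phi> (xs @ (c \<odot>\<^bsub>L\<^esub> x) # ys) = c \<odot>\<^bsub>T 1\<^esub> ?\<phi> (xs @ x # ys)"
    if "xs @ x # ys \<in> tensor_symbols L 2" "c \<in> carrier K" for xs x ys c
    using that(1) by (cases rule: tsym_split2) (use that(2) in \<open>simp_all add: simps\<close>)
  note U = tensor_universal[where n = 2, OF T1.vs closed add smult tw]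
  have d: "leibniz_d K L 2 = (\<lambda>A. the_elem (lin_eval (T 1) ?\<phi> ` A))"
    by (simp add: leibniz_d_def[abs_def] One_nat_def numeral_2_eq_2)
  show "leibniz_d K L 2 \<in> hs_hom K (T 2) (T 1)"
    "\<lbrakk>x \<in> carrier L; y \<in> carrier L\<rbrakk> \<Longrightarrow> leibniz_d K L 2 (p [x, y]) = \<ominus>\<^bsub>T 1\<^esub> p [\<langle>x, y\<rangle>\<^bsub>L\<^esub>]"
    unfolding d using U(1) U(2) by (simp_all add: tsym_2 leibniz_d_pure_2)
qed

lemma leibniz_d_3:
  "leibniz_d K L 3 \<in> hs_hom K (T 3) (T 2)"
  "\<lbrakk>x \<in> carrier L; y \<in> carrier L; z \<in> carrier L\<rbrakk> \<Longrightarrow> leibniz_d K L 3 (p [x, y, z])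
    = \<ominus>\<^bsub>T 2\<^esub> p [\<langle>x, y\<rangle>\<^bsub>L\<^esub>, twist L z] \<oplus>\<^bsub>T 2\<^esub>
      (p [\<langle>x, z\<rangle>\<^bsub>L\<^esub>, twist L y] \<oplus>\<^bsub>T 2\<^esub> p [twist L x, \<langle>y, z\<rangle>\<^bsub>L\<^esub>])"
proof -
  let ?\<phi> = "leibniz_d_pure K L 3"
  note simps = leibniz_d_pure_3 pure_add pure_smult bracket_add_left bracket_add_right bracket_smult_left
    bracket_smult_right T2.M.minus_add T2.smult_r_minus T2.smult_r_distr T2.twist_neg T2.twist_add
    pure_twist twist_bracket twist_add twist_smult
  have closed: "\<And>xs. xs \<in> tensor_symbols L 3 \<Longrightarrow> ?\<phi> xs \<in> carrier (T 2)"
    by (auto simp: tsym_3 leibniz_d_pure_3)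
  have tw: "\<And>xs. xs \<in> tensor_symbols L 3 \<Longrightarrow> ?\<phi> (map (twist L) xs) = twist (T 2) (?\<phi> xs)"
    by (auto simp: tsym_3 simps)
  have add: "?\<phi> (xs @ (x \<oplus>\<^bsub>L\<^esub> y) # ys) = ?\<phi> (xs @ x # ys) \<oplus>\<^bsub>T 2\<^esub> ?\<phi> (xs @ y # ys)"
    if "xs @ x # ys \<in> tensor_symbols L 3" "y \<in> carrier L" for xs x ys y
    using that(1) by (cases rule: tsym_split3) (use that(2) in \<open>simp_all add: simps T2.M.a_ac\<close>)
  have smult: "?\<phi> (xs @ (c \<odot>\<^bsub>L\<^esub> x) # ys) = c \<odot>\<^bsub>T 2\<^esub> ?\<phi> (xs @ x # ys)"
    if "xs @ x # ys \<in> tensor_symbols L 3" "c \<in> carrier K" for xs x ys c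
    using that(1) by (cases rule: tsym_split3) (use that(2) in \<open>simp_all add: simps\<close>)
  note U = tensor_universal[where n = 3, OF T2.vs closed add smult tw]
  have d: "leibniz_d K L 3 = (\<lambda>A. the_elem (lin_eval (T 2) ?\<phi> ` A))"
    by (simp add: leibniz_d_def[abs_def] One_nat_def numeral_2_eq_2)
  show "leibniz_d K L 3 \<in> hs_hom K (T 3) (T 2)"
    "\<lbrakk>x \<in> carrier L; y \<in> carrier L; z \<in> carrier L\<rbrakk> \<Longrightarrow> leibniz_d K L 3 (p [x, y, z])
    = \<ominus>\<^bsub>T 2\<^esub> p [\<langle>x, y\<rangle>\<^bsub>L\<^esub>, twist L z] \<oplus>\<^bsub>T 2\<^esub>
      (p [\<langle>x, z\<rangle>\<^bsub>L\<^esub>, twist L y] \<oplus>\<^bsub>T 2\<^esub> p [twist L x, \<langle>y, z\<rangle>\<^bsub>L\<^esub>])"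
    unfolding d using U(1) U(2) by (simp_all add: tsym_3 leibniz_d_pure_3)
qed

lemma tensor_power_1_iso:
  obtains e where "e \<in> hs_hom K (T 1) L" "\<And>x. x \<in> carrier L \<Longrightarrow> e (p [x]) = x"
    "\<And>t. t \<in> carrier (T 1) \<Longrightarrow> p [e t] = t"
proof -
  have closed: "\<And>xs. xs \<in> tensor_symbols L 1 \<Longrightarrow> hd xs \<in> carrier L"
    and tw: "\<And>xs. xs \<in> tensor_symbols L 1 \<Longrightarrow> hd (map (twist L) xs) = twist L (hd xs)"
    by (auto simp: tsym_1)
  have add: "hd (xs @ (x \<oplus>\<^bsub>L\<^esub> y) # ys) = hd (xs @ x # ys) \<oplus>\<^bsub>L\<^esub> hd (xs @ y # ys)"
    if "xs @ x # ys \<in> tensor_symbols L 1" "y \<in> carrier L" for xs x ys y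
    using that by (simp add: tsym_split1)
  have smult: "hd (xs @ (c \<odot>\<^bsub>L\<^esub> x) # ys) = c \<odot>\<^bsub>L\<^esub> hd (xs @ x # ys)"
    if "xs @ x # ys \<in> tensor_symbols L 1" "c \<in> carrier K" for xs x ys c
    using that by (simp add: tsym_split1)
  note U = tensor_universal[where n = 1, OF vs closed add smult tw]
  define e where "e = (\<lambda>A. the_elem (lin_eval L hd ` A))"
  have e: "e \<in> hs_hom K (T 1) L" "e (p [x]) = x" if "x \<in> carrier L" for x
    unfolding e_def using U(1) U(2)[of "[x]"] that by (simp_all add: tsym_1)
  have e_hom: "e \<in> hs_hom K (T 1) L" by (rule e(1)[of "\<zero>\<^bsub>L\<^esub>"]) simp
  have p_hom: "(\<lambda>x. p [x]) \<in> hs_hom K L (T 1)"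
    by (rule hs_homI) (simp_all add: pure_add pure_smult pure_twist)
  have "p [e t] = t" if "t \<in> carrier (T 1)" for t
    by (rule pure_tensor_ext[OF T1.vs hs_hom_comp[OF e_hom p_hom] hs_hom_id _ that])
      (auto simp: tsym_1 e(2))
  with e_hom e(2) show ?thesis by (rule that)
qed

text \<open>The second tensor power maps onto the exterior square. The kernel contains the boundaries by
  the Leibniz rule of the wedge. Conversely, modulo boundaries the tensor \<open>x \<otimes> y\<close> is a pairing, since
  \<open>d\<^sub>3\<close> of \<open>x \<otimes> y \<otimes> z\<close> is its Leibniz rule; so the class of a tensor modulo boundaries can be
  recovered from its image.\<close>

lemma tensor_power_2_exterior:
  obtains u where "u \<in> hs_hom K (T 2) W.ext"
    and "\<And>x y. \<lbrakk>x \<in> carrier L; y \<in> carrier L\<rbrakk> \<Longrightarrow> u (p [x, y]) = wedge K L (carrier L) x y"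
    and "u ` carrier (T 2) = carrier W.ext"
    and "a_kernel (T 2) W.ext u = leibniz_d K L 3 ` carrier (T 3)"
proof -
  define g where "g xs = wedge K L (carrier L) (xs ! 0) (xs ! 1)" for xs
  have g: "g [x, y] = wedge K L (carrier L) x y" for x y by (simp add: g_def One_nat_def)
  note simps = g W.wedge.pair_add_left W.wedge.pair_add_right W.wedge.pair_smult_left
    W.wedge.pair_smult_right W.wedge.pair_twist W.wedge.pair_closed
  have closed: "\<And>xs. xs \<in> tensor_symbols L 2 \<Longrightarrow> g xs \<in> carrier W.ext"
    and tw: "\<And>xs. xs \<in> tensor_symbols L 2 \<Longrightarrow> g (map (twist L) xs) = twist W.ext (g xs)"
    by (auto simp: tsym_2 simps)
  have add: "g (xs @ (x \<oplus>\<^bsub>L\<^esub> y) # ys) = g (xs @ x # ys) \<oplus>\<^bsub>W.ext\<^esub> g (xs @ y # ys)"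
    if "xs @ x # ys \<in> tensor_symbols L 2" "y \<in> carrier L" for xs x ys y
    using that(1) by (cases rule: tsym_split2) (use that(2) in \<open>simp_all add: simps\<close>)
  have smult: "g (xs @ (c \<odot>\<^bsub>L\<^esub> x) # ys) = c \<odot>\<^bsub>W.ext\<^esub> g (xs @ x # ys)"
    if "xs @ x # ys \<in> tensor_symbols L 2" "c \<in> carrier K" for xs x ys c
    using that(1) by (cases rule: tsym_split2) (use that(2) in \<open>simp_all add: simps\<close>)
  note U = tensor_universal[where n = 2, OF W.EV.vs closed add smult tw]
  define u where "u = (\<lambda>A. the_elem (lin_eval W.ext g ` A))"
  have u: "u \<in> hs_hom K (T 2) W.ext" unfolding u_def using U(1) by simp
  have u_p: "u (p [x, y]) = wedge K L (carrier L) x y" if "x \<in> carrier L" "y \<in> carrier L" for x y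
    unfolding u_def using U(2)[of "[x, y]"] that by (simp add: tsym_2 g)
  interpret u: hs_map K "T 2" W.ext u
    by (rule hs_mapI[OF T2.vs W.EV.vs u])
  interpret d3: hs_map K "T 3" "T 2" "leibniz_d K L 3"
    by (rule hs_mapI[OF T3.vs T2.vs leibniz_d_3(1)])
  have "carrier W.ext \<subseteq> u ` carrier (T 2)"
  proof (rule W.wedge_span)
    show "submodule (u ` carrier (T 2)) K W.ext"
      using u.image_subspace[OF T2.whole_subspace] by (simp add: hs_subspace_def)
    show "wedge K L (carrier L) x y \<in> u ` carrier (T 2)" if "x \<in> carrier L" "y \<in> carrier L" for x y
      using that u_p by (metis imageI pure_closed(2))
  qed
  then have onto: "u ` carrier (T 2) = carrier W.ext" by auto
  have ud: "u (leibniz_d K L 3 t) = \<zero>\<^bsub>W.ext\<^esub>" if "t \<in> carrier (T 3)" for t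
  proof (rule pure_tensor_ext[OF W.EV.vs hs_hom_comp[OF leibniz_d_3(1) u] W.EV.hs_hom_zero _ that])
    fix xs assume "xs \<in> tensor_symbols L 3"
    then obtain x y z where xyz: "x \<in> carrier L" "y \<in> carrier L" "z \<in> carrier L" "xs = [x, y, z]"
      by (auto simp: tsym_3)
    let ?w = "wedge K L (carrier L)"
    have "?w (twist L x) \<langle>y, z\<rangle>\<^bsub>L\<^esub> \<oplus>\<^bsub>W.ext\<^esub> ?w \<langle>x, z\<rangle>\<^bsub>L\<^esub> (twist L y) = ?w \<langle>x, y\<rangle>\<^bsub>L\<^esub> (twist L z)"
      using xyz by (intro W.wedge.pair_leibniz) auto
    then show "u (leibniz_d K L 3 (p xs)) = \<zero>\<^bsub>W.ext\<^esub>"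
      using xyz by (simp add: leibniz_d_3 u.add u.neg u_p W.wedge.pair_closed W.EV.M.a_comm W.EV.M.r_neg)
  qed
  let ?B = "leibniz_d K L 3 ` carrier (T 3)"
  have B: "hs_subspace K (T 2) ?B" by (rule d3.image_subspace[OF T3.whole_subspace])
  interpret Q: subspace_quotient K "T 2" ?B "hs_quot (T 2) ?B"
    by (rule subspace_quotient_hs_quot[OF T2.vs B])
  interpret QV: hom_vector_space K "hs_quot (T 2) ?B" by (rule Q.quotient_hom_vector_space)
  define q where "q t = ?B +>\<^bsub>T 2\<^esub> t" for t
  have q_hom: "q \<in> hs_hom K (T 2) (hs_quot (T 2) ?B)"
    unfolding q_def[abs_def] by (rule Q.projection)
  interpret q: hs_map K "T 2" "hs_quot (T 2) ?B" q
    by (rule hs_mapI[OF T2.vs QV.vs q_hom])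
  have "leibniz_pairing K L (carrier L) (hs_quot (T 2) ?B) (\<lambda>x y. q (p [x, y]))"
  proof (intro leibniz_pairing.intro W.leibniz_ideal_axioms QV.vs
      leibniz_pairing_axioms.intro)
    fix x y z assume xyz: "x \<in> carrier L" "y \<in> carrier L" "z \<in> carrier L"
    let ?a = "p [\<langle>x, y\<rangle>\<^bsub>L\<^esub>, twist L z]" and ?b = "p [\<langle>x, z\<rangle>\<^bsub>L\<^esub>, twist L y]" and ?c = "p [twist L x, \<langle>y, z\<rangle>\<^bsub>L\<^esub>]"
    have "leibniz_d K L 3 (p [x, y, z]) = (?c \<oplus>\<^bsub>T 2\<^esub> ?b) \<ominus>\<^bsub>T 2\<^esub> ?a"
      using xyz by (simp add: leibniz_d_3 a_minus_def T2.M.a_ac)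
    moreover have "leibniz_d K L 3 (p [x, y, z]) \<in> ?B" using xyz by (intro imageI pure_closed)
    ultimately have "q (?c \<oplus>\<^bsub>T 2\<^esub> ?b) = q ?a"
      unfolding q_def using xyz by (subst Q.coset_eq_iff) auto
    then show "q ?c \<oplus>\<^bsub>hs_quot (T 2) ?B\<^esub> q ?b = q ?a" using xyz by (simp add: q.add)
  qed (simp_all add: pure_add pure_smult q.add q.smult q.tw[symmetric] pure_twist)
  then obtain f where f: "f \<in> hs_hom K W.ext (hs_quot (T 2) ?B)"
    "\<And>x y. \<lbrakk>x \<in> carrier L; y \<in> carrier L\<rbrakk> \<Longrightarrow> f (wedge K L (carrier L) x y) = q (p [x, y])"
    by (rule leibniz_pairing.wedge_universal) blast
  interpret f: hs_map K W.ext "hs_quot (T 2) ?B" f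
    by (rule hs_mapI[OF W.EV.vs QV.vs f(1)])
  have fu: "f (u t) = q t" if "t \<in> carrier (T 2)" for t
    by (rule pure_tensor_ext[OF QV.vs hs_hom_comp[OF u f(1)] q_hom _ that])
      (auto simp: tsym_2 u_p f(2))
  have "a_kernel (T 2) W.ext u = ?B"
  proof
    show "?B \<subseteq> a_kernel (T 2) W.ext u" using ud by (auto simp: a_kernel_def')
    show "a_kernel (T 2) W.ext u \<subseteq> ?B"
    proof
      fix t assume "t \<in> a_kernel (T 2) W.ext u"
      then have t: "t \<in> carrier (T 2)" "u t = \<zero>\<^bsub>W.ext\<^esub>" by (auto simp: a_kernel_def')
      then have "q t = ?B" using fu[of t] by (simp add: Q.quotient)
      then show "t \<in> ?B" using t unfolding q_def by (simp add: Q.coset_zero_iff)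
    qed
  qed
  with u u_p onto show ?thesis by (rule that)
qed

lemma exterior_map_leibniz_d_2:
  assumes u: "u \<in> hs_hom K (T 2) W.ext"
      "\<And>x y. \<lbrakk>x \<in> carrier L; y \<in> carrier L\<rbrakk> \<Longrightarrow> u (p [x, y]) = wedge K L (carrier L) x y"
    and e: "e \<in> hs_hom K (T 1) L" "\<And>x. x \<in> carrier L \<Longrightarrow> e (p [x]) = x"
    and t: "t \<in> carrier (T 2)"
  shows "exterior_map L (u t) = \<ominus>\<^bsub>L\<^esub> e (leibniz_d K L 2 t)"
proof -
  interpret e: hs_map K "T 1" L e by (rule hs_mapI[OF T1.vs vs e(1)])
  have neg: "(\<lambda>x. \<ominus>\<^bsub>L\<^esub> x) \<in> hs_hom K L L"
    by (rule hs_homI) (simp_all add: minus_add smult_r_minus twist_neg)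
  show ?thesis
    by (rule pure_tensor_ext[OF vs hs_hom_comp[OF u(1) W.exterior_map_hom]
          hs_hom_comp[OF hs_hom_comp[OF leibniz_d_2(1) e(1)] neg] _ t])
      (auto simp: tsym_2 u(2) e(2) W.exterior_map_wedge leibniz_d_2 e.neg)
qed

text \<open>Under \<open>u\<close> the cycles \<open>ker d\<^sub>2\<close> are the preimage of \<open>ker \<lambda>\<close>, as \<open>\<lambda> u = - d\<^sub>2\<close> when the first
  tensor power is identified with \<open>L\<close>; and the boundaries are the kernel of \<open>u\<close>.\<close>

lemma HL_2_iso:
  "\<exists>\<Phi>. hs_iso K (exterior_kernel K L (carrier L) (carrier L)) (HL K L 2) \<Phi>"
proof -
  obtain u where u: "u \<in> hs_hom K (T 2) W.ext"
    "\<And>x y. \<lbrakk>x \<in> carrier L; y \<in> carrier L\<rbrakk> \<Longrightarrow> u (p [x, y]) = wedge K L (carrier L) x y"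
    "u ` carrier (T 2) = carrier W.ext"
    "a_kernel (T 2) W.ext u = leibniz_d K L 3 ` carrier (T 3)"
    by (rule tensor_power_2_exterior) blast
  obtain e where e: "e \<in> hs_hom K (T 1) L" "\<And>x. x \<in> carrier L \<Longrightarrow> e (p [x]) = x"
    "\<And>t. t \<in> carrier (T 1) \<Longrightarrow> p [e t] = t"
    by (rule tensor_power_1_iso) blast
  interpret u: hs_map K "T 2" W.ext u
    by (rule hs_mapI[OF T2.vs W.EV.vs u(1)])
  interpret e: hs_map K "T 1" L e
    by (rule hs_mapI[OF T1.vs vs e(1)])
  interpret d: hs_map K "T 2" "T 1" "leibniz_d K L 2"
    by (rule hs_mapI[OF T2.vs T1.vs leibniz_d_2(1)])
  have "p [\<zero>\<^bsub>L\<^esub>] = \<zero>\<^bsub>T 1\<^esub>" using pure_smult(1)[of "\<zero>" "\<zero>\<^bsub>L\<^esub>"] by simp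
  then have e0: "e t = \<zero>\<^bsub>L\<^esub> \<longleftrightarrow> t = \<zero>\<^bsub>T 1\<^esub>" if "t \<in> carrier (T 1)" for t
    using e(3)[OF that] by auto
  have ker_iff: "exterior_map L (u t) = \<zero>\<^bsub>L\<^esub> \<longleftrightarrow> leibniz_d K L 2 t = \<zero>\<^bsub>T 1\<^esub>" if t: "t \<in> carrier (T 2)" for t
    using exterior_map_leibniz_d_2[OF u(1,2) e(1,2) t] e0[of "leibniz_d K L 2 t"] t
      add_eq_zero_iff[of "\<zero>\<^bsub>L\<^esub>" "e (leibniz_d K L 2 t)"] by auto
  let ?V = "(T 2)\<lparr>carrier := a_kernel (T 2) (T 1) (leibniz_d K L 2)\<rparr>"
  let ?E = "exterior_kernel K L (carrier L) (carrier L)"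
  have E: "hom_vector_space K ?E"
    unfolding exterior_kernel_def by (rule W.EV.subspace_restrict[OF W.lam.kernel_subspace])
  have V: "hom_vector_space K ?V" by (rule T2.subspace_restrict[OF d.kernel_subspace])
  have uV: "hs_map K ?V ?E u"
    using ker_iff
    by (intro hs_mapI[OF V E] hs_homI) (auto simp: a_kernel_def' exterior_kernel_def u.add u.smult u.tw)
  have onto: "u ` carrier ?V = carrier ?E"
  proof -
    have "v \<in> u ` carrier ?V" if v: "v \<in> carrier W.ext" "exterior_map L v = \<zero>\<^bsub>L\<^esub>" for v
    proof -
      obtain t where "t \<in> carrier (T 2)" "v = u t" using v(1) unfolding u(3)[symmetric] by blast
      then show ?thesis using v(2) ker_iff by (auto simp: a_kernel_def')
    qed
    then show ?thesis using ker_iff by (auto simp: a_kernel_def' exterior_kernel_def)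
  qed
  have zE: "\<zero>\<^bsub>?E\<^esub> = \<zero>\<^bsub>W.ext\<^esub>" by (simp add: exterior_kernel_def)
  have "a_kernel ?V ?E u = a_kernel (T 2) W.ext u"
  proof -
    have "leibniz_d K L 2 t = \<zero>\<^bsub>T 1\<^esub>" if "t \<in> carrier (T 2)" "u t = \<zero>\<^bsub>W.ext\<^esub>" for t
      using ker_iff[OF that(1)] that(2) by simp
    then show ?thesis by (auto simp: a_kernel_def' zE)
  qed
  then have ker: "a_kernel ?V ?E u = leibniz_d K L 3 ` carrier (T 3)" using u(4) by simp
  have "HL K L 2 = hs_quot ?V (leibniz_d K L 3 ` carrier (T 3))"
    unfolding HL_def by (simp add: One_nat_def numeral_2_eq_2 numeral_3_eq_3)
  then show ?thesis using quotient_iso[OF uV onto] ker by simp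
qed

lemma HL_1_iso:
  "\<exists>\<Phi>. hs_iso K (hs_quot L (exterior_map L ` carrier W.ext)) (HL K L 1) \<Phi>"
proof -
  obtain u where u: "u \<in> hs_hom K (T 2) W.ext"
    "\<And>x y. \<lbrakk>x \<in> carrier L; y \<in> carrier L\<rbrakk> \<Longrightarrow> u (p [x, y]) = wedge K L (carrier L) x y"
    "u ` carrier (T 2) = carrier W.ext"
    by (rule tensor_power_2_exterior) blast
  obtain e where e: "e \<in> hs_hom K (T 1) L" "\<And>x. x \<in> carrier L \<Longrightarrow> e (p [x]) = x"
    "\<And>t. t \<in> carrier (T 1) \<Longrightarrow> p [e t] = t"
    by (rule tensor_power_1_iso) blast
  let ?J = "exterior_map L ` carrier W.ext"
  have J: "hs_subspace K L ?J" by (rule W.lam.image_subspace[OF W.EV.whole_subspace])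
  interpret Q: subspace_quotient K L ?J "hs_quot L ?J"
    by (rule subspace_quotient_hs_quot[OF vs J])
  interpret QV: hom_vector_space K "hs_quot L ?J" by (rule Q.quotient_hom_vector_space)
  interpret e: hs_map K "T 1" L e
    by (rule hs_mapI[OF T1.vs vs e(1)])
  interpret d: hs_map K "T 2" "T 1" "leibniz_d K L 2"
    by (rule hs_mapI[OF T2.vs T1.vs leibniz_d_2(1)])
  note ext_d = exterior_map_leibniz_d_2[OF u(1,2) e(1,2)]
  have J_iff: "e t \<in> ?J \<longleftrightarrow> t \<in> leibniz_d K L 2 ` carrier (T 2)" if t: "t \<in> carrier (T 1)" for t
  proof
    assume "e t \<in> ?J"
    then have "e t \<in> exterior_map L ` u ` carrier (T 2)" by (simp only: u(3))
    then obtain v where v: "v \<in> carrier (T 2)" "e t = exterior_map L (u v)" by blast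
    then have "e t = e (leibniz_d K L 2 (\<ominus>\<^bsub>T 2\<^esub> v))" by (simp add: ext_d d.neg e.neg)
    then have "p [e t] = p [e (leibniz_d K L 2 (\<ominus>\<^bsub>T 2\<^esub> v))]" by (rule arg_cong)
    moreover have "leibniz_d K L 2 (\<ominus>\<^bsub>T 2\<^esub> v) \<in> carrier (T 1)" using v(1) by simp
    ultimately have "t = leibniz_d K L 2 (\<ominus>\<^bsub>T 2\<^esub> v)" by (simp only: e(3) t)
    then show "t \<in> leibniz_d K L 2 ` carrier (T 2)" using v(1) by blast
  next
    assume "t \<in> leibniz_d K L 2 ` carrier (T 2)"
    then obtain v where v: "v \<in> carrier (T 2)" "t = leibniz_d K L 2 v" by blast
    then have "e t = \<ominus>\<^bsub>L\<^esub> exterior_map L (u v)" by (simp add: ext_d)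
    moreover have "exterior_map L (u v) \<in> ?J" using v(1) u(3) by blast
    ultimately show "e t \<in> ?J" using subspaceD(6)[OF J] by simp
  qed
  let ?V = "(T 1)\<lparr>carrier := a_kernel (T 1) (T 0) (leibniz_d K L 1)\<rparr>"
  have kV: "a_kernel (T 1) (T 0) (leibniz_d K L 1) = carrier (T 1)"
    using leibniz_d_1 by (auto simp: a_kernel_def')
  have V: "hom_vector_space K ?V" unfolding kV by (rule T1.subspace_restrict[OF T1.whole_subspace])
  let ?f = "\<lambda>t. ?J +>\<^bsub>L\<^esub> e t"
  have f: "hs_map K ?V (hs_quot L ?J) ?f"
    unfolding kV
    by (rule hs_mapI[OF V[unfolded kV] QV.vs], rule hs_homI)
      (simp_all add: e.add e.smult e.tw Q.add_Q Q.smult_Q Q.twist_Q)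
  have e_onto: "e ` carrier (T 1) = carrier L"
    using e(2) e.closed pure_closed(1) by (metis (no_types, opaque_lifting) image_eqI image_subsetI subsetI subset_antisym)
  have onto: "?f ` carrier ?V = carrier (hs_quot L ?J)"
  proof -
    have "?f ` carrier ?V = (\<lambda>x. ?J +>\<^bsub>L\<^esub> x) ` (e ` carrier (T 1))"
      by (simp add: kV image_image)
    then show ?thesis by (simp only: e_onto Q.carrier_Q)
  qed
  have ker: "a_kernel ?V (hs_quot L ?J) ?f = leibniz_d K L 2 ` carrier (T 2)"
  proof -
    have "a_kernel ?V (hs_quot L ?J) ?f = {t \<in> carrier (T 1). ?J +>\<^bsub>L\<^esub> e t = ?J}"
      unfolding kV by (simp add: a_kernel_def' Q.quotient(2))
    also have "\<dots> = {t \<in> carrier (T 1). t \<in> leibniz_d K L 2 ` carrier (T 2)}"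
      by (rule Collect_cong) (simp only: Q.coset_zero_iff e.closed J_iff cong: conj_cong)
    also have "\<dots> = leibniz_d K L 2 ` carrier (T 2)"
      using d.closed by blast
    finally show ?thesis .
  qed
  have "HL K L 1 = hs_quot ?V (leibniz_d K L 2 ` carrier (T 2))"
    unfolding HL_def by (simp add: One_nat_def numeral_2_eq_2)
  then show ?thesis using quotient_iso[OF f onto] ker by simp
qed

end

section \<open>The snake lemma and the transport of exact sequences\<close>

lemma (in hom_vector_space) restrict_diff:
  assumes B: "hs_subspace K V B" and xy: "x \<in> B" "y \<in> B"
  shows "x \<ominus>\<^bsub>V\<lparr>carrier := B\<rparr>\<^esub> y = x \<ominus>\<^bsub>V\<^esub> y"
proof -
  interpret R: hom_vector_space K "V\<lparr>carrier := B\<rparr>" by (rule subspace_restrict[OF B])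
  show ?thesis using R.diff_smult[of x y] diff_smult[of x y] xy subspaceD(2)[OF B] by simp
qed

text \<open>The exact sequence of kernels and cokernels for the diagram with exact rows
  \<open>A \<rightarrow> B \<rightarrow> C \<rightarrow> 0\<close> and \<open>0 \<rightarrow> M \<rightarrow> k \<rightarrow> g \<rightarrow> 0\<close>, from \<open>ker lB\<close> on.\<close>

lemma snake:
  assumes "hs_map K A B a" "hs_map K B C b" "hs_map K A k lA" "hs_map K B k lB" "hs_map K C g lC"
    "hs_map K k g \<pi>"
    and comm1: "\<And>u. u \<in> carrier A \<Longrightarrow> lB (a u) = lA u"
    and comm2: "\<And>v. v \<in> carrier B \<Longrightarrow> lC (b v) = \<pi> (lB v)"
    and ex: "a ` carrier A = a_kernel B C b" and onto_b: "b ` carrier B = carrier C"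
    and M: "M = a_kernel k g \<pi>" and onto_\<pi>: "\<pi> ` carrier k = carrier g"
  defines "KA \<equiv> A\<lparr>carrier := a_kernel A k lA\<rparr>"
    and "KB \<equiv> B\<lparr>carrier := a_kernel B k lB\<rparr>"
    and "KC \<equiv> C\<lparr>carrier := a_kernel C g lC\<rparr>"
    and "QM \<equiv> hs_quot (k\<lparr>carrier := M\<rparr>) (lA ` carrier A)"
    and "Qk \<equiv> hs_quot k (lB ` carrier B)"
    and "Qg \<equiv> hs_quot g (lC ` carrier C)"
  shows "a \<in> hs_hom K KA KB" "b \<in> hs_hom K KB KC" "exact_at KA a KB b KC"
    and "\<exists>\<theta>5\<in>hs_hom K KC QM. \<exists>\<theta>6\<in>hs_hom K QM Qk. \<exists>\<theta>7\<in>hs_hom K Qk Qg.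
      exact_at KB b KC \<theta>5 QM \<and> exact_at KC \<theta>5 QM \<theta>6 Qk \<and> exact_at QM \<theta>6 Qk \<theta>7 Qg
      \<and> \<theta>7 ` carrier Qk = carrier Qg"
proof -
  interpret A: hom_vector_space K A by (rule hs_map.axioms(1)[OF assms(1)])
  interpret B: hom_vector_space K B by (rule hs_map.axioms(1)[OF assms(2)])
  interpret C: hom_vector_space K C by (rule hs_map.axioms(1)[OF assms(5)])
  interpret k: hom_vector_space K k by (rule hs_map.axioms(1)[OF assms(6)])
  interpret g: hom_vector_space K g by (rule hs_map.axioms(2)[OF assms(6)])
  interpret a: hs_map K A B a by fact
  interpret b: hs_map K B C b by fact
  interpret lA: hs_map K A k lA by fact
  interpret lB: hs_map K B k lB by fact
  interpret lC: hs_map K C g lC by fact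
  interpret \<pi>: hs_map K k g \<pi> by fact
  have ba: "b (a u) = \<zero>\<^bsub>C\<^esub>" if "u \<in> carrier A" for u
  proof -
    have "a u \<in> a_kernel B C b" unfolding ex[symmetric] using that by (rule imageI)
    then show ?thesis by (simp add: a_kernel_def')
  qed
  have M_iff: "x \<in> M \<longleftrightarrow> x \<in> carrier k \<and> \<pi> x = \<zero>\<^bsub>g\<^esub>" for x unfolding M a_kernel_def' by blast
  have carr: "carrier KA = {u \<in> carrier A. lA u = \<zero>\<^bsub>k\<^esub>}" "carrier KB = {u \<in> carrier B. lB u = \<zero>\<^bsub>k\<^esub>}"
    "carrier KC = {u \<in> carrier C. lC u = \<zero>\<^bsub>g\<^esub>}"
    by (auto simp: KA_def KB_def KC_def a_kernel_def')
  have ops: "add KA = add A" "smult KA = smult A" "twist KA = twist A" "\<zero>\<^bsub>KA\<^esub> = \<zero>\<^bsub>A\<^esub>"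
    "add KB = add B" "smult KB = smult B" "twist KB = twist B" "\<zero>\<^bsub>KB\<^esub> = \<zero>\<^bsub>B\<^esub>"
    "add KC = add C" "smult KC = smult C" "twist KC = twist C" "\<zero>\<^bsub>KC\<^esub> = \<zero>\<^bsub>C\<^esub>"
    by (simp_all add: KA_def KB_def KC_def)
  interpret KC: hom_vector_space K KC
    unfolding KC_def by (rule C.subspace_restrict[OF lC.kernel_subspace])
  show "a \<in> hs_hom K KA KB"
    by (rule hs_homI) (auto simp: carr ops comm1 a.add a.smult a.tw)
  show bK: "b \<in> hs_hom K KB KC"
    by (rule hs_homI) (auto simp: carr ops comm2 b.add b.smult b.tw)
  show "exact_at KA a KB b KC"
    unfolding exact_at_def
  proof
    show "a ` carrier KA \<subseteq> a_kernel KB KC b"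
      using ba by (auto simp: a_kernel_def' carr ops comm1)
    show "a_kernel KB KC b \<subseteq> a ` carrier KA"
    proof
      fix v assume "v \<in> a_kernel KB KC b"
      then have v: "v \<in> carrier B" "lB v = \<zero>\<^bsub>k\<^esub>" "b v = \<zero>\<^bsub>C\<^esub>" by (auto simp: a_kernel_def' carr ops)
      then have "v \<in> a ` carrier A" unfolding ex by (simp add: a_kernel_def')
      then obtain u where "u \<in> carrier A" "v = a u" by blast
      with v comm1[of u] show "v \<in> a ` carrier KA" by (simp add: carr)
    qed
  qed
  have MS: "hs_subspace K k M" unfolding M by (rule \<pi>.kernel_subspace)
  let ?kM = "k\<lparr>carrier := M\<rparr>"
  interpret kM: hom_vector_space K ?kM by (rule k.subspace_restrict[OF MS])
  have lA_M: "lA u \<in> M" if "u \<in> carrier A" for u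
    using that comm1[OF that] comm2[of "a u"] ba[OF that] by (simp add: M_iff)
  let ?I = "lA ` carrier A" and ?J = "lB ` carrier B" and ?J' = "lC ` carrier C"
  have lAM: "hs_map K A ?kM lA"
    by (rule hs_mapI[OF A.vs kM.vs], rule hs_homI)
      (simp_all add: lA_M lA.add lA.smult lA.tw)
  have I: "hs_subspace K ?kM ?I" by (rule hs_map.image_subspace[OF lAM A.whole_subspace])
  have J: "hs_subspace K k ?J" by (rule lB.image_subspace[OF B.whole_subspace])
  have J': "hs_subspace K g ?J'" by (rule lC.image_subspace[OF C.whole_subspace])
  interpret QM: subspace_quotient K ?kM ?I QM
    unfolding QM_def by (rule subspace_quotient_hs_quot[OF kM.vs I])
  interpret Qk: subspace_quotient K k ?J Qk
    unfolding Qk_def by (rule subspace_quotient_hs_quot[OF k.vs J])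
  interpret Qg: subspace_quotient K g ?J' Qg
    unfolding Qg_def by (rule subspace_quotient_hs_quot[OF g.vs J'])
  note Qk_hvs = Qk.quotient_hom_vector_space and Qg_hvs = Qg.quotient_hom_vector_space
  define qM where "qM x = ?I +>\<^bsub>?kM\<^esub> x" for x
  define qk where "qk x = ?J +>\<^bsub>k\<^esub> x" for x
  define qg where "qg x = ?J' +>\<^bsub>g\<^esub> x" for x
  have qM_hom: "qM \<in> hs_hom K ?kM QM" unfolding qM_def[abs_def] by (rule QM.projection)
  have qk_hom: "qk \<in> hs_hom K k Qk" unfolding qk_def[abs_def] by (rule Qk.projection)
  have qg_hom: "qg \<in> hs_hom K g Qg" unfolding qg_def[abs_def] by (rule Qg.projection)
  have qM_eq: "qM x = qM y \<longleftrightarrow> x \<ominus>\<^bsub>k\<^esub> y \<in> ?I" if "x \<in> M" "y \<in> M" for x y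
    unfolding qM_def using that by (subst QM.coset_eq_iff) (simp_all add: k.restrict_diff[OF MS])
  have qM_zero: "qM x = \<zero>\<^bsub>QM\<^esub> \<longleftrightarrow> x \<in> ?I" if "x \<in> M" for x
    unfolding qM_def QM.quotient(2) using that by (intro QM.coset_zero_iff) simp
  have qk_eq: "qk x = qk y \<longleftrightarrow> x \<ominus>\<^bsub>k\<^esub> y \<in> ?J" if "x \<in> carrier k" "y \<in> carrier k" for x y
    unfolding qk_def using that by (rule Qk.coset_eq_iff)
  have qk_zero: "qk x = \<zero>\<^bsub>Qk\<^esub> \<longleftrightarrow> x \<in> ?J" if "x \<in> carrier k" for x
    unfolding qk_def Qk.quotient(2) using that by (rule Qk.coset_zero_iff)
  have qg_zero: "qg x = \<zero>\<^bsub>Qg\<^esub> \<longleftrightarrow> x \<in> ?J'" if "x \<in> carrier g" for x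
    unfolding qg_def Qg.quotient(2) using that by (rule Qg.coset_zero_iff)
  have QM_carr: "carrier QM = qM ` M" unfolding qM_def[abs_def] QM.carrier_Q by simp
  have Qk_carr: "carrier Qk = qk ` carrier k" unfolding qk_def[abs_def] by (rule Qk.carrier_Q)
  have Qg_carr: "carrier Qg = qg ` carrier g" unfolding qg_def[abs_def] by (rule Qg.carrier_Q)
  have I_J: "x \<in> ?J" if x: "x \<in> ?I" for x
  proof -
    obtain u where "u \<in> carrier A" "x = lA u" using x by blast
    then have "x = lB (a u)" "a u \<in> carrier B" by (simp_all add: comm1)
    then show ?thesis by blast
  qed
  \<comment> \<open>the connecting map \<open>\<theta>5\<close>: lift \<open>c\<close> along \<open>b\<close>, apply \<open>lB\<close> and land in \<open>M\<close>; another lift differs by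
    some \<open>a u\<close>, which changes the result by \<open>lA u\<close>\<close>
  define s where "s c = (SOME v. v \<in> carrier B \<and> b v = c)" for c
  have "s c \<in> carrier B \<and> b (s c) = c" if "c \<in> carrier C" for c
  proof -
    have "c \<in> b ` carrier B" unfolding onto_b by (rule that)
    then have "\<exists>v. v \<in> carrier B \<and> b v = c" by blast
    then show ?thesis unfolding s_def by (rule someI_ex)
  qed
  then have s: "s c \<in> carrier B" "b (s c) = c" if "c \<in> carrier C" for c using that by blast+
  have lB_M: "lB v \<in> M" if "v \<in> carrier B" "lC (b v) = \<zero>\<^bsub>g\<^esub>" for v
    using that comm2[of v] by (simp add: M_iff)
  define \<theta>5 where "\<theta>5 c = qM (lB (s c))" for c
  have \<theta>5: "\<theta>5 (b v) = qM (lB v)" if v: "v \<in> carrier B" "lC (b v) = \<zero>\<^bsub>g\<^esub>" for v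
  proof -
    have bv: "b v \<in> carrier C" using v by simp
    have sv: "s (b v) \<in> carrier B" "b (s (b v)) = b v" using s[OF bv] by blast+
    have "b (s (b v) \<ominus>\<^bsub>B\<^esub> v) = \<zero>\<^bsub>C\<^esub>" using sv v by (simp add: b.diff)
    then have "s (b v) \<ominus>\<^bsub>B\<^esub> v \<in> a ` carrier A" unfolding ex using sv v by (simp add: a_kernel_def')
    then obtain u where u: "u \<in> carrier A" "s (b v) \<ominus>\<^bsub>B\<^esub> v = a u" by blast
    then have "lB (s (b v)) \<ominus>\<^bsub>k\<^esub> lB v = lA u" using sv v comm1[of u] by (simp add: lB.diff[symmetric])
    then have "lB (s (b v)) \<ominus>\<^bsub>k\<^esub> lB v \<in> ?I" using u by blast
    moreover have "lB (s (b v)) \<in> M" "lB v \<in> M" using sv v by (auto intro!: lB_M)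
    ultimately show ?thesis unfolding \<theta>5_def by (simp add: qM_eq)
  qed
  have lift: "\<exists>v. v \<in> carrier B \<and> c = b v \<and> lC (b v) = \<zero>\<^bsub>g\<^esub>" if "c \<in> carrier KC" for c
    using that s[of c] by (intro exI[of _ "s c"]) (simp add: carr)
  have \<theta>5_hom: "\<theta>5 \<in> hs_hom K KC QM"
  proof (rule hs_homI)
    fix x assume "x \<in> carrier KC"
    then obtain v where v: "v \<in> carrier B" "x = b v" "lC (b v) = \<zero>\<^bsub>g\<^esub>" using lift by blast
    then show "\<theta>5 x \<in> carrier QM" using lB_M by (simp add: \<theta>5 QM_carr)
    have "twist KC x = b (twist B v)" "lC (b (twist B v)) = \<zero>\<^bsub>g\<^esub>"
      using v by (simp_all add: ops b.tw lC.tw)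
    then show "\<theta>5 (twist KC x) = twist QM (\<theta>5 x)"
      using v hs_homD(4)[OF qM_hom, of "lB v"] lB_M[of v] by (simp add: \<theta>5 lB.tw)
    show "\<theta>5 (c \<odot>\<^bsub>KC\<^esub> x) = c \<odot>\<^bsub>QM\<^esub> \<theta>5 x" if c: "c \<in> carrier K" for c
    proof -
      have "c \<odot>\<^bsub>KC\<^esub> x = b (c \<odot>\<^bsub>B\<^esub> v)" "lC (b (c \<odot>\<^bsub>B\<^esub> v)) = \<zero>\<^bsub>g\<^esub>"
        using v c by (simp_all add: ops b.smult lC.smult)
      then show ?thesis
        using v c hs_homD(3)[OF qM_hom c, of "lB v"] lB_M[of v] by (simp add: \<theta>5 lB.smult)
    qed
    fix y assume "y \<in> carrier KC"
    then obtain w where w: "w \<in> carrier B" "y = b w" "lC (b w) = \<zero>\<^bsub>g\<^esub>" using lift by blast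
    have "x \<oplus>\<^bsub>KC\<^esub> y = b (v \<oplus>\<^bsub>B\<^esub> w)" "lC (b (v \<oplus>\<^bsub>B\<^esub> w)) = \<zero>\<^bsub>g\<^esub>"
      using v w by (simp_all add: ops b.add lC.add)
    then show "\<theta>5 (x \<oplus>\<^bsub>KC\<^esub> y) = \<theta>5 x \<oplus>\<^bsub>QM\<^esub> \<theta>5 y"
      using v w hs_homD(2)[OF qM_hom, of "lB v" "lB w"] lB_M[of v] lB_M[of w] by (simp add: \<theta>5 lB.add)
  qed
  have M_sub: "x \<in> carrier k" if "x \<in> M" for x using that by (simp add: M_iff)
  have qk_kM: "qk \<in> hs_hom K ?kM Qk"
    by (rule hs_homI) (simp_all add: M_sub hs_homD[OF qk_hom])
  have qk_I: "qk x = \<zero>\<^bsub>Qk\<^esub>" if "x \<in> ?I" for x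
    using I_J[OF that] k.subspaceD(2)[OF J] qk_zero by simp
  define \<theta>6 where "\<theta>6 = (\<lambda>X. the_elem (qk ` X))"
  have \<theta>6_hom: "\<theta>6 \<in> hs_hom K QM Qk"
    unfolding \<theta>6_def by (rule QM.descend(1)[OF Qk_hvs qk_kM qk_I])
  have \<theta>6: "\<theta>6 (qM x) = qk x" if "x \<in> M" for x
    unfolding \<theta>6_def qM_def using that by (intro QM.descend(2)[OF Qk_hvs qk_kM qk_I]) simp_all
  have q\<pi>: "(\<lambda>x. qg (\<pi> x)) \<in> hs_hom K k Qg" by (rule hs_hom_comp[OF \<pi>.hs qg_hom])
  have q\<pi>_J: "qg (\<pi> x) = \<zero>\<^bsub>Qg\<^esub>" if x: "x \<in> ?J" for x
  proof -
    obtain v where "v \<in> carrier B" "x = lB v" using x by blast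
    then have "\<pi> x = lC (b v)" "b v \<in> carrier C" by (simp_all add: comm2)
    then show ?thesis by (simp add: qg_zero)
  qed
  define \<theta>7 where "\<theta>7 = (\<lambda>X. the_elem ((\<lambda>x. qg (\<pi> x)) ` X))"
  have \<theta>7_hom: "\<theta>7 \<in> hs_hom K Qk Qg"
    unfolding \<theta>7_def by (rule Qk.descend(1)[OF Qg_hvs q\<pi> q\<pi>_J])
  have \<theta>7: "\<theta>7 (qk x) = qg (\<pi> x)" if "x \<in> carrier k" for x
    unfolding \<theta>7_def qk_def using that by (intro Qk.descend(2)[OF Qg_hvs q\<pi> q\<pi>_J]) simp_all
  have ex4: "exact_at KB b KC \<theta>5 QM"
    unfolding exact_at_def
  proof
    show "b ` carrier KB \<subseteq> a_kernel KC QM \<theta>5"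
    proof clarify
      fix v assume v: "v \<in> carrier KB"
      then have "lC (b v) = \<zero>\<^bsub>g\<^esub>" "v \<in> carrier B" "lB v = \<zero>\<^bsub>k\<^esub>" by (simp_all add: carr comm2)
      then show "b v \<in> a_kernel KC QM \<theta>5"
        using qM_zero[of "\<zero>\<^bsub>k\<^esub>"] QM.B(3) by (simp add: a_kernel_def' carr \<theta>5 M_iff)
    qed
    show "a_kernel KC QM \<theta>5 \<subseteq> b ` carrier KB"
    proof
      fix c assume c: "c \<in> a_kernel KC QM \<theta>5"
      then have "c \<in> carrier KC" by (simp add: a_kernel_def')
      then obtain v where v: "v \<in> carrier B" "c = b v" "lC (b v) = \<zero>\<^bsub>g\<^esub>" using lift by blast
      then have "qM (lB v) = \<zero>\<^bsub>QM\<^esub>" using c by (simp add: a_kernel_def' \<theta>5)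
      then have "lB v \<in> ?I" using qM_zero lB_M v by simp
      then obtain u where u: "u \<in> carrier A" "lB v = lA u" by blast
      have "lB (v \<ominus>\<^bsub>B\<^esub> a u) = \<zero>\<^bsub>k\<^esub>" "b (v \<ominus>\<^bsub>B\<^esub> a u) = c" "v \<ominus>\<^bsub>B\<^esub> a u \<in> carrier B"
        using u v by (simp_all add: lB.diff b.diff comm1 ba)
      then show "c \<in> b ` carrier KB" by (auto simp: carr intro!: image_eqI[of _ _ "v \<ominus>\<^bsub>B\<^esub> a u"])
    qed
  qed
  have ex5: "exact_at KC \<theta>5 QM \<theta>6 Qk"
    unfolding exact_at_def
  proof
    show "\<theta>5 ` carrier KC \<subseteq> a_kernel QM Qk \<theta>6"
    proof clarify
      fix c assume "c \<in> carrier KC"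
      then obtain v where v: "v \<in> carrier B" "c = b v" "lC (b v) = \<zero>\<^bsub>g\<^esub>" using lift by blast
      then show "\<theta>5 c \<in> a_kernel QM Qk \<theta>6"
        using lB_M[of v] qk_zero[of "lB v"] by (simp add: a_kernel_def' \<theta>5 QM_carr \<theta>6)
    qed
    show "a_kernel QM Qk \<theta>6 \<subseteq> \<theta>5 ` carrier KC"
    proof
      fix X assume "X \<in> a_kernel QM Qk \<theta>6"
      then obtain m where m: "m \<in> M" "X = qM m" "qk m = \<zero>\<^bsub>Qk\<^esub>"
        by (auto simp: a_kernel_def' QM_carr \<theta>6)
      then have "m \<in> ?J" using qk_zero M_sub by simp
      then obtain v where v: "v \<in> carrier B" "m = lB v" by blast
      then have "lC (b v) = \<zero>\<^bsub>g\<^esub>" using m by (simp add: comm2 M_iff)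
      then have "X = \<theta>5 (b v)" "b v \<in> carrier KC" using m v by (simp_all add: \<theta>5 carr)
      then show "X \<in> \<theta>5 ` carrier KC" by blast
    qed
  qed
  have ex6: "exact_at QM \<theta>6 Qk \<theta>7 Qg"
    unfolding exact_at_def
  proof
    show "\<theta>6 ` carrier QM \<subseteq> a_kernel Qk Qg \<theta>7"
    proof clarify
      fix X assume "X \<in> carrier QM"
      then obtain m where m: "m \<in> M" "X = qM m" by (auto simp: QM_carr)
      then show "\<theta>6 X \<in> a_kernel Qk Qg \<theta>7"
        using M_sub[of m] qg_zero[of "\<zero>\<^bsub>g\<^esub>"] Qg.B(3)
        by (simp add: a_kernel_def' Qk_carr \<theta>6 \<theta>7) (simp add: M_iff)
    qed
    show "a_kernel Qk Qg \<theta>7 \<subseteq> \<theta>6 ` carrier QM"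
    proof
      fix X assume "X \<in> a_kernel Qk Qg \<theta>7"
      then obtain x where x: "x \<in> carrier k" "X = qk x" "qg (\<pi> x) = \<zero>\<^bsub>Qg\<^esub>"
        by (auto simp: a_kernel_def' Qk_carr \<theta>7)
      then have "\<pi> x \<in> ?J'" using qg_zero by simp
      then obtain c where c: "c \<in> carrier C" "\<pi> x = lC c" by blast
      let ?v = "s c"
      have v: "?v \<in> carrier B" "\<pi> x = \<pi> (lB ?v)" using c s[OF c(1)] comm2[of ?v] by simp_all
      have m: "x \<ominus>\<^bsub>k\<^esub> lB ?v \<in> M" using v x by (simp add: M_iff \<pi>.diff)
      have "x \<ominus>\<^bsub>k\<^esub> (x \<ominus>\<^bsub>k\<^esub> lB ?v) = lB ?v"
        using v x by (simp add: a_minus_def k.M.minus_add k.M.a_assoc[symmetric] k.M.r_neg)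
      moreover have "lB ?v \<in> ?J" using v by blast
      ultimately have "qk x = qk (x \<ominus>\<^bsub>k\<^esub> lB ?v)" using qk_eq[of x "x \<ominus>\<^bsub>k\<^esub> lB ?v"] x v by simp
      then have "X = \<theta>6 (qM (x \<ominus>\<^bsub>k\<^esub> lB ?v))" using x m by (simp add: \<theta>6)
      moreover have "qM (x \<ominus>\<^bsub>k\<^esub> lB ?v) \<in> carrier QM" using m by (simp add: QM_carr)
      ultimately show "X \<in> \<theta>6 ` carrier QM" by blast
    qed
  qed
  have "\<theta>7 ` carrier Qk = carrier Qg"
  proof -
    have "\<theta>7 ` carrier Qk = (\<lambda>x. qg (\<pi> x)) ` carrier k"
      unfolding Qk_carr image_image by (rule image_cong) (simp_all add: \<theta>7)
    also have "\<dots> = qg ` \<pi> ` carrier k" by (simp add: image_image)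
    finally show ?thesis unfolding onto_\<pi> Qg_carr .
  qed
  with \<theta>5_hom \<theta>6_hom \<theta>7_hom ex4 ex5 ex6
  show "\<exists>\<theta>5\<in>hs_hom K KC QM. \<exists>\<theta>6\<in>hs_hom K QM Qk. \<exists>\<theta>7\<in>hs_hom K Qk Qg.
      exact_at KB b KC \<theta>5 QM \<and> exact_at KC \<theta>5 QM \<theta>6 Qk \<and> exact_at QM \<theta>6 Qk \<theta>7 Qg
      \<and> \<theta>7 ` carrier Qk = carrier Qg"
    by blast
qed

text \<open>The map \<open>\<beta> \<circ> f \<circ> \<alpha>\<^sup>-\<^sup>1\<close> that corresponds to \<open>f\<close> when its source and target are replaced
  by isomorphic spaces.\<close>

definition transport :: "('a, 'm) partial_object_scheme \<Rightarrow> ('a \<Rightarrow> 'a') \<Rightarrow> ('b \<Rightarrow> 'b') \<Rightarrow> ('a \<Rightarrow> 'b) \<Rightarrow> 'a' \<Rightarrow> 'b'"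
  where "transport U \<alpha> \<beta> f x = \<beta> (f (inv_into (carrier U) \<alpha> x))"

lemma transport_hom:
  assumes "hs_iso K U U' \<alpha>" "hs_iso K V V' \<beta>" "f \<in> hs_hom K U V"
  shows "transport U \<alpha> \<beta> f \<in> hs_hom K U' V'"
  using hs_hom_comp[OF hs_hom_comp[OF hs_iso_hom[OF hs_iso_inverse[OF assms(1)]] assms(3)]
      hs_iso_hom[OF assms(2)]]
  by (simp add: transport_def[abs_def])

lemma transport_apply:
  assumes "hs_iso K U U' \<alpha>" "u \<in> carrier U"
  shows "transport U \<alpha> \<beta> f (\<alpha> u) = \<beta> (f u)"
  using assms by (simp add: transport_def hs_iso_def bij_betw_def)

lemma transport_image:
  assumes "hs_iso K U U' \<alpha>"
  shows "transport U \<alpha> \<beta> f ` carrier U' = \<beta> ` f ` carrier U"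
proof -
  have U': "carrier U' = \<alpha> ` carrier U" using assms by (simp add: hs_iso_def bij_betw_def)
  show ?thesis
    unfolding U' image_image by (rule image_cong) (simp_all add: transport_apply[OF assms])
qed

lemma transport_exact:
  assumes \<alpha>: "hs_iso K U U' \<alpha>" and \<beta>: "hs_iso K V V' \<beta>" and \<gamma>: "hs_iso K W W' \<gamma>"
    and g: "g \<in> hs_hom K V W" and ex: "exact_at U f V g W"
  shows "exact_at U' (transport U \<alpha> \<beta> f) V' (transport V \<beta> \<gamma> g) W'"
proof -
  interpret \<gamma>: hs_map K W W' \<gamma>
    using \<gamma> by (simp add: hs_iso_def)
  have V': "carrier V' = \<beta> ` carrier V" using \<beta> by (simp add: hs_iso_def bij_betw_def)
  have inj: "inj_on \<gamma> (carrier W)" using \<gamma> by (simp add: hs_iso_def bij_betw_def)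
  have zero: "\<gamma> (g v) = \<zero>\<^bsub>W'\<^esub> \<longleftrightarrow> g v = \<zero>\<^bsub>W\<^esub>" if "v \<in> carrier V" for v
    using inj_onD[OF inj, of "g v" "\<zero>\<^bsub>W\<^esub>"] hs_homD(1)[OF g that] by auto
  have "transport U \<alpha> \<beta> f ` carrier U' = \<beta> ` a_kernel V W g"
    using ex by (simp add: transport_image[OF \<alpha>] exact_at_def)
  also have "\<dots> = a_kernel V' W' (transport V \<beta> \<gamma> g)"
    unfolding a_kernel_def' V' using zero by (auto simp: transport_apply[OF \<beta>])
  finally show ?thesis by (simp add: exact_at_def)
qed

section \<open>The exact sequence\<close>

lemma exterior_kernel_simps:
  "carrier (exterior_kernel K L M N)
    = {u \<in> carrier (exterior_product K L M N). exterior_map L u = \<zero>\<^bsub>L\<^esub>}"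
  "\<zero>\<^bsub>exterior_kernel K L M N\<^esub> = \<zero>\<^bsub>exterior_product K L M N\<^esub>"
  "add (exterior_kernel K L M N) = add (exterior_product K L M N)"
  "smult (exterior_kernel K L M N) = smult (exterior_product K L M N)"
  "twist (exterior_kernel K L M N) = twist (exterior_product K L M N)"
  by (simp_all add: exterior_kernel_def a_kernel_def')

lemma exterior_kernel_hom:
  assumes f: "f \<in> hs_hom K (exterior_product K L M (carrier L)) (exterior_product K L' M' (carrier L'))"
    and lam: "\<And>u. u \<in> carrier (exterior_product K L M (carrier L)) \<Longrightarrow> exterior_map L' (f u) = p (exterior_map L u)"
    and p: "p \<zero>\<^bsub>L\<^esub> = \<zero>\<^bsub>L'\<^esub>"
  shows "f \<in> hs_hom K (exterior_kernel K L M (carrier L)) (exterior_kernel K L' M' (carrier L'))"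
  using hs_homD[OF f] by (intro hs_homI) (simp_all add: exterior_kernel_simps lam p)

text \<open>The image of \<open>\<lambda>\<close> is spanned by brackets of \<open>M\<close> with \<open>L\<close> and lies in \<open>M\<close>, so brackets of its
  elements are again such brackets: the span is already a subalgebra.\<close>

lemma (in leibniz_ideal) ideal_commutator_eq:
  "ideal_commutator K L M (carrier L) = exterior_map L ` carrier ext"
proof
  let ?I = "exterior_map L ` carrier ext"
  have sub: "hs_subspace K L ?I" by (rule lam.image_subspace[OF EV.whole_subspace])
  have "carrier ext \<subseteq> {u \<in> carrier ext. exterior_map L u \<in> M}"
  proof (rule wedge_span)
    show "submodule {u \<in> carrier ext. exterior_map L u \<in> M} K ext"
      using ideal_subspace by (intro lam.preimage_submodule) (simp add: hs_subspace_def)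
  qed (auto simp: exterior_map_wedge intro: wedge.pair_closed)
  then have IM: "?I \<subseteq> M" by blast
  have br: "\<langle>x, y\<rangle>\<^bsub>L\<^esub> \<in> ?I" if "x \<in> carrier L" "y \<in> carrier L" "x \<in> M \<or> y \<in> M" for x y
    using exterior_map_wedge[OF that] wedge.pair_closed[OF that] by (metis imageI)
  have "hl_subalgebra K L ?I"
    unfolding hl_subalgebra_def
  proof (intro conjI ballI)
    show "submodule ?I K L" "twist L ` ?I \<subseteq> ?I"
      using sub unfolding hs_subspace_def by (rule conjunct1, rule conjunct2)
    fix x y assume "x \<in> ?I" "y \<in> ?I"
    then show "\<langle>x, y\<rangle>\<^bsub>L\<^esub> \<in> ?I" using IM by (intro br) auto
  qed
  moreover have "\<forall>h\<in>M. \<forall>j\<in>carrier L. \<langle>h, j\<rangle>\<^bsub>L\<^esub> \<in> ?I \<and> \<langle>j, h\<rangle>\<^bsub>L\<^esub> \<in> ?I"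
    by (intro ballI conjI br) simp_all
  ultimately show "ideal_commutator K L M (carrier L) \<subseteq> ?I"
    unfolding ideal_commutator_def by (intro Inter_lower CollectI conjI)
  show "?I \<subseteq> ideal_commutator K L M (carrier L)"
    unfolding ideal_commutator_def
  proof (rule Inter_greatest, clarify)
    fix S u assume S: "hl_subalgebra K L S"
      and gen: "\<forall>h\<in>M. \<forall>j\<in>carrier L. \<langle>h, j\<rangle>\<^bsub>L\<^esub> \<in> S \<and> \<langle>j, h\<rangle>\<^bsub>L\<^esub> \<in> S" and u: "u \<in> carrier ext"
    have "carrier ext \<subseteq> {u \<in> carrier ext. exterior_map L u \<in> S}"
    proof (rule wedge_span)
      show "submodule {u \<in> carrier ext. exterior_map L u \<in> S} K ext"
        using S by (intro lam.preimage_submodule) (simp add: hl_subalgebra_def)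
    qed (use gen in \<open>auto simp: exterior_map_wedge intro: wedge.pair_closed\<close>)
    then show "exterior_map L u \<in> S" using u by blast
  qed
qed

lemma (in leibniz_ideal) ideal_commutator_subset: "ideal_commutator K L M (carrier L) \<subseteq> M"
proof -
  have "hl_subalgebra K L M" using ideal by (auto simp: hl_subalgebra_def hl_ideal_def)
  then show ?thesis unfolding ideal_commutator_def by (intro Inter_lower) simp
qed

lemma (in hom_vector_space) subspace_restrict_mono:
  assumes "hs_subspace K V B" "hs_subspace K V B'" "B' \<subseteq> B"
  shows "hs_subspace K (V\<lparr>carrier := B\<rparr>) B'"
proof -
  interpret R: hom_vector_space K "V\<lparr>carrier := B\<rparr>" by (rule subspace_restrict[OF assms(1)])
  show ?thesis by (rule R.subspaceI) (use subspaceD[OF assms(2)] assms(3) in auto)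
qed

lemma kernel_ideal:
  assumes A: "hom_leibniz K A" and B: "hom_leibniz K B" and p: "p \<in> hl_hom K A B"
  shows "hl_ideal K A (a_kernel A B p)"
proof -
  interpret A: hom_leibniz K A by fact
  interpret B: hom_leibniz K B by fact
  interpret p: hs_map K A B p
    by (rule hs_mapI[OF A.vs B.vs hl_homD(1)[OF p]])
  show ?thesis
    using p.kernel_subspace hl_homD(2)[OF p]
    unfolding hl_ideal_def hs_subspace_def by (auto simp: a_kernel_def')
qed

lemma short_exactD:
  assumes "hl_short_exact K M i L p G"
  shows "hom_leibniz K L" "hom_leibniz K G" "p \<in> hl_hom K L G" "p ` carrier L = carrier G"
    and "i ` carrier M = a_kernel L G p"
  using assms by (auto simp: hl_short_exact_def exact_at_def)

text \<open>Restricted to the kernels of \<open>\<lambda>\<close>, the sequence for \<open>R, S, M\<close> stays exact at \<open>S\<close>. At \<open>M\<close>, an element \<open>u\<close>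
  over \<open>S\<close> with \<open>\<lambda> u = 0\<close> vanishes in \<open>E(F,F)\<close>, hence in \<open>E(L,L)\<close>. Conversely, if \<open>w\<close> vanishes in \<open>E(L,L)\<close>,
  a lift \<open>v\<close> of \<open>w\<close> over \<open>S\<close> becomes in \<open>E(F,F)\<close> the image of some \<open>u\<close> over \<open>R\<close>; then \<open>v - u\<close> lifts \<open>w\<close>
  and vanishes in \<open>E(F,F)\<close>, so \<open>\<lambda>\<close> kills it.\<close>

lemma exterior_kernel_exact_free:
  fixes F :: "('k, 'f) hom_alg" and L :: "('k, 'l) hom_alg"
  assumes free: "free_hom_leibniz K V \<iota> F"
    and L: "hom_leibniz K L" and \<rho>: "\<rho> \<in> hl_hom K F L" "\<rho> ` carrier F = carrier L"
    and R: "R = a_kernel F L \<rho>" "R \<subseteq> S" and S: "hl_ideal K F S" and M: "\<rho> ` S = M" "hl_ideal K L M"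
    and a: "a \<in> hs_hom K (exterior_product K L M (carrier L)) (exterior_product K L (carrier L) (carrier L))"
      "\<And>x y. \<lbrakk>x \<in> carrier L; y \<in> carrier L; x \<in> M \<or> y \<in> M\<rbrakk>
        \<Longrightarrow> a (wedge K L M x y) = wedge K L (carrier L) x y"
  shows "\<exists>\<theta>1\<in>hs_hom K (exterior_kernel K F R (carrier F)) (exterior_kernel K F S (carrier F)).
    \<exists>\<theta>2\<in>hs_hom K (exterior_kernel K F S (carrier F)) (exterior_kernel K L M (carrier L)).
      exact_at (exterior_kernel K F R (carrier F)) \<theta>1 (exterior_kernel K F S (carrier F))
        \<theta>2 (exterior_kernel K L M (carrier L))
    \<and> exact_at (exterior_kernel K F S (carrier F)) \<theta>2 (exterior_kernel K L M (carrier L))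
        a (exterior_kernel K L (carrier L) (carrier L))"
proof -
  have F: "hom_leibniz K F" using free by (simp add: free_hom_leibniz_def)
  have ideals: "leibniz_ideal K F R" "leibniz_ideal K F S" "leibniz_ideal K F (carrier F)"
    "leibniz_ideal K L M" "leibniz_ideal K L (carrier L)"
    using F L S M(2) kernel_ideal[OF F L \<rho>(1)] R(1) hom_leibniz.whole_ideal[OF F] hom_leibniz.whole_ideal[OF L]
    by (simp_all add: leibniz_ideal_def leibniz_ideal_axioms_def)
  interpret R: leibniz_ideal K F R by fact
  interpret S: leibniz_ideal K F S by fact
  interpret F: leibniz_ideal K F "carrier F" by fact
  interpret M: leibniz_ideal K L M by fact
  interpret L: leibniz_ideal K L "carrier L" by fact
  interpret \<rho>: hs_map K F L \<rho>
    by (rule hs_mapI[OF R.vs M.vs hl_homD(1)[OF \<rho>(1)]])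
  have id: "(\<lambda>x. x) \<in> hl_hom K F F" by (simp add: hl_hom_def hs_hom_id)
  obtain r where r: "r \<in> hs_hom K R.ext S.ext"
    "\<And>x y. \<lbrakk>x \<in> carrier F; y \<in> carrier F; x \<in> R \<or> y \<in> R\<rbrakk> \<Longrightarrow> r (wedge K F R x y) = wedge K F S x y"
    "\<And>u. u \<in> carrier R.ext \<Longrightarrow> exterior_map F (r u) = exterior_map F u"
    by (rule exterior_functorial[OF ideals(1,2) id]) (use R(2) in auto)
  obtain c where c: "c \<in> hs_hom K S.ext F.ext"
    "\<And>x y. \<lbrakk>x \<in> carrier F; y \<in> carrier F; x \<in> S \<or> y \<in> S\<rbrakk> \<Longrightarrow> c (wedge K F S x y) = wedge K F (carrier F) x y"
    "\<And>u. u \<in> carrier S.ext \<Longrightarrow> exterior_map F (c u) = exterior_map F u"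
    by (rule exterior_functorial[OF ideals(2,3) id]) (use S.M_subset in auto)
  obtain b where b: "b \<in> hs_hom K S.ext M.ext"
    "\<And>x y. \<lbrakk>x \<in> carrier F; y \<in> carrier F; x \<in> S \<or> y \<in> S\<rbrakk> \<Longrightarrow> b (wedge K F S x y) = wedge K L M (\<rho> x) (\<rho> y)"
    "\<And>u. u \<in> carrier S.ext \<Longrightarrow> exterior_map L (b u) = \<rho> (exterior_map F u)"
    by (rule exterior_functorial[OF ideals(2,4) \<rho>(1)]) (use M(1) in auto)
  obtain d where d: "d \<in> hs_hom K F.ext L.ext"
    "\<And>x y. \<lbrakk>x \<in> carrier F; y \<in> carrier F\<rbrakk> \<Longrightarrow> d (wedge K F (carrier F) x y) = wedge K L (carrier L) (\<rho> x) (\<rho> y)"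
    by (rule exterior_functorial[OF ideals(3,5) \<rho>(1)]) (use \<rho>(2) in auto)
  note hvs = R.EV.vs S.EV.vs F.EV.vs
    M.EV.vs L.EV.vs
  interpret r: hs_map K R.ext S.ext r by (rule hs_mapI[OF hvs(1,2) r(1)])
  interpret c: hs_map K S.ext F.ext c by (rule hs_mapI[OF hvs(2,3) c(1)])
  interpret b: hs_map K S.ext M.ext b by (rule hs_mapI[OF hvs(2,4) b(1)])
  interpret d: hs_map K F.ext L.ext d by (rule hs_mapI[OF hvs(3,5) d(1)])
  interpret a: hs_map K M.ext L.ext a by (rule hs_mapI[OF hvs(4,5) a(1)])
  have exS: "r ` carrier R.ext = a_kernel S.ext M.ext b" "b ` carrier S.ext = carrier M.ext"
    using exterior_right_exact[OF ideals(1,2,4) \<rho> R M(1) r(1,2) b(1,2)] by blast+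
  have exF: "(\<lambda>u. c (r u)) ` carrier R.ext = a_kernel F.ext L.ext d"
  proof (rule exterior_right_exact(1)[OF ideals(1,3,5) \<rho> R(1)])
    show "R \<subseteq> carrier F" by (rule R.M_subset)
    show "\<rho> ` carrier F = carrier L" by (rule \<rho>(2))
    show "(\<lambda>u. c (r u)) \<in> hs_hom K R.ext F.ext" by (rule hs_hom_comp[OF r(1) c(1)])
    show "c (r (wedge K F R x y)) = wedge K F (carrier F) x y"
      if "x \<in> carrier F" "y \<in> carrier F" "x \<in> R \<or> y \<in> R" for x y
      using that R(2) by (auto simp: r(2) c(2))
  qed (use d in auto)
  have ab: "a (b u) = d (c u)" if "u \<in> carrier S.ext" for u
  proof (rule S.wedge_ext[OF hvs(5) hs_hom_comp[OF b(1) a(1)] hs_hom_comp[OF c(1) d(1)] _ that])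
    fix x y assume xy: "x \<in> carrier F" "y \<in> carrier F" "x \<in> S \<or> y \<in> S"
    then have "\<rho> x \<in> M \<or> \<rho> y \<in> M" using M(1) by auto
    then show "a (b (wedge K F S x y)) = d (c (wedge K F S x y))"
      using xy by (simp add: a(2) b(2) c(2) d(2))
  qed
  let ?KR = "exterior_kernel K F R (carrier F)" and ?KS = "exterior_kernel K F S (carrier F)"
    and ?KM = "exterior_kernel K L M (carrier L)" and ?KL = "exterior_kernel K L (carrier L) (carrier L)"
  have rK: "r \<in> hs_hom K ?KR ?KS"
    by (rule exterior_kernel_hom[OF r(1), where p = "\<lambda>x. x"]) (simp_all add: r(3))
  have bK: "b \<in> hs_hom K ?KS ?KM"
    by (rule exterior_kernel_hom[OF b(1,3)]) simp_all
  have ex1: "exact_at ?KR r ?KS b ?KM"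
    unfolding exact_at_def
  proof
    show "r ` carrier ?KR \<subseteq> a_kernel ?KS ?KM b"
    proof clarify
      fix u assume u: "u \<in> carrier ?KR"
      then have "r u \<in> a_kernel S.ext M.ext b" unfolding exS(1)[symmetric] by (simp add: exterior_kernel_simps)
      then show "r u \<in> a_kernel ?KS ?KM b"
        using u by (simp add: a_kernel_def' exterior_kernel_simps r(3))
    qed
    show "a_kernel ?KS ?KM b \<subseteq> r ` carrier ?KR"
    proof
      fix v assume v: "v \<in> a_kernel ?KS ?KM b"
      then have "v \<in> r ` carrier R.ext" unfolding exS(1) by (simp add: a_kernel_def' exterior_kernel_simps)
      then obtain u where u: "u \<in> carrier R.ext" "v = r u" by blast
      then have "u \<in> carrier ?KR" using v r(3)[OF u(1)] by (simp add: a_kernel_def' exterior_kernel_simps)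
      then show "v \<in> r ` carrier ?KR" using u(2) by blast
    qed
  qed
  have ex2: "exact_at ?KS b ?KM a ?KL"
    unfolding exact_at_def
  proof
    show "b ` carrier ?KS \<subseteq> a_kernel ?KM ?KL a"
    proof clarify
      fix u assume "u \<in> carrier ?KS"
      then have u: "u \<in> carrier S.ext" "exterior_map F u = \<zero>\<^bsub>F\<^esub>" by (simp_all add: exterior_kernel_simps)
      then have "c u = \<zero>\<^bsub>F.ext\<^esub>"
        by (intro exterior_map_free_injective[OF free]) (simp_all add: c(3))
      then have "a (b u) = \<zero>\<^bsub>L.ext\<^esub>" using ab[OF u(1)] by simp
      then show "b u \<in> a_kernel ?KM ?KL a"
        using u by (simp add: a_kernel_def' exterior_kernel_simps b(3))
    qed
    show "a_kernel ?KM ?KL a \<subseteq> b ` carrier ?KS"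
    proof
      fix w assume "w \<in> a_kernel ?KM ?KL a"
      then have w: "w \<in> carrier M.ext" "a w = \<zero>\<^bsub>L.ext\<^esub>" by (simp_all add: a_kernel_def' exterior_kernel_simps)
      then have "w \<in> b ` carrier S.ext" by (simp only: exS(2))
      then obtain v where v: "v \<in> carrier S.ext" "w = b v" by blast
      then have "c v \<in> a_kernel F.ext L.ext d" using w ab[OF v(1)] by (simp add: a_kernel_def')
      then have "c v \<in> (\<lambda>u. c (r u)) ` carrier R.ext" by (simp only: exF)
      then obtain u where u: "u \<in> carrier R.ext" "c v = c (r u)" by blast
      have "r u \<in> a_kernel S.ext M.ext b" unfolding exS(1)[symmetric] using u(1) by (rule imageI)
      then have br: "b (r u) = \<zero>\<^bsub>M.ext\<^esub>" by (simp add: a_kernel_def')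
      let ?v = "v \<ominus>\<^bsub>S.ext\<^esub> r u"
      have v': "?v \<in> carrier S.ext" using u v by simp
      have "b ?v = w" using u v br by (simp add: b.diff w(1))
      moreover have "exterior_map F ?v = \<zero>\<^bsub>F\<^esub>"
      proof -
        have "c ?v = \<zero>\<^bsub>F.ext\<^esub>" using u v by (simp add: c.diff)
        then show ?thesis using c(3)[OF v'] F.lam.zero by simp
      qed
      ultimately show "w \<in> b ` carrier ?KS" using v' by (auto simp: exterior_kernel_simps)
    qed
  qed
  show ?thesis using rK bK ex1 ex2 by blast
qed

lemma exterior_kernel_hom_vector_space:
  assumes "leibniz_ideal K L M"
  shows "hom_vector_space K (exterior_kernel K L M (carrier L))"
proof -
  interpret L: leibniz_ideal K L M by fact
  show ?thesis
    unfolding exterior_kernel_def by (rule L.EV.subspace_restrict[OF L.lam.kernel_subspace])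
qed

text \<open>The section \<open>\<sigma>\<close> is used twice: \<open>\<sigma>\<pi>\<close> is the projection that makes \<open>a\<close> injective, and \<open>\<sigma>\<close> induces
  on exterior squares a section of \<open>b\<close> that preserves the kernels of \<open>\<lambda>\<close>.\<close>

lemma exterior_kernel_split:
  fixes L :: "('k, 'l) hom_alg" and G :: "('k, 'g) hom_alg"
  assumes L: "hom_leibniz K L" and G: "hom_leibniz K G" and \<pi>: "\<pi> \<in> hl_hom K L G"
    and M: "M = a_kernel L G \<pi>" and split: "hl_split K L \<pi> G"
    and a: "a \<in> hs_hom K (exterior_product K L M (carrier L)) (exterior_product K L (carrier L) (carrier L))"
      "\<And>x y. \<lbrakk>x \<in> carrier L; y \<in> carrier L; x \<in> M \<or> y \<in> M\<rbrakk>
        \<Longrightarrow> a (wedge K L M x y) = wedge K L (carrier L) x y"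
    and b: "b \<in> hs_hom K (exterior_product K L (carrier L) (carrier L)) (exterior_product K G (carrier G) (carrier G))"
      "\<And>x y. \<lbrakk>x \<in> carrier L; y \<in> carrier L\<rbrakk>
        \<Longrightarrow> b (wedge K L (carrier L) x y) = wedge K G (carrier G) (\<pi> x) (\<pi> y)"
  shows "inj_on a (carrier (exterior_kernel K L M (carrier L)))"
    and "carrier (exterior_kernel K G (carrier G) (carrier G))
      \<subseteq> b ` carrier (exterior_kernel K L (carrier L) (carrier L))"
proof -
  have ideals: "leibniz_ideal K L M" "leibniz_ideal K L (carrier L)" "leibniz_ideal K G (carrier G)"
    using L G kernel_ideal[OF L G \<pi>] M hom_leibniz.whole_ideal[OF L] hom_leibniz.whole_ideal[OF G]
    by (simp_all add: leibniz_ideal_def leibniz_ideal_axioms_def)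
  interpret M: leibniz_ideal K L M by fact
  interpret L: leibniz_ideal K L "carrier L" by fact
  interpret G: leibniz_ideal K G "carrier G" by fact
  interpret \<pi>: hs_map K L G \<pi>
    by (rule hs_mapI[OF M.vs G.vs hl_homD(1)[OF \<pi>]])
  obtain \<sigma> where \<sigma>: "\<sigma> \<in> hl_hom K G L" "\<And>x. x \<in> carrier G \<Longrightarrow> \<pi> (\<sigma> x) = x"
    using split unfolding hl_split_def by blast
  interpret \<sigma>: hs_map K G L \<sigma>
    by (rule hs_mapI[OF G.vs M.vs hl_homD(1)[OF \<sigma>(1)]])
  have e: "(\<lambda>x. \<sigma> (\<pi> x)) \<in> hl_hom K L L"
    using hs_hom_comp[OF \<pi>.hs \<sigma>.hs] hl_homD(2)[OF \<pi>] hl_homD(2)[OF \<sigma>(1)] by (simp add: hl_hom_def)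
  have M_iff: "x \<in> M \<longleftrightarrow> x \<in> carrier L \<and> \<pi> x = \<zero>\<^bsub>G\<^esub>" for x
    unfolding M a_kernel_def' by blast
  have "x \<ominus>\<^bsub>L\<^esub> \<sigma> (\<pi> x) \<in> M" if "x \<in> carrier L" for x
    unfolding M_iff using that by (simp add: \<pi>.diff \<sigma>(2))
  moreover have "\<sigma> (\<pi> x) = \<zero>\<^bsub>L\<^esub>" if "x \<in> M" for x
    using that unfolding M_iff by simp
  ultimately have "inj_on a (carrier M.ext)"
    by (rule exterior_split_injective[OF ideals(1) e _ _ a])
  then show "inj_on a (carrier (exterior_kernel K L M (carrier L)))"
    by (rule inj_on_subset) (auto simp: exterior_kernel_simps)
  obtain f where f: "f \<in> hs_hom K G.ext L.ext"
    "\<And>x y. \<lbrakk>x \<in> carrier G; y \<in> carrier G\<rbrakk> \<Longrightarrow> f (wedge K G (carrier G) x y) = wedge K L (carrier L) (\<sigma> x) (\<sigma> y)"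
    "\<And>u. u \<in> carrier G.ext \<Longrightarrow> exterior_map L (f u) = \<sigma> (exterior_map G u)"
    by (rule exterior_functorial[OF ideals(3,2) \<sigma>(1)]) auto
  have bf: "b (f w) = w" if "w \<in> carrier G.ext" for w
    by (rule G.wedge_ext[OF G.EV.vs hs_hom_comp[OF f(1) b(1)] hs_hom_id _ that])
      (simp add: f(2) b(2) \<sigma>(2))
  show "carrier (exterior_kernel K G (carrier G) (carrier G))
      \<subseteq> b ` carrier (exterior_kernel K L (carrier L) (carrier L))"
  proof
    fix w assume "w \<in> carrier (exterior_kernel K G (carrier G) (carrier G))"
    then have w: "w \<in> carrier G.ext" "exterior_map G w = \<zero>\<^bsub>G\<^esub>" by (simp_all add: exterior_kernel_simps)
    then have "f w \<in> carrier (exterior_kernel K L (carrier L) (carrier L))"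
      by (simp add: exterior_kernel_simps f(3) hs_homD(1)[OF f(1)])
    with bf[OF w(1)] show "w \<in> b ` carrier (exterior_kernel K L (carrier L) (carrier L))"
      by (metis imageI)
  qed
qed

text \<open>The maps are those of the free presentation and of the snake lemma, with the kernels and cokernels of \<open>\<lambda>\<close> on
  exterior squares replaced by the isomorphic homology spaces. The terms
  that are not replaced are transported along the identity.\<close>

theorem theorem4p7:
  fixes K :: "('k, 'z) ring_scheme"
    and \<mm> :: "('k, 'm) hom_alg" and \<kk> :: "('k, 'l) hom_alg" and \<gg> :: "('k, 'g) hom_alg"
    and \<rr> :: "('k, 'r) hom_alg" and \<ff> :: "('k, 'f) hom_alg" and \<vv> :: "('k, 'v) hom_space"
    and i :: "'m \<Rightarrow> 'l" and \<pi> :: "'l \<Rightarrow> 'g" and j :: "'r \<Rightarrow> 'f" and \<rho> :: "'f \<Rightarrow> 'l"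
    and \<iota> :: "'v \<Rightarrow> 'f"
    and M :: "'l set" and R S :: "'f set"
  assumes "field K"
    and extension: "hl_short_exact K \<mm> i \<kk> \<pi> \<gg>"
    and presentation: "hl_short_exact K \<rr> j \<ff> \<rho> \<kk>"
    and free: "free_hom_leibniz K \<vv> \<iota> \<ff>"
    and M_def: "M = i ` carrier \<mm>"
    and R_def: "R = j ` carrier \<rr>"
    and ideal_S: "hl_ideal K \<ff> S" "R \<subseteq> S"
    and S_M: "\<rho> ` S = M"
  shows "\<exists>\<theta>1 \<theta>2 \<theta>3 \<theta>4 \<theta>5 \<theta>6 \<theta>7.
    \<theta>1 \<in> hs_hom K (exterior_kernel K \<ff> R (carrier \<ff>)) (exterior_kernel K \<ff> S (carrier \<ff>))
  \<and> \<theta>2 \<in> hs_hom K (exterior_kernel K \<ff> S (carrier \<ff>)) (exterior_kernel K \<kk> M (carrier \<kk>))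
  \<and> \<theta>3 \<in> hs_hom K (exterior_kernel K \<kk> M (carrier \<kk>)) (HL K \<kk> 2)
  \<and> \<theta>4 \<in> hs_hom K (HL K \<kk> 2) (HL K \<gg> 2)
  \<and> \<theta>5 \<in> hs_hom K (HL K \<gg> 2) (hs_quot (\<kk>\<lparr>carrier := M\<rparr>) (ideal_commutator K \<kk> M (carrier \<kk>)))
  \<and> \<theta>6 \<in> hs_hom K (hs_quot (\<kk>\<lparr>carrier := M\<rparr>) (ideal_commutator K \<kk> M (carrier \<kk>))) (HL K \<kk> 1)
  \<and> \<theta>7 \<in> hs_hom K (HL K \<kk> 1) (HL K \<gg> 1)
  \<and> exact_at (exterior_kernel K \<ff> R (carrier \<ff>)) \<theta>1
      (exterior_kernel K \<ff> S (carrier \<ff>)) \<theta>2 (exterior_kernel K \<kk> M (carrier \<kk>))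
  \<and> exact_at (exterior_kernel K \<ff> S (carrier \<ff>)) \<theta>2
      (exterior_kernel K \<kk> M (carrier \<kk>)) \<theta>3 (HL K \<kk> 2)
  \<and> exact_at (exterior_kernel K \<kk> M (carrier \<kk>)) \<theta>3 (HL K \<kk> 2) \<theta>4 (HL K \<gg> 2)
  \<and> exact_at (HL K \<kk> 2) \<theta>4 (HL K \<gg> 2) \<theta>5
      (hs_quot (\<kk>\<lparr>carrier := M\<rparr>) (ideal_commutator K \<kk> M (carrier \<kk>)))
  \<and> exact_at (HL K \<gg> 2) \<theta>5
      (hs_quot (\<kk>\<lparr>carrier := M\<rparr>) (ideal_commutator K \<kk> M (carrier \<kk>))) \<theta>6 (HL K \<kk> 1)
  \<and> exact_at (hs_quot (\<kk>\<lparr>carrier := M\<rparr>) (ideal_commutator K \<kk> M (carrier \<kk>))) \<theta>6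
      (HL K \<kk> 1) \<theta>7 (HL K \<gg> 1)
  \<and> \<theta>7 ` carrier (HL K \<kk> 1) = carrier (HL K \<gg> 1)
  \<and> (hl_split K \<kk> \<pi> \<gg> \<longrightarrow>
        inj_on \<theta>3 (carrier (exterior_kernel K \<kk> M (carrier \<kk>)))
      \<and> exact_at (exterior_kernel K \<kk> M (carrier \<kk>)) \<theta>3 (HL K \<kk> 2) \<theta>4 (HL K \<gg> 2)
      \<and> \<theta>4 ` carrier (HL K \<kk> 2) = carrier (HL K \<gg> 2))"
proof -
  note k = short_exactD[OF extension] and f = short_exactD[OF presentation]
  have M: "M = a_kernel \<kk> \<gg> \<pi>" using k(5) M_def by simp
  have R: "R = a_kernel \<ff> \<kk> \<rho>" using f(5) R_def by simp
  have M_ideal: "hl_ideal K \<kk> M" unfolding M by (rule kernel_ideal[OF k(1,2,3)])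
  have ideals: "leibniz_ideal K \<kk> M" "leibniz_ideal K \<kk> (carrier \<kk>)" "leibniz_ideal K \<gg> (carrier \<gg>)"
    "leibniz_ideal K \<ff> R" "leibniz_ideal K \<ff> S"
    using k(1,2) f(1) M_ideal hom_leibniz.whole_ideal[OF k(1)] hom_leibniz.whole_ideal[OF k(2)]
      kernel_ideal[OF f(1,2,3)] R ideal_S(1)
    by (simp_all add: leibniz_ideal_def leibniz_ideal_axioms_def)
  interpret M: leibniz_ideal K \<kk> M by fact
  interpret k: leibniz_ideal K \<kk> "carrier \<kk>" by fact
  interpret g: leibniz_ideal K \<gg> "carrier \<gg>" by fact
  have id: "(\<lambda>x. x) \<in> hl_hom K \<kk> \<kk>" by (simp add: hl_hom_def hs_hom_id)
  obtain a where a: "a \<in> hs_hom K M.ext k.ext"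
    "\<And>x y. \<lbrakk>x \<in> carrier \<kk>; y \<in> carrier \<kk>; x \<in> M \<or> y \<in> M\<rbrakk> \<Longrightarrow> a (wedge K \<kk> M x y) = wedge K \<kk> (carrier \<kk>) x y"
    "\<And>u. u \<in> carrier M.ext \<Longrightarrow> exterior_map \<kk> (a u) = exterior_map \<kk> u"
    by (rule exterior_functorial[OF ideals(1,2) id]) (use M.M_subset in auto)
  obtain b where b: "b \<in> hs_hom K k.ext g.ext"
    "\<And>x y. \<lbrakk>x \<in> carrier \<kk>; y \<in> carrier \<kk>\<rbrakk> \<Longrightarrow> b (wedge K \<kk> (carrier \<kk>) x y) = wedge K \<gg> (carrier \<gg>) (\<pi> x) (\<pi> y)"
    "\<And>u. u \<in> carrier k.ext \<Longrightarrow> exterior_map \<gg> (b u) = \<pi> (exterior_map \<kk> u)"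
    by (rule exterior_functorial[OF ideals(2,3) k(3)]) (use k(4) in auto)
  have ab: "a ` carrier M.ext = a_kernel k.ext g.ext b" "b ` carrier k.ext = carrier g.ext"
    by (rule exterior_right_exact[OF ideals(1,2,3) k(3,4) M M.M_subset k(4) a(1,2) b(1)];
        simp add: b(2))+
  let ?KR = "exterior_kernel K \<ff> R (carrier \<ff>)" and ?KS = "exterior_kernel K \<ff> S (carrier \<ff>)"
    and ?KM = "exterior_kernel K \<kk> M (carrier \<kk>)" and ?Kk = "exterior_kernel K \<kk> (carrier \<kk>) (carrier \<kk>)"
    and ?Kg = "exterior_kernel K \<gg> (carrier \<gg>) (carrier \<gg>)"
  let ?QM = "hs_quot (\<kk>\<lparr>carrier := M\<rparr>) (ideal_commutator K \<kk> M (carrier \<kk>))"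
    and ?Qk = "hs_quot \<kk> (exterior_map \<kk> ` carrier k.ext)"
    and ?Qg = "hs_quot \<gg> (exterior_map \<gg> ` carrier g.ext)"
  have \<pi>: "hs_map K \<kk> \<gg> \<pi>"
    by (rule hs_mapI[OF M.vs g.vs hl_homD(1)[OF k(3)]])
  note snake = snake[OF hs_mapI[OF M.EV.vs k.EV.vs a(1)]
      hs_mapI[OF k.EV.vs g.EV.vs b(1)]
      M.lam.hs_map_axioms k.lam.hs_map_axioms g.lam.hs_map_axioms \<pi> a(3) b(3) ab M k(4),
      folded exterior_kernel_def M.ideal_commutator_eq]
  obtain \<theta>5 \<theta>6 \<theta>7 where \<theta>: "\<theta>5 \<in> hs_hom K ?Kg ?QM" "\<theta>6 \<in> hs_hom K ?QM ?Qk" "\<theta>7 \<in> hs_hom K ?Qk ?Qg"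
    and ex: "exact_at ?Kk b ?Kg \<theta>5 ?QM" "exact_at ?Kg \<theta>5 ?QM \<theta>6 ?Qk" "exact_at ?QM \<theta>6 ?Qk \<theta>7 ?Qg"
    and onto: "\<theta>7 ` carrier ?Qk = carrier ?Qg"
    using snake(4) by blast
  obtain \<theta>1 \<theta>2 where \<theta>12: "\<theta>1 \<in> hs_hom K ?KR ?KS" "\<theta>2 \<in> hs_hom K ?KS ?KM"
    and ex12: "exact_at ?KR \<theta>1 ?KS \<theta>2 ?KM" "exact_at ?KS \<theta>2 ?KM a ?Kk"
    using exterior_kernel_exact_free[OF free f(2,3,4) R ideal_S(2,1) S_M M_ideal a(1,2)] by blast
  obtain \<Phi>k where \<Phi>k: "hs_iso K ?Kk (HL K \<kk> 2) \<Phi>k" using hom_leibniz.HL_2_iso[OF k(1)] by blast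
  obtain \<Phi>g where \<Phi>g: "hs_iso K ?Kg (HL K \<gg> 2) \<Phi>g" using hom_leibniz.HL_2_iso[OF k(2)] by blast
  obtain \<Psi>k where \<Psi>k: "hs_iso K ?Qk (HL K \<kk> 1) \<Psi>k" using hom_leibniz.HL_1_iso[OF k(1)] by blast
  obtain \<Psi>g where \<Psi>g: "hs_iso K ?Qg (HL K \<gg> 1) \<Psi>g" using hom_leibniz.HL_1_iso[OF k(2)] by blast
  note iR = hs_iso_id[OF exterior_kernel_hom_vector_space[OF ideals(4)]]
    and iS = hs_iso_id[OF exterior_kernel_hom_vector_space[OF ideals(5)]]
    and iM = hs_iso_id[OF exterior_kernel_hom_vector_space[OF ideals(1)]]
  have "hom_vector_space K ?QM"
  proof -
    have "hs_subspace K (\<kk>\<lparr>carrier := M\<rparr>) (ideal_commutator K \<kk> M (carrier \<kk>))"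
    proof -
      have "hs_subspace K \<kk> (ideal_commutator K \<kk> M (carrier \<kk>))"
        unfolding M.ideal_commutator_eq by (rule M.lam.image_subspace[OF M.EV.whole_subspace])
      then show ?thesis
        using M.subspace_restrict_mono[OF M.ideal_subspace _ M.ideal_commutator_subset] by blast
    qed
    then show ?thesis
      using subspace_quotient.quotient_hom_vector_space[OF subspace_quotient_hs_quot[OF M.subspace_restrict[OF M.ideal_subspace]]]
      by blast
  qed
  note iQ = hs_iso_id[OF this]
  let ?id = "\<lambda>x. x"
  let ?t1 = "transport ?KR ?id ?id \<theta>1" and ?t2 = "transport ?KS ?id ?id \<theta>2" and ?t3 = "transport ?KM ?id \<Phi>k a"
    and ?t4 = "transport ?Kk \<Phi>k \<Phi>g b" and ?t5 = "transport ?Kg \<Phi>g ?id \<theta>5"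
    and ?t6 = "transport ?QM ?id \<Psi>k \<theta>6" and ?t7 = "transport ?Qk \<Psi>k \<Psi>g \<theta>7"
  have split: "inj_on ?t3 (carrier ?KM) \<and> exact_at ?KM ?t3 (HL K \<kk> 2) ?t4 (HL K \<gg> 2)
      \<and> ?t4 ` carrier (HL K \<kk> 2) = carrier (HL K \<gg> 2)" if split: "hl_split K \<kk> \<pi> \<gg>"
  proof (intro conjI)
    note inj = exterior_kernel_split[OF k(1,2,3) M split a(1,2) b(1,2)]
    have "inj_on \<Phi>k (carrier ?Kk)" using \<Phi>k by (simp add: hs_iso_def bij_betw_def)
    then have "inj_on \<Phi>k (a ` carrier ?KM)"
      by (rule inj_on_subset) (use hs_homD(1)[OF snake(1)] in blast)
    then have "inj_on (\<Phi>k \<circ> a) (carrier ?KM)" using inj(1) by (intro comp_inj_on)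
    then show "inj_on ?t3 (carrier ?KM)"
      by (rule iffD1[OF inj_on_cong, rotated]) (simp add: transport_apply[OF iM])
    show "exact_at ?KM ?t3 (HL K \<kk> 2) ?t4 (HL K \<gg> 2)"
      by (rule transport_exact[OF iM \<Phi>k \<Phi>g snake(2,3)])
    have "b ` carrier ?Kk = carrier ?Kg" using inj(2) hs_homD(1)[OF snake(2)] by blast
    then show "?t4 ` carrier (HL K \<kk> 2) = carrier (HL K \<gg> 2)"
      using \<Phi>g by (simp add: transport_image[OF \<Phi>k] hs_iso_def bij_betw_def)
  qed
  have onto7: "?t7 ` carrier (HL K \<kk> 1) = carrier (HL K \<gg> 1)"
    using \<Psi>g by (simp add: transport_image[OF \<Psi>k] onto hs_iso_def bij_betw_def)
  show ?thesis
    by (intro exI[of _ ?t1] exI[of _ ?t2] exI[of _ ?t3] exI[of _ ?t4] exI[of _ ?t5] exI[of _ ?t6]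
        exI[of _ ?t7] conjI impI onto7 split
        transport_hom[OF iR iS \<theta>12(1)] transport_hom[OF iS iM \<theta>12(2)] transport_hom[OF iM \<Phi>k snake(1)]
        transport_hom[OF \<Phi>k \<Phi>g snake(2)] transport_hom[OF \<Phi>g iQ \<theta>(1)]
        transport_hom[OF iQ \<Psi>k \<theta>(2)] transport_hom[OF \<Psi>k \<Psi>g \<theta>(3)]
        transport_exact[OF iR iS iM \<theta>12(2) ex12(1)] transport_exact[OF iS iM \<Phi>k snake(1) ex12(2)]
        transport_exact[OF iM \<Phi>k \<Phi>g snake(2,3)] transport_exact[OF \<Phi>k \<Phi>g iQ \<theta>(1) ex(1)]
        transport_exact[OF \<Phi>g iQ \<Psi>k \<theta>(2) ex(2)] transport_exact[OF iQ \<Psi>k \<Psi>g \<theta>(3) ex(3)])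
qed

end
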